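(* Let $n\ge1$, $\alpha>-1$, $0<p\le1$, and $\Phi_1,\Phi_2\in\mathscr L_p$. Suppose moreover that $\int_1^\infty\frac{\Phi_2(t)}{t^2}dt<\infty$. Then $h_b$ extends into a bounded operator from $\mathcal A_\alpha^{\Phi_1}(\mathbb B^n)$ into $\mathcal A_\alpha^{\Phi_2}(\mathbb B^n)$ if and only if the symbol $b$ belongs to $\Gamma_{\alpha,\rho_1}(\mathbb B^n)$, where $\rho_1(t)=\frac{1}{t\Phi_1^{-1}(1/t)}$.
   Context: $\mathbb B^n$ is the unit ball of $\mathbb C^n$, $d\nu$ is Lebesgue measure on it, and $d\nu_\alpha(z)=c_\alpha(1-|z|^2)^\alpha d\nu(z)$ with $\nu_\alpha(\mathbb B^n)=1$. A growth function is a continuous non-decreasing function from $[0,\infty)$ onto itself. $\mathscr L_p$ ($0<p\le1$): growth functions $\Phi$ of lower type $p$ ($\Phi(st)\le Ct^p\Phi(s)$ for all $s>0$, $0<t\le1$, some $C>0$) with $\Phi(t)/t$ non-increasing. Equivalent growth functions ($c\Phi_1(ct)\le\Phi_2(t)\le c^{-1}\Phi_1(c^{-1}t)$ for some $c>0$) define the same spaces; by convention members of $\mathscr L_p$ are supposed concave and $C^1$ with $\Phi'(t)\simeq\Phi(t)/t$. $\mathcal A_\alpha^\Phi(\mathbb B^n)$ is the space of holomorphic $f$ on $\mathbb B^n$ with $\int_{\mathbb B^n}\Phi(|f|)\,d\nu_\alpha<\infty$, with (quasi-)norm $\|f\|^{lux}_{\alpha,\Phi}=\inf\{\lambda>0:\int\Phi(|f|/\lambda)\,d\nu_\alpha\le1\}$.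 $\mathcal A^2_\alpha$ is the case $\Phi(t)=t^2$. $P_\alpha f(z)=\int_{\mathbb B^n}\frac{f(\xi)}{(1-\langle z,\xi\rangle)^{n+1+\alpha}}d\nu_\alpha(\xi)$ is the Bergman projection. For a symbol $b\in\mathcal A_\alpha^2(\mathbb B^n)$ the small Hankel operator is defined on bounded holomorphic $f$ by $h_b(f)=P_\alpha(b\overline f)$. "$h_b$ extends into a bounded operator from $\mathcal A_\alpha^{\Phi_1}$ into $\mathcal A_\alpha^{\Phi_2}$" means there is $C$ with $\|h_b(f)\|^{lux}_{\alpha,\Phi_2}\le C\|f\|^{lux}_{\alpha,\Phi_1}$ for all bounded holomorphic $f$. $Rf(z)=\sum_{j}z_j\frac{\partial f}{\partial z_j}(z)$. A positive function $\rho$ is of upper type $\gamma$ on $[0,1]$ if $\rho(st)\le Cs^\gamma\rho(t)$ for $s>1$, $st\le1$; $\rho_1$ above is of upper type $\gamma=\frac1p-1$. For $\rho$ of upper type $\gamma$, $\Gamma_{\alpha,\rho}(\mathbb B^n)$ is the space of holomorphic $f$ on $\mathbb B^n$ such that for some integer $k>\gamma(n+1+\alpha)$ and some $C>0$, $|R^kf(z)|\le C(1-|z|^2)^{-k}\rho\big((1-|z|^2)^{n+1+\alpha}\big)$ for all $z\in\mathbb B^n$; it does not depend on the choice of such $k$. *)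

theory Defs
  imports "HOL-Analysis.Analysis"
begin

definition growth_function :: "(real \<Rightarrow> real) \<Rightarrow> bool" where
  "growth_function \<Phi> \<longleftrightarrow>
     continuous_on {0..} \<Phi> \<and> mono_on {0..} \<Phi> \<and> \<Phi> ` {0..} = {0..}"

definition lower_type :: "real \<Rightarrow> (real \<Rightarrow> real) \<Rightarrow> bool" where
  "lower_type p \<Phi> \<longleftrightarrow>
     (\<exists>C>0. \<forall>s>0. \<forall>t. 0 < t \<and> t \<le> 1 \<longrightarrow> \<Phi> (s * t) \<le> C * t powr p * \<Phi> s)"

text \<open>The last two conjuncts are the usual normalisation: every growth function satisfying the
  other conditions is equivalent to one that is moreover concave and continuously differentiable
  on the open half-line, with derivative comparable to \<open>\<Phi> t / t\<close>.  In particular members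
  of the class are strictly increasing on \<open>[0, \<infinity>)\<close>, so that they have a genuine inverse there.\<close>

definition growth_class :: "real \<Rightarrow> (real \<Rightarrow> real) set" where
  "growth_class p = {\<Phi>. growth_function \<Phi> \<and> lower_type p \<Phi> \<and>
     antimono_on {0<..} (\<lambda>t. \<Phi> t / t) \<and>
     concave_on {0..} \<Phi> \<and>
     (\<exists>\<Phi>'. (\<forall>t>0. (\<Phi> has_real_derivative \<Phi>' t) (at t)) \<and> continuous_on {0<..} \<Phi>' \<and>
       (\<exists>c>0. \<forall>t>0. c * (\<Phi> t / t) \<le> \<Phi>' t \<and> \<Phi>' t \<le> inverse c * (\<Phi> t / t)))}"

definition holomorphic_ball :: "(complex ^ 'n \<Rightarrow> complex) \<Rightarrow> bool" where
  "holomorphic_ball f \<longleftrightarrow>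
     (\<forall>z\<in>ball 0 1. \<exists>D. (f has_derivative D) (at z) \<and> (\<forall>c v. D (c *s v) = c * D v))"

definition hermitian_inner :: "complex ^ 'n \<Rightarrow> complex ^ 'n \<Rightarrow> complex" where
  "hermitian_inner z w = (\<Sum>j\<in>UNIV. z $ j * cnj (w $ j))"

text \<open>The measure lives on the ball as its underlying space, so that the values of functions
  outside the ball play no role, not even for measurability.\<close>

definition weight_const :: "'n::finite itself \<Rightarrow> real \<Rightarrow> real" where
  "weight_const _ \<alpha> =
     1 / (LINT z|restrict_space lborel (ball (0 :: complex ^ 'n) 1). (1 - (norm z)\<^sup>2) powr \<alpha>)"

definition weighted_measure :: "real \<Rightarrow> (complex ^ 'n) measure" where
  "weighted_measure \<alpha> =
     density (restrict_space lborel (ball 0 1))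
       (\<lambda>z. ennreal (weight_const TYPE('n) \<alpha> * (1 - (norm z)\<^sup>2) powr \<alpha>))"

definition bergman_orlicz :: "real \<Rightarrow> (real \<Rightarrow> real) \<Rightarrow> (complex ^ 'n \<Rightarrow> complex) set" where
  "bergman_orlicz \<alpha> \<Phi> = {f. holomorphic_ball f \<and>
     (\<integral>\<^sup>+ z. ennreal (\<Phi> (cmod (f z))) \<partial>weighted_measure \<alpha>) < \<infinity>}"

text \<open>Extended-valued, so that the infimum of the empty set is infinite.\<close>

definition lux_norm ::
  "real \<Rightarrow> (real \<Rightarrow> real) \<Rightarrow> (complex ^ 'n \<Rightarrow> complex) \<Rightarrow> ennreal" where
  "lux_norm \<alpha> \<Phi> f = Inf {ennreal r | r. r > 0 \<and>
     (\<integral>\<^sup>+ z. ennreal (\<Phi> (cmod (f z) / r)) \<partial>weighted_measure \<alpha>) \<le> 1}"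

definition bergman_projection ::
  "real \<Rightarrow> (complex ^ 'n \<Rightarrow> complex) \<Rightarrow> complex ^ 'n \<Rightarrow> complex" where
  "bergman_projection \<alpha> f z =
     (LINT \<xi>|weighted_measure \<alpha>.
        f \<xi> / (1 - hermitian_inner z \<xi>) powr of_real (real CARD('n) + 1 + \<alpha>))"

definition small_hankel ::
  "real \<Rightarrow> (complex ^ 'n \<Rightarrow> complex) \<Rightarrow> (complex ^ 'n \<Rightarrow> complex) \<Rightarrow>
   complex ^ 'n \<Rightarrow> complex" where
  "small_hankel \<alpha> b f = bergman_projection \<alpha> (\<lambda>\<xi>. b \<xi> * cnj (f \<xi>))"

definition hankel_extends_bounded ::
  "real \<Rightarrow> (real \<Rightarrow> real) \<Rightarrow> (real \<Rightarrow> real) \<Rightarrow> (complex ^ 'n \<Rightarrow> complex) \<Rightarrow> bool" where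
  "hankel_extends_bounded \<alpha> \<Phi>1 \<Phi>2 b \<longleftrightarrow>
     (\<exists>C::real. \<forall>f. holomorphic_ball f \<and> bounded (f ` ball 0 1) \<longrightarrow>
        lux_norm \<alpha> \<Phi>2 (small_hankel \<alpha> b f) \<le> ennreal C * lux_norm \<alpha> \<Phi>1 f)"

definition radial_deriv ::
  "(complex ^ 'n \<Rightarrow> complex) \<Rightarrow> complex ^ 'n \<Rightarrow> complex" where
  "radial_deriv f z = (\<Sum>j\<in>UNIV. z $ j * deriv (\<lambda>h. f (z + axis j h)) 0)"

text \<open>The parameter \<open>\<gamma>\<close> is an upper type of \<open>\<rho>\<close>; it only determines which orders \<open>k\<close> are admitted.\<close>

definition Gamma_space ::
  "real \<Rightarrow> real \<Rightarrow> (real \<Rightarrow> real) \<Rightarrow> (complex ^ 'n \<Rightarrow> complex) set" where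
  "Gamma_space \<alpha> \<gamma> \<rho> = {f. holomorphic_ball f \<and>
     (\<exists>k::nat. real k > \<gamma> * (real CARD('n) + 1 + \<alpha>) \<and>
       (\<exists>C>0. \<forall>z\<in>ball 0 1.
          cmod ((radial_deriv ^^ k) f z)
            \<le> C * (1 - (norm z)\<^sup>2) powr (- real k)
                * \<rho> ((1 - (norm z)\<^sup>2) powr (real CARD('n) + 1 + \<alpha>))))}"

definition dual_weight :: "(real \<Rightarrow> real) \<Rightarrow> real \<Rightarrow> real" where
  "dual_weight \<Phi> t = 1 / (t * inv_into {0..} \<Phi> (1 / t))"

end

theory Submission
  imports Defs "HOL-Complex_Analysis.Complex_Analysis"
begin

text \<open>The reproducing formula for the weight \<open>\<alpha>\<close> is obtained from the one for the Gaussian weight on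
  the whole space, where it is a translation followed by the mean value property: both weights are
  radial, so on the homogeneous parts of a holomorphic function they differ only by a constant.
  Evaluated on powers of the kernel, the reproducing formula bounds the volumes of the balls of the
  quasi-metric \<open>\<bar>1 - \<langle>z,w\<rangle>\<bar>\<close> and yields the Forelli--Rudin estimates, the pointwise estimate in the
  Bergman--Orlicz spaces and the weak type \<open>(1,1)\<close> of the projection.

  If \<open>h\<^sub>b\<close> is bounded, evaluation of \<open>h\<^sub>b f\<close> at the origin shows that \<open>f \<mapsto> \<integral> b (cnj f)\<close> is bounded on the
  source space; tested on radial derivatives of the kernel this is the growth condition on
  \<open>R\<^sup>k b\<close>. Conversely, that condition represents \<open>b\<close> as the projection of a function \<open>g\<close> bounded by the
  dual weight, so that \<open>h\<^sub>b f\<close> is the projection of \<open>g (cnj f)\<close>, whose \<open>L\<^sup>1\<close> norm is controlled by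
  \<open>\<integral> \<Phi>1 \<bar>f\<bar>\<close>; the integral condition on \<open>\<Phi>2\<close> turns the weak type bound into membership in the target space.\<close>

section \<open>Hermitian inner product and invariance of Lebesgue measure\<close>

text \<open>Concave \<Phi>1 and \<Phi>2 leave no duality of normed spaces to lean on, so the
  argument runs on the modular of f, normalised to be at most 1. Modular and symbol are linked by
  the identity \<rho>1(y^N) = \<Phi>1(s)/s, with N = n + 1 + \<alpha>, y = 1 - |z|^2 and s the value
  at y^(-N) of the inverse of \<Phi>1. Up to a constant, s is the largest size that the pointwise
  estimate allows for |f z|, and \<Phi>1(t)/t is non-increasing; hence \<rho>1(y^N) |f z| is at most
  a constant times \<Phi>1 |f z|, and g (cnj f) lies in L^1. At this endpoint the projection is not
  bounded. Only a distribution bound C/l survives; integrating the derivative of \<Phi>2, comparable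
  to \<Phi>2(t)/t, against it produces the integral of \<Phi>2(t)/t^2. The order condition k > (1/p
  - 1) N does two jobs. It is the same as p (N + k) > N, which gives Forelli-Rudin control of
  \<Phi>1 applied to k-fold radial derivatives of the kernel. It also makes y^(-k) \<rho>1(y^N)
  almost decreasing in y, so that a bound on R^k b descends to all lower orders.\<close>

lemma hermitian_inner_scale_left: "hermitian_inner (c *s z) w = c * hermitian_inner z w"
  by (simp add: hermitian_inner_def sum_distrib_left mult.assoc)

lemma hermitian_inner_scale_right: "hermitian_inner z (c *s w) = cnj c * hermitian_inner z w"
  by (simp add: hermitian_inner_def sum_distrib_left mult_ac)

lemma hermitian_inner_add_left: "hermitian_inner (x + y) w = hermitian_inner x w + hermitian_inner y w"
  by (simp add: hermitian_inner_def sum.distrib distrib_right)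

lemma hermitian_inner_add_right: "hermitian_inner w (x + y) = hermitian_inner w x + hermitian_inner w y"
  by (simp add: hermitian_inner_def sum.distrib distrib_left)

lemma hermitian_inner_diff_left: "hermitian_inner (x - y) w = hermitian_inner x w - hermitian_inner y w"
  by (simp add: hermitian_inner_def sum_subtractf left_diff_distrib)

lemma hermitian_inner_diff_right: "hermitian_inner w (x - y) = hermitian_inner w x - hermitian_inner w y"
  by (simp add: hermitian_inner_def sum_subtractf right_diff_distrib)

lemma hermitian_inner_zero [simp]: "hermitian_inner 0 w = 0" "hermitian_inner w 0 = 0"
  by (simp_all add: hermitian_inner_def)

lemma cnj_hermitian_inner: "cnj (hermitian_inner z w) = hermitian_inner w z"
  by (simp add: hermitian_inner_def mult.commute)

lemma hermitian_inner_self: "hermitian_inner z z = of_real ((norm z)\<^sup>2)"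
  by (simp add: hermitian_inner_def norm_vec_def L2_set_def sum_nonneg complex_norm_square
      flip: of_real_power)

lemma cmod_hermitian_inner_le: "cmod (hermitian_inner z w) \<le> norm z * norm w"
proof -
  have "cmod (hermitian_inner z w) \<le> (\<Sum>j\<in>UNIV. \<bar>cmod (z $ j)\<bar> * \<bar>cmod (w $ j)\<bar>)"
    unfolding hermitian_inner_def by (rule sum_norm_le) (simp add: norm_mult)
  also have "\<dots> \<le> norm z * norm w"
    unfolding norm_vec_def by (rule L2_set_mult_ineq)
  finally show ?thesis .
qed

lemma norm_vec_scale: "norm (c *s z) = cmod c * norm (z :: complex ^ 'n)"
  unfolding norm_vec_def by (simp add: norm_mult L2_set_right_distrib)

lemma of_real_vec_scale: "of_real r *s z = r *\<^sub>R (z :: complex ^ 'n)"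
  by (simp add: vec_eq_iff) (simp add: scaleR_conv_of_real)

lemma continuous_on_hermitian_inner [continuous_intros]:
  assumes "continuous_on S f" "continuous_on S g"
  shows "continuous_on S (\<lambda>x. hermitian_inner (f x) (g x))"
  unfolding hermitian_inner_def
  by (intro continuous_intros assms)

lemma borel_measurable_hermitian_inner [measurable (raw)]:
  fixes f g :: "'a \<Rightarrow> complex ^ 'n"
  assumes [measurable]: "f \<in> borel_measurable M" "g \<in> borel_measurable M"
  shows "(\<lambda>x. hermitian_inner (f x) (g x)) \<in> borel_measurable M"
proof -
  have "case_prod hermitian_inner \<in> borel_measurable (borel :: ((complex ^ 'n) \<times> (complex ^ 'n)) measure)"
    by (rule borel_measurable_continuous_onI)
      (auto simp: case_prod_beta' intro!: continuous_intros)
  then have "(\<lambda>x. case_prod hermitian_inner (f x, g x)) \<in> borel_measurable M"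
    by (rule measurable_compose[rotated]) (simp add: borel_measurable_Pair)
  then show ?thesis by simp
qed

lemma continuous_on_vec_scale [continuous_intros]:
  fixes g :: "'a::topological_space \<Rightarrow> complex ^ 'n"
  assumes "continuous_on S f" "continuous_on S g"
  shows "continuous_on S (\<lambda>x. f x *s g x)"
  unfolding vector_scalar_mult_def by (intro continuous_intros assms)

lemma borel_measurable_vec_scale [measurable (raw)]:
  fixes f :: "'a \<Rightarrow> complex" and g :: "'a \<Rightarrow> complex ^ 'n"
  assumes [measurable]: "f \<in> borel_measurable M" "g \<in> borel_measurable M"
  shows "(\<lambda>x. f x *s g x) \<in> borel_measurable M"
proof -
  have "(\<lambda>(c, v). c *s v) \<in> borel_measurable (borel :: (complex \<times> (complex ^ 'n)) measure)"
    by (rule borel_measurable_continuous_onI)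
      (auto simp: case_prod_beta' intro!: continuous_intros)
  then have "(\<lambda>x. (\<lambda>(c, v). c *s v) (f x, g x)) \<in> borel_measurable M"
    by (rule measurable_compose[rotated]) (simp add: borel_measurable_Pair)
  then show ?thesis by simp
qed

lemma nn_integral_lborel_translate:
  fixes f :: "'a::euclidean_space \<Rightarrow> ennreal"
  assumes [measurable]: "f \<in> borel_measurable borel"
  shows "(\<integral>\<^sup>+x. f (x + c) \<partial>lborel) = (\<integral>\<^sup>+x. f x \<partial>lborel)"
proof -
  have "(\<integral>\<^sup>+x. f x \<partial>lborel) = (\<integral>\<^sup>+x. f x \<partial>distr lborel borel ((+) c))"
    by (simp only: lborel_distr_plus)
  also have "\<dots> = (\<integral>\<^sup>+x. f (x + c) \<partial>lborel)"
    by (subst nn_integral_distr) (simp_all add: add.commute)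
  finally show ?thesis ..
qed

text \<open>Uniqueness of Haar measure in miniature: with \<open>E\<close> the unit ball, the
  product of two masses is a double integral over x and y in which Fubini and translation invariance
  free the factor of \<open>A\<close> from \<open>T\<close>. An isometry preserves membership in
  \<open>E\<close>, so the constant of proportionality is 1.\<close>

lemma distr_lborel_linear_isometry:
  fixes T :: "'a::euclidean_space \<Rightarrow> 'a"
  assumes lin: "linear T" and iso: "\<And>x. norm (T x) = norm x"
  shows "distr lborel borel T = lborel"
proof (rule measure_eqI)
  have [measurable]: "T \<in> borel_measurable borel"
    by (rule borel_measurable_continuous_onI) (simp add: lin linear_continuous_on linear_conv_bounded_linear[symmetric])
  have "inj T"
    using lin iso by (metis linear_injective_0 norm_eq_zero)
  then have "surj T"
    using lin linear_injective_imp_surjective by blast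
  fix A assume "A \<in> sets (distr lborel borel T)"
  then have [measurable]: "A \<in> sets borel" by simp
  define E where "E = ball (0::'a) 1"
  have [measurable]: "E \<in> sets borel" by (simp add: E_def)
  have E: "emeasure lborel E \<noteq> 0" "emeasure lborel E \<noteq> \<infinity>"
    using emeasure_lborel_ball_finite[of "0::'a" 1] content_ball_pos[of 1 "0::'a"]
    unfolding E_def by (auto simp: measure_def)
  have "emeasure (distr lborel borel T) A * emeasure lborel E
      = (\<integral>\<^sup>+x. indicator A (T x) * emeasure lborel E \<partial>lborel)"
  proof -
    have "emeasure (distr lborel borel T) A = (\<integral>\<^sup>+x. indicator A x \<partial>distr lborel borel T)"
      by simp
    also have "\<dots> = (\<integral>\<^sup>+x. indicator A (T x) \<partial>lborel)"
      by (subst nn_integral_distr) simp_all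
    finally show ?thesis
      by (subst nn_integral_multc) simp_all
  qed
  also have "\<dots> = (\<integral>\<^sup>+x. (\<integral>\<^sup>+y. indicator A (T x) * indicator E (y + - T x) \<partial>lborel) \<partial>lborel)"
    by (subst nn_integral_cmult, measurable)
      (subst nn_integral_lborel_translate[of "\<lambda>y. indicator E y"], simp_all)
  also have "\<dots> = (\<integral>\<^sup>+y. (\<integral>\<^sup>+x. indicator A (T x) * indicator E (y + - T x) \<partial>lborel) \<partial>lborel)"
    by (rule lborel_pair.Fubini'[symmetric]) measurable
  also have "\<dots> = (\<integral>\<^sup>+y. (\<integral>\<^sup>+x. indicator A (T x + y) * indicator E (- T x) \<partial>lborel) \<partial>lborel)"
  proof (rule nn_integral_cong)
    \<comment> \<open>Surjectivity makes \<open>y\<close> an image \<open>T w\<close>; shifting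
      \<open>x\<close> by \<open>w\<close> then moves \<open>y\<close> from the second factor to the
      first.\<close>
    fix y obtain w where w: "y = T w" using \<open>surj T\<close> by (metis surjD)
    have "(\<integral>\<^sup>+x. indicator A (T x) * indicator E (y + - T x) \<partial>lborel)
      = (\<integral>\<^sup>+x. indicator A (T (x + w)) * indicator E (y + - T (x + w)) \<partial>lborel)"
      by (rule nn_integral_lborel_translate[of "\<lambda>x. indicator A (T x) * indicator E (y + - T x)" w, symmetric])
        measurable
    then show "(\<integral>\<^sup>+x. indicator A (T x) * indicator E (y + - T x) \<partial>lborel)
      = (\<integral>\<^sup>+x. indicator A (T x + y) * indicator E (- T x) \<partial>lborel)"
      by (simp add: w linear_add[OF lin])
  qed
  also have "\<dots> = (\<integral>\<^sup>+x. (\<integral>\<^sup>+y. indicator A (T x + y) * indicator E (- T x) \<partial>lborel) \<partial>lborel)"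
    by (rule lborel_pair.Fubini') measurable
  also have "\<dots> = (\<integral>\<^sup>+x. emeasure lborel A * indicator E x \<partial>lborel)"
  proof (rule nn_integral_cong)
    fix x
    have "(\<integral>\<^sup>+y. indicator A (T x + y) * indicator E (- T x) \<partial>lborel)
      = (\<integral>\<^sup>+y. indicator A (y + T x) \<partial>lborel) * indicator E (- T x)"
      by (subst nn_integral_multc) (simp_all add: add.commute)
    also have "(\<integral>\<^sup>+y. indicator A (y + T x) \<partial>lborel) = emeasure lborel A"
      by (subst nn_integral_lborel_translate[of "\<lambda>y. indicator A y"]) simp_all
    finally show "(\<integral>\<^sup>+y. indicator A (T x + y) * indicator E (- T x) \<partial>lborel)
      = emeasure lborel A * indicator E x"
      by (simp add: E_def indicator_def iso)
  qed
  also have "\<dots> = emeasure lborel A * emeasure lborel E"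
    by (simp add: nn_integral_cmult)
  finally show "emeasure (distr lborel borel T) A = emeasure lborel A"
    using E by (simp add: mult.commute[of _ "emeasure lborel E"] ennreal_mult_cancel_left)
qed simp

lemma distr_lborel_vec_scale:
  assumes "cmod c = 1"
  shows "distr lborel borel ((*s) c) = (lborel :: (complex ^ 'n) measure)"
proof (rule distr_lborel_linear_isometry)
  show "linear ((*s) c :: complex ^ 'n \<Rightarrow> _)"
    by (rule linearI) (simp_all add: vec_eq_iff algebra_simps)
qed (simp add: norm_vec_scale assms)

section \<open>Integrals of homogeneous functions\<close>

lemma nn_integral_lborel_scale:
  fixes f :: "'a::euclidean_space \<Rightarrow> ennreal"
  assumes [measurable]: "f \<in> borel_measurable borel" and "c > 0"
  shows "(\<integral>\<^sup>+x. f x \<partial>lborel) = ennreal (c ^ DIM('a)) * (\<integral>\<^sup>+x. f (c *\<^sub>R x) \<partial>lborel)"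
proof -
  have "(\<integral>\<^sup>+x. f x \<partial>lborel)
      = (\<integral>\<^sup>+x. f x \<partial>density (distr lborel borel (\<lambda>x. 0 + c *\<^sub>R x)) (\<lambda>_. ennreal (\<bar>c\<bar> ^ DIM('a))))"
    using lborel_affine[of c "0::'a"] assms by simp
  also have "\<dots> = ennreal (c ^ DIM('a)) * (\<integral>\<^sup>+x. f (c *\<^sub>R x) \<partial>lborel)"
    using assms by (simp add: nn_integral_density nn_integral_distr nn_integral_cmult)
  finally show ?thesis .
qed

text \<open>The half-open interval is the part in \<open>{0..}\<close> of the generators
  \<open>{..<a}\<close> on which two measures are compared below.\<close>

lemma nn_integral_powr_from_0:
  assumes "k > 0" "c \<ge> 0"
  shows "(\<integral>\<^sup>+s. ennreal (k * s powr (k - 1)) * indicator {0..<c} s \<partial>lborel) = ennreal (c powr k)"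
proof -
  have "((\<lambda>x. k * x powr (k - 1)) has_integral (k * (c powr (k - 1 + 1) / (k - 1 + 1)))) {0..c}"
    using assms by (intro has_integral_mult_right has_integral_powr_from_0) auto
  then have "(\<integral>\<^sup>+s. ennreal (k * s powr (k - 1)) * indicator {0..c} s \<partial>lborel) = ennreal (c powr k)"
    using assms nn_integral_has_integral_lebesgue'[of "{0..c}" "\<lambda>s. k * s powr (k - 1)"] by simp
  moreover have "(\<integral>\<^sup>+s. ennreal (k * s powr (k - 1)) * indicator {0..<c} s \<partial>lborel)
     = (\<integral>\<^sup>+s. ennreal (k * s powr (k - 1)) * indicator {0..c} s \<partial>lborel)"
    by (intro nn_integral_cong_AE AE_I[where N="{c}"]) (auto simp: indicator_def)
  ultimately show ?thesis by simp
qed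

text \<open>Both sides are integrals of \<open>\<phi>\<close> against measures on the line, which agree on the
  intervals \<open>{..<a}\<close> by homogeneity.\<close>

lemma nn_integral_radial:
  fixes h :: "'a::euclidean_space \<Rightarrow> real" and d :: nat
  defines "k \<equiv> (real d + real DIM('a)) / 2"
  assumes [measurable]: "h \<in> borel_measurable borel" "\<phi> \<in> borel_measurable borel"
    and nonneg: "\<And>x. h x \<ge> 0" and hom: "\<And>t x. t > 0 \<Longrightarrow> h (t *\<^sub>R x) = t ^ d * h x"
    and fin: "(\<integral>\<^sup>+x. ennreal (h x) * indicator (ball 0 1) x \<partial>lborel) < \<infinity>"
  shows "(\<integral>\<^sup>+x. ennreal (h x) * \<phi> ((norm x)\<^sup>2) \<partial>lborel)
    = (\<integral>\<^sup>+x. ennreal (h x) * indicator (ball 0 1) x \<partial>lborel)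
      * (\<integral>\<^sup>+s. ennreal (k * s powr (k - 1)) * indicator {0..} s * \<phi> s \<partial>lborel)"
proof -
  have [measurable]: "ball (0::'a) 1 \<in> sets borel" by simp
  define H where "H = (\<integral>\<^sup>+x. ennreal (h x) * indicator (ball 0 1) x \<partial>lborel)"
  have k: "k > 0" using DIM_positive[where 'a='a] by (simp add: k_def add_nonneg_pos)
  define M1 where "M1 = distr (density lborel (\<lambda>x. ennreal (h x))) borel (\<lambda>x. (norm x)\<^sup>2)"
  define M2 where "M2 = density lborel (\<lambda>s. H * (ennreal (k * s powr (k - 1)) * indicator {0..} s))"
  have M2: "emeasure M2 {..<a} = H * ennreal (max a 0 powr k)" for a :: real
  proof -
    have "emeasure M2 {..<a} = (\<integral>\<^sup>+s. H * (ennreal (k * s powr (k - 1)) * indicator {0..<max a 0} s) \<partial>lborel)"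
      unfolding M2_def by (subst emeasure_density) (auto intro!: nn_integral_cong simp: indicator_def)
    also have "\<dots> = H * ennreal (max a 0 powr k)"
      using k by (subst nn_integral_cmult) (simp_all add: nn_integral_powr_from_0)
    finally show ?thesis .
  qed
  have M1: "emeasure M1 {..<a} = H * ennreal (max a 0 powr k)" for a :: real
  proof (cases "a > 0")
    case True
    have "emeasure M1 {..<a} = (\<integral>\<^sup>+x. ennreal (h x) * indicator {x. (norm x)\<^sup>2 < a} x \<partial>lborel)"
      unfolding M1_def by (subst emeasure_distr) (auto simp: emeasure_density vimage_def)
    also have "\<dots> = ennreal (sqrt a ^ DIM('a)) *
      (\<integral>\<^sup>+x. ennreal (h (sqrt a *\<^sub>R x)) * indicator {x. (norm x)\<^sup>2 < a} (sqrt a *\<^sub>R x) \<partial>lborel)"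
      using True by (intro nn_integral_lborel_scale) measurable
    also have "(\<integral>\<^sup>+x. ennreal (h (sqrt a *\<^sub>R x)) * indicator {x. (norm x)\<^sup>2 < a} (sqrt a *\<^sub>R x) \<partial>lborel)
       = (\<integral>\<^sup>+x. ennreal (sqrt a ^ d) * (ennreal (h x) * indicator (ball 0 1) x) \<partial>lborel)"
    proof (rule nn_integral_cong)
      fix x :: 'a
      have "(norm (sqrt a *\<^sub>R x))\<^sup>2 < a \<longleftrightarrow> norm x < 1"
        using True by (simp add: power_mult_distrib abs_square_less_1)
      then show "ennreal (h (sqrt a *\<^sub>R x)) * indicator {x. (norm x)\<^sup>2 < a} (sqrt a *\<^sub>R x)
        = ennreal (sqrt a ^ d) * (ennreal (h x) * indicator (ball 0 1) x)"
        using True by (simp add: hom indicator_def ennreal_mult nonneg)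
    qed
    also have "\<dots> = ennreal (sqrt a ^ d) * H"
      unfolding H_def by (rule nn_integral_cmult) measurable
    also have "ennreal (sqrt a ^ DIM('a)) * (ennreal (sqrt a ^ d) * H) = H * ennreal (sqrt a ^ (d + DIM('a)))"
      using True by (simp add: power_add ennreal_mult mult_ac)
    \<comment> \<open>The exponent is halved because the line carries the variable s = |x|^2: the
      interval below \<open>a\<close> corresponds to the ball of radius
      \<open>sqrt a\<close>.\<close>
    also have "sqrt a ^ (d + DIM('a)) = a powr k"
      using True by (simp add: k_def powr_half_sqrt[symmetric] powr_powr flip: powr_realpow)
    finally show ?thesis using True by simp
  next
    case False
    then have "{x::'a. (norm x)\<^sup>2 < a} = {}"
      using zero_le_power2 by (smt (verit) Collect_empty_eq)
    then have "emeasure M1 {..<a} = 0"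
      unfolding M1_def by (subst emeasure_distr) (auto simp: emeasure_density vimage_def)
    then show ?thesis using False k by simp
  qed
  have "M1 = M2"
  proof (rule measure_eqI_generator_eq[where E="range lessThan" and \<Omega>=UNIV and A="\<lambda>i. {..<real i}"])
    have "{..<a} \<inter> {..<b} = {..<min a b}" for a b :: real by auto
    then show "Int_stable (range (lessThan :: real \<Rightarrow> _))"
      by (simp add: Int_stable_def)
    show "emeasure M1 X = emeasure M2 X" if "X \<in> range lessThan" for X
      using that M1 M2 by auto
    show "sets M1 = sigma_sets UNIV (range lessThan)" "sets M2 = sigma_sets UNIV (range lessThan)"
      by (simp_all add: M1_def M2_def borel_Iio)
    show "(\<Union>i. {..<real i}) = UNIV"
      using reals_Archimedean2 by auto
    show "emeasure M1 {..<real i} \<noteq> \<infinity>" for i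
      using fin by (simp add: M1 H_def[symmetric] ennreal_mult_eq_top_iff)
  qed auto
  then have "(\<integral>\<^sup>+s. \<phi> s \<partial>M1) = (\<integral>\<^sup>+s. \<phi> s \<partial>M2)" by simp
  also have "(\<integral>\<^sup>+s. \<phi> s \<partial>M1) = (\<integral>\<^sup>+x. ennreal (h x) * \<phi> ((norm x)\<^sup>2) \<partial>lborel)"
    unfolding M1_def by (simp add: nn_integral_distr nn_integral_density)
  also have "(\<integral>\<^sup>+s. \<phi> s \<partial>M2) = H * (\<integral>\<^sup>+s. ennreal (k * s powr (k - 1)) * indicator {0..} s * \<phi> s \<partial>lborel)"
    unfolding M2_def by (simp add: nn_integral_density nn_integral_cmult mult.assoc)
  finally show ?thesis by (simp add: H_def)
qed

text \<open>The profile \<open>\<phi>\<close> enters only through the one-dimensional integral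
  \<open>I\<close>; the factor over the unit ball is the same for all profiles, which is what allows
  one radial weight to be exchanged for another. A signed \<open>h\<close> splits into positive and
  negative parts, both homogeneous of the same degree since t^d > 0.\<close>

lemma has_bochner_integral_radial_real:
  fixes h :: "'a::euclidean_space \<Rightarrow> real" and d :: nat
  defines "k \<equiv> (real d + real DIM('a)) / 2"
  assumes [measurable]: "h \<in> borel_measurable borel" "\<phi> \<in> borel_measurable borel"
    and phi: "\<And>s. \<phi> s \<ge> 0" and hom: "\<And>t x. t > 0 \<Longrightarrow> h (t *\<^sub>R x) = t ^ d * h x"
    and int: "integrable lborel (\<lambda>x. indicator (ball 0 1) x * h x)"
    and I: "(\<integral>\<^sup>+s. ennreal (k * s powr (k - 1)) * indicator {0..} s * ennreal (\<phi> s) \<partial>lborel) = ennreal I"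
    and "I \<ge> 0"
  shows "has_bochner_integral lborel (\<lambda>x. h x * \<phi> ((norm x)\<^sup>2))
    ((LINT x|lborel. indicator (ball 0 1) x * h x) * I)"
proof -
  have *: "has_bochner_integral lborel (\<lambda>x. g x * \<phi> ((norm x)\<^sup>2))
    ((LINT x|lborel. indicator (ball 0 1) x * g x) * I)"
    if [measurable]: "g \<in> borel_measurable borel" and nonneg: "\<And>x. g x \<ge> 0"
      and gh: "\<And>t x. t > 0 \<Longrightarrow> g (t *\<^sub>R x) = t ^ d * g x"
      and gi: "integrable lborel (\<lambda>x. indicator (ball 0 1) x * g x)" for g :: "'a \<Rightarrow> real"
  proof (rule has_bochner_integral_nn_integral)
    have e: "(\<integral>\<^sup>+x. ennreal (g x) * indicator (ball 0 1) x \<partial>lborel)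
      = ennreal (LINT x|lborel. indicator (ball 0 1) x * g x)"
      using nn_integral_eq_integral[OF gi] nonneg
      by (auto intro!: nn_integral_cong simp: indicator_def elim!: trans[rotated])
    have "(\<integral>\<^sup>+x. ennreal (g x * \<phi> ((norm x)\<^sup>2)) \<partial>lborel)
       = (\<integral>\<^sup>+x. ennreal (g x) * ennreal (\<phi> ((norm x)\<^sup>2)) \<partial>lborel)"
      by (intro nn_integral_cong) (simp add: ennreal_mult nonneg phi)
    also have "\<dots> = ennreal (LINT x|lborel. indicator (ball 0 1) x * g x) * ennreal I"
      using e I by (subst nn_integral_radial[where d=d]) (simp_all add: nonneg gh k_def)
    finally show "(\<integral>\<^sup>+x. ennreal (g x * \<phi> ((norm x)\<^sup>2)) \<partial>lborel)
      = ennreal ((LINT x|lborel. indicator (ball 0 1) x * g x) * I)"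
      using \<open>I \<ge> 0\<close> nonneg by (simp add: ennreal_mult)
  qed (use nonneg phi \<open>I \<ge> 0\<close> in auto)
  define hp hm where "hp x = max 0 (h x)" and "hm x = max 0 (- h x)" for x
  have [measurable]: "hp \<in> borel_measurable borel" "hm \<in> borel_measurable borel"
    unfolding hp_def[abs_def] hm_def[abs_def] by measurable
  have scale: "max 0 (t ^ d * y) = t ^ d * max 0 y" if "t > 0" for t y :: real
    using that by (simp add: max_mult_distrib_left)
  have hp: "hp (t *\<^sub>R x) = t ^ d * hp x" if "t > 0" for t x
    using scale[OF that, of "h x"] by (simp add: hp_def hom that)
  have hm: "hm (t *\<^sub>R x) = t ^ d * hm x" if "t > 0" for t x
    using scale[OF that, of "- h x"] by (simp add: hm_def hom that)
  have p: "integrable lborel (\<lambda>x. indicator (ball 0 1) x * hp x)"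
    by (rule Bochner_Integration.integrable_bound[OF int]) (auto simp: hp_def indicator_def)
  have m: "integrable lborel (\<lambda>x. indicator (ball 0 1) x * hm x)"
    by (rule Bochner_Integration.integrable_bound[OF int]) (auto simp: hm_def indicator_def)
  have hpm: "h x = hp x - hm x" for x by (auto simp: hp_def hm_def)
  have "has_bochner_integral lborel (\<lambda>x. hp x * \<phi> ((norm x)\<^sup>2) - hm x * \<phi> ((norm x)\<^sup>2))
    ((LINT x|lborel. indicator (ball 0 1) x * hp x) * I - (LINT x|lborel. indicator (ball 0 1) x * hm x) * I)"
    by (intro has_bochner_integral_diff * p m hp hm) (simp_all add: hp_def hm_def)
  moreover have "(LINT x|lborel. indicator (ball 0 1) x * h x)
    = (LINT x|lborel. indicator (ball 0 1) x * hp x) - (LINT x|lborel. indicator (ball 0 1) x * hm x)"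
    by (subst Bochner_Integration.integral_diff[OF p m, symmetric]) (simp add: hpm right_diff_distrib)
  ultimately show ?thesis by (simp add: left_diff_distrib hpm)
qed

lemma has_bochner_integral_radial:
  fixes h :: "'a::euclidean_space \<Rightarrow> complex" and d :: nat
  defines "k \<equiv> (real d + real DIM('a)) / 2"
  assumes [measurable]: "h \<in> borel_measurable borel" "\<phi> \<in> borel_measurable borel"
    and phi: "\<And>s. \<phi> s \<ge> 0" and hom: "\<And>t x. t > 0 \<Longrightarrow> h (t *\<^sub>R x) = of_real t ^ d * h x"
    and int: "integrable lborel (\<lambda>x. indicator (ball 0 1) x * h x)"
    and I: "(\<integral>\<^sup>+s. ennreal (k * s powr (k - 1)) * indicator {0..} s * ennreal (\<phi> s) \<partial>lborel) = ennreal I"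
    and "I \<ge> 0"
  shows "has_bochner_integral lborel (\<lambda>x. h x * of_real (\<phi> ((norm x)\<^sup>2)))
    ((LINT x|lborel. indicator (ball 0 1) x * h x) * of_real I)"
proof -
  have ind: "indicator A x * h x = (if x \<in> A then h x else 0)"
     "indicator A x * Re (h x) = Re (indicator A x * h x)"
     "indicator A x * Im (h x) = Im (indicator A x * h x)" for A x
    by (auto simp: indicator_def)
  have re: "has_bochner_integral lborel (\<lambda>x. Re (h x) * \<phi> ((norm x)\<^sup>2))
    ((LINT x|lborel. indicator (ball 0 1) x * Re (h x)) * I)"
    using I phi \<open>I \<ge> 0\<close> integrable_Re[OF int] unfolding k_def
    by (intro has_bochner_integral_radial_real[where d=d])
      (auto simp: hom ind simp flip: of_real_power)
  have im: "has_bochner_integral lborel (\<lambda>x. Im (h x) * \<phi> ((norm x)\<^sup>2))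
    ((LINT x|lborel. indicator (ball 0 1) x * Im (h x)) * I)"
    using I phi \<open>I \<ge> 0\<close> integrable_Im[OF int] unfolding k_def
    by (intro has_bochner_integral_radial_real[where d=d])
      (auto simp: hom ind simp flip: of_real_power)
  have "has_bochner_integral lborel
      (\<lambda>x. of_real (Re (h x) * \<phi> ((norm x)\<^sup>2)) + \<i> * of_real (Im (h x) * \<phi> ((norm x)\<^sup>2)))
      (of_real ((LINT x|lborel. indicator (ball 0 1) x * Re (h x)) * I)
        + \<i> * of_real ((LINT x|lborel. indicator (ball 0 1) x * Im (h x)) * I))"
    by (intro has_bochner_integral_add has_bochner_integral_mult_right
        has_bochner_integral_of_real re im)
  moreover have "of_real ((LINT x|lborel. indicator (ball 0 1) x * Re (h x)) * I)
      + \<i> * of_real ((LINT x|lborel. indicator (ball 0 1) x * Im (h x)) * I)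
    = (LINT x|lborel. indicator (ball 0 1) x * h x) * of_real I"
    using integral_Re[OF int] integral_Im[OF int] by (simp add: ind complex_eq_iff)
  moreover have "of_real (Re (h x) * y) + \<i> * of_real (Im (h x) * y) = h x * of_real y" for x y
    by (simp add: complex_eq_iff)
  ultimately show ?thesis by simp
qed

section \<open>Circle means and Taylor parts\<close>

text \<open>Total mass 1, so that integrals over the circle are means. A density over
  \<open>lborel\<close>, rather than a restriction, keeps \<open>UNIV\<close> as the underlying
  space.\<close>

abbreviation unit_interval_measure :: "real measure" where
  "unit_interval_measure \<equiv> density lborel (indicator {0..1})"

interpretation unit_interval: finite_measure unit_interval_measure
  by standard (simp add: emeasure_density)

lemma measure_unit_interval [simp]:
  "emeasure unit_interval_measure UNIV = 1" "measure unit_interval_measure UNIV = 1"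
  by (simp_all add: measure_def emeasure_density)

abbreviation circ :: "real \<Rightarrow> complex" where
  "circ t \<equiv> cis (2 * pi * t)"

lemma unit_interval_measure_eq:
  "unit_interval_measure = density lborel (\<lambda>t. ennreal (indicator {0..1} t))"
  by (simp add: ennreal_indicator)

lemma borel_measurable_cnj [measurable]: "cnj \<in> borel_measurable borel"
  by (rule borel_measurable_continuous_onI) (intro continuous_intros)

lemma borel_measurable_cis [measurable]: "cis \<in> borel_measurable borel"
  by (rule borel_measurable_continuous_onI) (intro continuous_intros)

text \<open>Cauchy's formula for derivatives on the unit circle. There \<open>cnj (circ t)\<close>
  is the inverse of \<open>circ t\<close>, so its m-th power picks out the m-th Taylor
  coefficient.\<close>

lemma circle_mean_coeff:
  assumes f: "f holomorphic_on ball 0 r" and "r > 1"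
  shows "(LINT t|unit_interval_measure. f (circ t) * cnj (circ t) ^ m) = (deriv ^^ m) f 0 / fact m"
proof -
  have cont: "continuous_on S (\<lambda>t. f (circ t) * cnj (circ t) ^ m)" for S
    using \<open>r > 1\<close> by (intro continuous_intros continuous_on_compose2[OF holomorphic_on_imp_continuous_on[OF f]]) auto
  have "((\<lambda>u. f u / (u - 0) ^ Suc m) has_contour_integral 2 * pi * \<i> / fact m * (deriv ^^ m) f 0) (circlepath 0 1)"
    using \<open>r > 1\<close> by (intro Cauchy_has_contour_integral_higher_derivative_circlepath
      holomorphic_on_imp_continuous_on holomorphic_on_subset[OF f]) auto
  then have "((\<lambda>t. f (circlepath 0 1 t) / circlepath 0 1 t ^ Suc m * (2 * pi * \<i> * exp (2 * of_real pi * \<i> * t)))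
      has_integral 2 * pi * \<i> / fact m * (deriv ^^ m) f 0) {0..1}"
    unfolding has_contour_integral_def
    by (rule has_integral_eq[rotated]) (simp add: vector_derivative_circlepath01)
  then have "((\<lambda>t. 1 / (2 * pi * \<i>) * (f (circlepath 0 1 t) / circlepath 0 1 t ^ Suc m * (2 * pi * \<i> * exp (2 * of_real pi * \<i> * t))))
      has_integral 1 / (2 * pi * \<i>) * (2 * pi * \<i> / fact m * (deriv ^^ m) f 0)) {0..1}"
    by (rule has_integral_mult_right)
  then have "((\<lambda>t. f (circ t) * cnj (circ t) ^ m) has_integral (deriv ^^ m) f 0 / fact m) {0..1}"
  proof (rule has_integral_eq[rotated, THEN iffD1[OF arg_cong[where f="\<lambda>i. (_ has_integral i) _"], rotated]])
    fix t :: real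
    have e: "exp (2 * of_real pi * \<i> * t) = circ t"
      by (simp add: cis_conv_exp mult_ac)
    show "1 / (2 * pi * \<i>) * (f (circlepath 0 1 t) / circlepath 0 1 t ^ Suc m * (2 * pi * \<i> * exp (2 * of_real pi * \<i> * t)))
      = f (circ t) * cnj (circ t) ^ m"
      unfolding circlepath e by (simp add: cis_cnj field_simps flip: cis_inverse)
  qed simp
  then have "integral {0..1} (\<lambda>t. f (circ t) * cnj (circ t) ^ m) = (deriv ^^ m) f 0 / fact m"
    by (rule integral_unique)
  then show ?thesis
    using borel_integrable_atLeastAtMost'[OF cont] borel_measurable_continuous_onI[OF cont]
    by (subst unit_interval_measure_eq, subst integral_density) (simp_all add: set_borel_integral_eq_integral(2)[unfolded set_lebesgue_integral_def])
qed

text \<open>Each rotated integral equals the original one and the parameter has total mass 1; Fubini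
  does the rest. It serves to replace an integrand by its mean over circles.\<close>

lemma rotation_average:
  fixes F :: "complex ^ 'n \<Rightarrow> complex"
  assumes F: "integrable lborel F" and [measurable]: "c \<in> borel_measurable borel"
    and c: "\<And>t. cmod (c t) = 1"
  shows "(LINT x|lborel. F x) = (LINT x|lborel. (LINT t|unit_interval_measure. F (c t *s x)))"
proof -
  interpret pair_sigma_finite unit_interval_measure "lborel :: (complex ^ 'n) measure" ..
  have [measurable]: "F \<in> borel_measurable borel" using F by auto
  have nn: "(\<integral>\<^sup>+x. G (c t *s x) \<partial>lborel) = (\<integral>\<^sup>+x. G x \<partial>lborel)"
    if [measurable]: "G \<in> borel_measurable borel" for G :: "complex ^ 'n \<Rightarrow> ennreal" and t
    using nn_integral_distr[of "(*s) (c t)" lborel borel G] by (simp add: distr_lborel_vec_scale c)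
  have li: "(LINT x|lborel. F (c t *s x)) = (LINT x|lborel. F x)" for t
    using integral_distr[of "(*s) (c t)" lborel borel F] by (simp add: distr_lborel_vec_scale c)
  have int: "integrable (unit_interval_measure \<Otimes>\<^sub>M lborel) (\<lambda>(t, x). F (c t *s x))"
  proof (rule integrableI_bounded)
    have "(\<integral>\<^sup>+p. ennreal (norm (case p of (t, x) \<Rightarrow> F (c t *s x))) \<partial>(unit_interval_measure \<Otimes>\<^sub>M lborel))
      = (\<integral>\<^sup>+t. (\<integral>\<^sup>+x. ennreal (norm (F (c t *s x))) \<partial>lborel) \<partial>unit_interval_measure)"
      by (subst lborel.nn_integral_fst[symmetric]) (simp_all add: case_prod_beta')
    also have "\<dots> = (\<integral>\<^sup>+t. (\<integral>\<^sup>+x. ennreal (norm (F x)) \<partial>lborel) \<partial>unit_interval_measure)"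
      by (subst nn) simp_all
    also have "\<dots> = (\<integral>\<^sup>+x. ennreal (norm (F x)) \<partial>lborel)"
      by simp
    also have "\<dots> < \<infinity>"
      using F by (simp add: integrable_iff_bounded)
    finally show "(\<integral>\<^sup>+p. ennreal (norm (case p of (t, x) \<Rightarrow> F (c t *s x)))
        \<partial>(unit_interval_measure \<Otimes>\<^sub>M lborel)) < \<infinity>" .
  qed measurable
  have "(LINT x|lborel. (LINT t|unit_interval_measure. F (c t *s x)))
      = (LINT t|unit_interval_measure. (LINT x|lborel. F (c t *s x)))"
    by (rule Fubini_integral[OF int])
  also have "\<dots> = (LINT x|lborel. F x)"
    by (simp add: li)
  finally show ?thesis ..
qed

lemma holomorphic_ball_imp_continuous_on:
  "holomorphic_ball f \<Longrightarrow> continuous_on (ball 0 1) f"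
  unfolding holomorphic_ball_def
  by (meson continuous_at_imp_continuous_on has_derivative_continuous)

lemma indicator_scaleR: "indicator A x *\<^sub>R y = indicator A x * (y :: complex)"
  by (simp split: split_indicator)

text \<open>Outside the ball \<open>f\<close> is arbitrary; the cutoff yields a function that is
  Borel on the whole space.\<close>

lemma borel_measurable_holomorphic_ball:
  "holomorphic_ball f \<Longrightarrow> (\<lambda>x. indicator (ball 0 1) x * f x) \<in> borel_measurable borel"
  using borel_measurable_continuous_on_indicator[OF _ holomorphic_ball_imp_continuous_on, of f]
  by (simp add: indicator_scaleR)

text \<open>Complex linearity makes the total derivative along a complex line a multiplication by a
  number, so one-variable theory applies on every slice.\<close>

lemma holomorphic_ball_line:
  assumes f: "holomorphic_ball f" and S: "\<And>c. c \<in> S \<Longrightarrow> norm (z + c *s w) < 1"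
  shows "(\<lambda>c. f (z + c *s w)) holomorphic_on S"
proof (rule holomorphic_onI)
  fix c assume "c \<in> S"
  then obtain D where D: "(f has_derivative D) (at (z + c *s w))" "\<And>c v. D (c *s v) = c * D v"
    using f S unfolding holomorphic_ball_def by fastforce
  have bl: "bounded_linear (\<lambda>c. c *s w)"
    by (rule linear_conv_bounded_linear[THEN iffD1], rule linearI) (simp_all add: vec_eq_iff algebra_simps)
  have "((\<lambda>c. z + c *s w) has_derivative (\<lambda>c. 0 + c *s w)) (at c within S)"
    by (intro has_derivative_add has_derivative_const bounded_linear_imp_has_derivative bl)
  then have "((\<lambda>c. f (z + c *s w)) has_derivative (\<lambda>c. D (0 + c *s w))) (at c within S)"
    by (rule has_derivative_compose[where f="\<lambda>c. z + c *s w" and g=f]) (rule D(1))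
  then have "((\<lambda>c. f (z + c *s w)) has_derivative (*) (D w)) (at c within S)"
    by (rule back_subst[of "\<lambda>h. (_ has_derivative h) _"]) (simp add: D(2) mult.commute fun_eq_iff)
  then show "(\<lambda>c. f (z + c *s w)) field_differentiable (at c within S)"
    by (auto simp: field_differentiable_def has_field_derivative_def)
qed

lemma holomorphic_ball_ray:
  assumes "holomorphic_ball f" "R * norm z \<le> 1" "R > 0"
  shows "(\<lambda>c. f (c *s z)) holomorphic_on ball 0 R"
proof -
  have "(\<lambda>c. f (0 + c *s z)) holomorphic_on ball 0 R"
  proof (rule holomorphic_ball_line[OF assms(1)])
    fix c assume c: "c \<in> ball (0::complex) R"
    show "norm (0 + c *s z) < 1"
    proof (cases "z = 0")
      case False
      then have "cmod c * norm z < R * norm z" using c by simp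
      then show ?thesis using assms by (simp add: norm_vec_scale)
    qed simp
  qed
  then show ?thesis by simp
qed

text \<open>The homogeneous part of degree \<open>m\<close>, read off on the slice through
  \<open>z\<close>. Only the germ of the slice at 0 matters, so it is meaningful for every
  \<open>z\<close>, also outside the ball, as integration against a Gaussian requires.\<close>

definition taylor_part :: "(complex ^ 'n \<Rightarrow> complex) \<Rightarrow> nat \<Rightarrow> complex ^ 'n \<Rightarrow> complex" where
  "taylor_part f m z = (deriv ^^ m) (\<lambda>c. f (c *s z)) 0 / fact m"

context
  fixes f :: "complex ^ 'n \<Rightarrow> complex"
  assumes f: "holomorphic_ball f"
begin

text \<open>Chain rule on a slice. As \<open>z\<close> may lie outside the ball, the slice is
  holomorphic only on a disc whose radius \<open>R\<close> shrinks with |z|; on the smaller disc of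
  radius \<open>R'\<close> multiplication by \<open>c\<close> stays inside it.\<close>

lemma taylor_part_scale: "taylor_part f m (c *s z) = c ^ m * taylor_part f m z"
proof -
  define R where "R = 1 / (1 + norm z)"
  define R' where "R' = R / (1 + cmod c)"
  have R: "R > 0" "R * norm z \<le> 1" "R' > 0"
    by (auto simp: R_def R'_def field_simps add_pos_nonneg)
  have "(deriv ^^ m) (\<lambda>w. (\<lambda>u. f (u *s z)) (c * w)) 0 = c ^ m * (deriv ^^ m) (\<lambda>u. f (u *s z)) (c * 0)"
  proof (rule higher_deriv_compose_linear)
    show "(\<lambda>u. f (u *s z)) holomorphic_on ball 0 R"
      using f R by (intro holomorphic_ball_ray) auto
    fix w assume "w \<in> ball (0::complex) R'"
    then have "cmod c * cmod w \<le> cmod c * R'" by (intro mult_left_mono) auto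
    also have "\<dots> = R * (cmod c / (1 + cmod c))" by (simp add: R'_def)
    also have "\<dots> < R * 1"
      using R by (intro mult_strict_left_mono) (simp_all add: add_pos_nonneg)
    finally have "cmod c * cmod w < R" by simp
    then show "c * w \<in> ball 0 R" by (simp add: norm_mult)
  qed (use R in auto)
  moreover have "(\<lambda>w. f (w *s (c *s z))) = (\<lambda>w. (\<lambda>u. f (u *s z)) (c * w))"
    by (simp add: vector_smult_assoc mult.commute)
  ultimately show ?thesis
    by (simp add: taylor_part_def)
qed

lemma taylor_part_circle_mean:
  assumes z: "norm z < 1"
  shows "taylor_part f m z = (LINT t|unit_interval_measure. f (circ t *s z) * cnj (circ t) ^ m)"
proof -
  define R where "R = 2 / (1 + norm z)"
  have "R > 1" "R * norm z \<le> 1"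
    using z by (auto simp: R_def field_simps add_pos_nonneg)
  then show ?thesis
    unfolding taylor_part_def using f
    by (intro circle_mean_coeff[symmetric, where r=R] holomorphic_ball_ray) auto
qed

text \<open>Since |z| < 1, the slice is holomorphic on a disc of radius \<open>R\<close> > 1, so its
  power series may be evaluated at c = 1.\<close>

lemma taylor_part_sums:
  assumes z: "norm z < 1"
  shows "(\<lambda>m. taylor_part f m z) sums f z"
proof -
  define R where "R = 2 / (1 + norm z)"
  have R: "R > 1" "R * norm z \<le> 1"
    using z by (auto simp: R_def field_simps add_pos_nonneg)
  have "(\<lambda>n. (deriv ^^ n) (\<lambda>c. f (c *s z)) 0 / fact n * (1 - 0) ^ n) sums f (1 *s z)"
    using R f by (intro holomorphic_power_series[where r=R] holomorphic_ball_ray) auto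
  then show ?thesis by (simp add: taylor_part_def)
qed

text \<open>An iterated derivative depending on a parameter is not visibly measurable. Homogeneity
  moves the argument into the ball by the factor \<open>r z\<close>, and there the Taylor part is a
  circle mean, a parameter integral of a Borel function.\<close>

lemma borel_measurable_taylor_part: "taylor_part f m \<in> borel_measurable borel"
proof -
  define F where "F x = indicator (ball 0 1) x * f x" for x
  have [measurable]: "F \<in> borel_measurable borel"
    unfolding F_def[abs_def] by (rule borel_measurable_holomorphic_ball[OF f])
  define r where "r z = 1 / (1 + norm z)" for z :: "complex ^ 'n"
  have r: "r z > 0" "norm (r z *\<^sub>R z) < 1" for z
    by (auto simp: r_def field_simps add_pos_nonneg)
  have [measurable]: "r \<in> borel_measurable borel" unfolding r_def[abs_def] by measurable
  have "taylor_part f m z = of_real ((1 / r z) ^ m) *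
    (LINT t|unit_interval_measure. F (circ t *s (r z *\<^sub>R z)) * cnj (circ t) ^ m)" for z
  proof -
    have "of_real (1 / r z) *s (r z *\<^sub>R z) = z"
      using r[of z] by (simp only: of_real_vec_scale) simp
    then have "taylor_part f m z = of_real (1 / r z) ^ m * taylor_part f m (r z *\<^sub>R z)"
      by (metis taylor_part_scale)
    also have "taylor_part f m (r z *\<^sub>R z) = (LINT t|unit_interval_measure. F (circ t *s (r z *\<^sub>R z)) * cnj (circ t) ^ m)"
      using r[of z] by (subst taylor_part_circle_mean) (auto simp: F_def indicator_def norm_vec_scale)
    finally show ?thesis by simp
  qed
  then have "taylor_part f m = (\<lambda>z. of_real ((1 / r z) ^ m) *
    (LINT t|unit_interval_measure. F (circ t *s (r z *\<^sub>R z)) * cnj (circ t) ^ m))"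
    by (rule ext)
  also have "\<dots> \<in> borel_measurable borel"
    by measurable
  finally show ?thesis .
qed

text \<open>Cauchy's estimate on the ball of radius 1/2, spread to all \<open>z\<close> by
  homogeneity; this is the origin of the factor 2^m.\<close>

lemma taylor_part_bound: "\<exists>M\<ge>0. \<forall>z. cmod (taylor_part f m z) \<le> M * norm z ^ m"
proof -
  have "compact (f ` cball 0 (1/2))"
    by (intro compact_continuous_image continuous_on_subset[OF holomorphic_ball_imp_continuous_on[OF f]]) auto
  then have "bounded (f ` cball 0 (1/2))" by (rule compact_imp_bounded)
  then obtain B where "B > 0" "\<And>x. x \<in> cball 0 (1/2) \<Longrightarrow> cmod (f x) \<le> B"
    unfolding bounded_pos by blast
  then have B: "\<And>x. norm x \<le> 1/2 \<Longrightarrow> cmod (f x) \<le> B" "B > 0" by auto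
  have b: "cmod (taylor_part f m z) \<le> B" if "norm z \<le> 1/2" for z
  proof -
    have "cmod (taylor_part f m z) = cmod (LINT t|unit_interval_measure. f (circ t *s z) * cnj (circ t) ^ m)"
      using that by (subst taylor_part_circle_mean) auto
    also have "\<dots> \<le> (LINT t|unit_interval_measure. cmod (f (circ t *s z) * cnj (circ t) ^ m))"
      by (rule integral_norm_bound)
    also have "\<dots> \<le> (LINT t|unit_interval_measure. B)"
      using that B by (intro integral_mono') (auto simp: norm_mult norm_power norm_vec_scale)
    finally show ?thesis by simp
  qed
  show ?thesis
  proof (intro exI[of _ "B * 2 ^ m"] conjI allI)
    fix z
    show "cmod (taylor_part f m z) \<le> B * 2 ^ m * norm z ^ m"
    proof (cases "z = 0")
      case True
      show ?thesis
      proof (cases m)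
        case (Suc k)
        have "taylor_part f m (0 *s z) = 0"
          by (subst taylor_part_scale) (simp add: Suc)
        then show ?thesis using True B by simp
      qed (use b[of z] True in simp)
    next
      case False
      define w where "w = (1 / (2 * norm z)) *\<^sub>R z"
      have "of_real (2 * norm z) *s w = z"
        using False by (simp only: of_real_vec_scale w_def) simp
      then have "taylor_part f m z = of_real (2 * norm z) ^ m * taylor_part f m w"
        by (metis taylor_part_scale)
      moreover have "cmod (taylor_part f m w) \<le> B"
        using False by (intro b) (simp add: w_def)
      ultimately show ?thesis
        using mult_left_mono[of "cmod (taylor_part f m w)" B "norm z ^ m * 2 ^ m"]
        by (simp add: norm_mult norm_power power_mult_distrib mult_ac)
    qed
  qed (use B in auto)
qed

end

section \<open>Gaussian and ball profiles, and integrability against the Gaussian\<close>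

lemma nn_integral_gaussian_radial:
  assumes "k > 0"
  shows "(\<integral>\<^sup>+s. ennreal (k * s powr (k - 1)) * indicator {0..} s * ennreal (exp (- s)) \<partial>lborel)
    = ennreal (Gamma (k + 1))"
proof -
  have "(\<integral>\<^sup>+s. ennreal (k * s powr (k - 1)) * indicator {0..} s * ennreal (exp (- s)) \<partial>lborel)
    = (\<integral>\<^sup>+s. ennreal k * ennreal (indicator {0..} s * s powr (k - 1) / exp s) \<partial>lborel)"
    using assms by (intro nn_integral_cong)
      (auto simp: indicator_def exp_minus field_simps simp flip: ennreal_mult)
  also have "\<dots> = ennreal k * ennreal (Gamma k)"
    by (subst nn_integral_cmult) (simp_all add: Gamma_conv_nn_integral_real[OF assms, symmetric])
  also have "\<dots> = ennreal (Gamma (k + 1))"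
    using assms by (subst Gamma_plus1) (auto simp: ennreal_mult elim!: nonpos_Ints_cases)
  finally show ?thesis .
qed

lemma nn_integral_ball_radial:
  assumes "k > 0" "\<alpha> > -1"
  shows "(\<integral>\<^sup>+s. ennreal (k * s powr (k - 1)) * indicator {0..} s
      * ennreal (indicator {..<1} s * (1 - s) powr \<alpha>) \<partial>lborel)
    = ennreal (k * Beta k (\<alpha> + 1))"
proof -
  have "((\<lambda>s. k * (s powr (k - 1) * (1 - s) powr (\<alpha> + 1 - 1))) has_integral k * Beta k (\<alpha> + 1)) {0..1}"
    using assms by (intro has_integral_mult_right has_integral_Beta_real) auto
  then have "(\<integral>\<^sup>+s. ennreal (k * (s powr (k - 1) * (1 - s) powr (\<alpha> + 1 - 1))) * indicator {0..1} s \<partial>lborel)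
    = ennreal (k * Beta k (\<alpha> + 1))"
    using assms by (intro nn_integral_has_integral_lebesgue') auto
  moreover have "(\<integral>\<^sup>+s. ennreal (k * s powr (k - 1)) * indicator {0..} s
      * ennreal (indicator {..<1} s * (1 - s) powr \<alpha>) \<partial>lborel)
    = (\<integral>\<^sup>+s. ennreal (k * (s powr (k - 1) * (1 - s) powr (\<alpha> + 1 - 1))) * indicator {0..1} s \<partial>lborel)"
    using assms by (intro nn_integral_cong) (auto simp: indicator_def mult_ac simp flip: ennreal_mult)
  ultimately show ?thesis by simp
qed

lemma integrable_gaussian:
  "integrable lborel (\<lambda>x::'a::euclidean_space. exp (- (norm x)\<^sup>2))"
proof (rule integrableI_bounded)
  have "(\<integral>\<^sup>+x. ennreal (norm (exp (- (norm x)\<^sup>2))) \<partial>(lborel :: 'a measure))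
      = (\<integral>\<^sup>+x. ennreal 1 * (\<lambda>s. ennreal (exp (- s))) ((norm x)\<^sup>2) \<partial>(lborel :: 'a measure))"
    by simp
  also have "\<dots> < \<infinity>"
  proof (subst nn_integral_radial[where d=0])
    show "(\<integral>\<^sup>+x. ennreal 1 * indicator (ball 0 1) x \<partial>(lborel :: 'a measure)) < \<infinity>"
      using emeasure_lborel_ball_finite[of "0::'a" 1] by simp
    then show "(\<integral>\<^sup>+x. ennreal 1 * indicator (ball 0 1) x \<partial>(lborel :: 'a measure)) *
       (\<integral>\<^sup>+s. ennreal ((real 0 + real DIM('a)) / 2 * s powr ((real 0 + real DIM('a)) / 2 - 1))
         * indicator {0..} s * ennreal (exp (- s)) \<partial>lborel) < \<infinity>"
      using nn_integral_gaussian_radial[of "(real 0 + real DIM('a)) / 2"]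
      by (simp add: ennreal_mult_less_top)
  qed auto
  finally show "(\<integral>\<^sup>+x. ennreal (norm (exp (- (norm x)\<^sup>2))) \<partial>(lborel :: 'a measure)) < \<infinity>" .
qed measurable

lemma integrable_gaussian_half:
  "integrable lborel (\<lambda>x::'a::euclidean_space. exp (- ((norm x)\<^sup>2 / 2)))"
proof (rule integrableI_bounded)
  have "(\<integral>\<^sup>+x. ennreal (norm (exp (- ((norm x)\<^sup>2 / 2)))) \<partial>(lborel :: 'a measure))
      = ennreal (sqrt 2 ^ DIM('a)) * (\<integral>\<^sup>+x. ennreal (norm (exp (- (norm x)\<^sup>2))) \<partial>(lborel :: 'a measure))"
    by (subst nn_integral_lborel_scale[of _ "sqrt 2"]) (simp_all add: power_mult_distrib)
  also have "\<dots> < \<infinity>"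
    using integrable_gaussian[where 'a='a] by (simp add: integrable_iff_bounded ennreal_mult_less_top)
  finally show "(\<integral>\<^sup>+x. ennreal (norm (exp (- ((norm x)\<^sup>2 / 2)))) \<partial>(lborel :: 'a measure)) < \<infinity>" .
qed measurable

lemma integrable_gaussian_growth:
  fixes g :: "'a::euclidean_space \<Rightarrow> complex"
  assumes [measurable]: "g \<in> borel_measurable borel"
    and g: "\<And>x. cmod (g x) \<le> M * exp (a * norm x)"
  shows "integrable lborel (\<lambda>x. g x * of_real (exp (- (norm x)\<^sup>2)))"
proof (rule Bochner_Integration.integrable_bound)
  show "integrable lborel (\<lambda>x::'a. M * exp (a\<^sup>2 / 2) * exp (- ((norm x)\<^sup>2 / 2)))"
    by (intro integrable_mult_right integrable_gaussian_half)
  have "M * exp (a * norm (0::'a)) \<ge> 0" using g[of 0] norm_ge_zero order_trans by blast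
  then have M: "M \<ge> 0" by simp
  have "cmod (g x * of_real (exp (- (norm x)\<^sup>2))) \<le> M * exp (a\<^sup>2 / 2) * exp (- ((norm x)\<^sup>2 / 2))" for x
  proof -
    \<comment> \<open>Completing the square: half of the Gaussian exponent pays for the exponential
      growth, the other half remains integrable.\<close>
    have "0 \<le> (norm x - a)\<^sup>2" by simp
    then have "a * norm x - (norm x)\<^sup>2 \<le> a\<^sup>2 / 2 - (norm x)\<^sup>2 / 2"
      by (simp add: power2_diff field_simps)
    then have "M * exp (a * norm x - (norm x)\<^sup>2) \<le> M * exp (a\<^sup>2 / 2 - (norm x)\<^sup>2 / 2)"
      using M by (intro mult_left_mono) auto
    moreover have "cmod (g x) * exp (- (norm x)\<^sup>2) \<le> M * exp (a * norm x) * exp (- (norm x)\<^sup>2)"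
      using g by (intro mult_right_mono) auto
    ultimately show ?thesis
      by (simp add: norm_mult mult.assoc flip: exp_add)
  qed
  then show "AE x in lborel. norm (g x * of_real (exp (- (norm x)\<^sup>2)))
      \<le> norm (M * exp (a\<^sup>2 / 2) * exp (- ((norm x)\<^sup>2 / 2)))"
    using M by simp
qed measurable

lemma power_le_fact_exp: "0 \<le> x \<Longrightarrow> x ^ m \<le> fact m * exp (x::real)"
proof -
  assume "0 \<le> x"
  have "x ^ m / fact m \<le> (\<Sum>i\<in>{..<Suc m}. x ^ i /\<^sub>R fact i)"
    using \<open>0 \<le> x\<close> by (intro order_trans[OF _ member_le_sum[of m]]) (auto simp: field_simps)
  also have "\<dots> \<le> exp x"
    unfolding exp_def using \<open>0 \<le> x\<close> summable_exp_generic[of x]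
    by (intro sum_le_suminf) auto
  finally show ?thesis by (simp add: field_simps)
qed

section \<open>Reproducing formula and moments for the Gaussian weight\<close>

context
  fixes f :: "complex ^ 'n \<Rightarrow> complex"
  assumes f: "holomorphic_ball f"
begin

text \<open>The mean value property at b = 0 for
  \<open>taylor_part f m (z + b *s w) * exp (b * a)\<close>. Instead of proving the Taylor part
  holomorphic off the origin, it is written as a circle mean of \<open>f\<close> at points shrunk
  into the ball, and the mean value property is applied under that integral.\<close>

lemma taylor_part_translate_mean:
  "(LINT t|unit_interval_measure. taylor_part f m (z + circ t *s w) * exp (circ t * a)) = taylor_part f m z"
proof -
  interpret UU: pair_sigma_finite unit_interval_measure unit_interval_measure ..
  interpret UUf: finite_measure "unit_interval_measure \<Otimes>\<^sub>M unit_interval_measure"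
    by (intro finite_measure_pair_measure unit_interval.finite_measure_axioms)
  \<comment> \<open>Small enough that r (z + b w) lies in the ball for all |b| \<le> 2, so that
    holomorphy in b holds on a disc strictly larger than the unit disc.\<close>
  define r where "r = 1 / (1 + norm z + 2 * norm w)"
  have r: "r > 0" "r * (norm z + 2 * norm w) < 1"
    by (auto simp: r_def field_simps add_pos_nonneg)
  have small: "norm (c *s (r *\<^sub>R (z + b *s w))) < 1" if "cmod c = 1" "cmod b \<le> 2" for c b
  proof -
    have "norm (z + b *s w) \<le> norm z + cmod b * norm w"
      by (metis norm_triangle_ineq norm_vec_scale)
    also have "\<dots> \<le> norm z + 2 * norm w" using that by (simp add: mult_right_mono)
    finally have "r * norm (z + b *s w) \<le> r * (norm z + 2 * norm w)"
      using r by (intro mult_left_mono) auto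
    then have "r * norm (z + b *s w) < 1" using r(2) by (rule order_le_less_trans)
    then show ?thesis using r(1) that by (simp add: norm_vec_scale)
  qed
  define F where "F x = indicator (ball 0 1) x * f x" for x
  have [measurable]: "F \<in> borel_measurable borel"
    unfolding F_def[abs_def] by (rule borel_measurable_holomorphic_ball[OF f])
  have "compact (f ` cball 0 (r * (norm z + 2 * norm w)))"
    using r by (intro compact_continuous_image continuous_on_subset[OF holomorphic_ball_imp_continuous_on[OF f]]) auto
  then obtain B where "B > 0" "\<forall>x\<in>cball 0 (r * (norm z + 2 * norm w)). cmod (f x) \<le> B"
    by (auto dest!: compact_imp_bounded simp: bounded_pos)
  then have B: "cmod (f x) \<le> B" if "norm x \<le> r * (norm z + 2 * norm w)" for x
    using that by auto
  have FB: "cmod (F (c *s (r *\<^sub>R (z + b *s w)))) \<le> B" if "cmod c = 1" "cmod b \<le> 1" for c b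
  proof -
    have "norm (z + b *s w) \<le> norm z + cmod b * norm w"
      by (metis norm_triangle_ineq norm_vec_scale)
    also have "\<dots> \<le> norm z + 2 * norm w"
      using that mult_right_mono[of "cmod b" 2 "norm w"] by simp
    finally have "r * norm (z + b *s w) \<le> r * (norm z + 2 * norm w)"
      using r by (intro mult_left_mono) auto
    then show ?thesis using r that \<open>B > 0\<close>
      by (auto simp: F_def indicator_def norm_vec_scale intro!: B)
  qed
  define G where "G t s = F (circ s *s (r *\<^sub>R (z + circ t *s w))) * cnj (circ s) ^ m * exp (circ t * a)" for t s
  have G: "case_prod G \<in> borel_measurable (borel \<Otimes>\<^sub>M borel)"
    unfolding G_def[abs_def] by measurable
  have int: "integrable (unit_interval_measure \<Otimes>\<^sub>M unit_interval_measure) (case_prod G)"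
  proof (rule UUf.integrable_const_bound[of _ "B * exp (cmod a)"])
    have "cmod (G t s) \<le> B * exp (cmod a)" for t s
    proof -
      have "cmod (exp (circ t * a)) \<le> exp (cmod (circ t * a))" by (rule norm_exp)
      then have "cmod (exp (circ t * a)) \<le> exp (cmod a)" by (simp add: norm_mult)
      then show ?thesis unfolding G_def norm_mult using FB[of "circ s" "circ t"] \<open>B > 0\<close>
        by (intro mult_mono) (auto simp: norm_power)
    qed
    then show "AE x in unit_interval_measure \<Otimes>\<^sub>M unit_interval_measure. norm (case_prod G x) \<le> B * exp (cmod a)"
      by (simp add: case_prod_beta')
  qed (use G in \<open>simp cong: measurable_cong_sets\<close>)
  have scale: "taylor_part f m x = of_real (1 / r) ^ m * taylor_part f m (r *\<^sub>R x)" for x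
  proof -
    have "of_real (1 / r) *s (r *\<^sub>R x) = x" using r by (simp only: of_real_vec_scale) simp
    then show ?thesis by (metis taylor_part_scale[OF f])
  qed
  have mean: "taylor_part f m (z + b *s w) =
      of_real (1 / r) ^ m * (LINT s|unit_interval_measure. F (circ s *s (r *\<^sub>R (z + b *s w))) * cnj (circ s) ^ m)"
    if "cmod b \<le> 1" for b
    using small[of 1 b] small[of "circ s" b for s] that
    by (subst scale, subst taylor_part_circle_mean[OF f]) (auto simp: F_def indicator_def)
  \<comment> \<open>The coefficient of order 0 is the value at b = 0: both the translation by
    \<open>w\<close> and the exponential factor disappear.\<close>
  have inner: "(LINT t|unit_interval_measure. G t s) = F (circ s *s (r *\<^sub>R (z + 0 *s w))) * cnj (circ s) ^ m" for s
  proof -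
    have "(\<lambda>b. f (circ s *s (r *\<^sub>R z) + b *s (circ s *s (r *\<^sub>R w)))) holomorphic_on ball 0 2"
    proof (rule holomorphic_ball_line[OF f])
      fix b assume "b \<in> ball (0::complex) 2"
      moreover have "circ s *s (r *\<^sub>R z) + b *s (circ s *s (r *\<^sub>R w)) = circ s *s (r *\<^sub>R (z + b *s w))"
        by (simp add: vec_eq_iff scaleR_conv_of_real algebra_simps)
      ultimately show "norm (circ s *s (r *\<^sub>R z) + b *s (circ s *s (r *\<^sub>R w))) < 1"
        using small[of "circ s" b] by simp
    qed
    moreover have "circ s *s (r *\<^sub>R z) + b *s (circ s *s (r *\<^sub>R w)) = circ s *s (r *\<^sub>R (z + b *s w))" for b
      by (simp add: vec_eq_iff scaleR_conv_of_real algebra_simps)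
    ultimately have "(\<lambda>b. f (circ s *s (r *\<^sub>R (z + b *s w))) * cnj (circ s) ^ m * exp (b * a)) holomorphic_on ball 0 2"
      by (intro holomorphic_intros) simp
    from circle_mean_coeff[OF this, of 0]
    have "(LINT t|unit_interval_measure. f (circ s *s (r *\<^sub>R (z + circ t *s w))) * cnj (circ s) ^ m * exp (circ t * a))
      = f (circ s *s (r *\<^sub>R (z + 0 *s w))) * cnj (circ s) ^ m" by simp
    moreover have "G t s = f (circ s *s (r *\<^sub>R (z + circ t *s w))) * cnj (circ s) ^ m * exp (circ t * a)" for t
      using small[of "circ s" "circ t"] by (simp add: G_def F_def indicator_def)
    moreover have "F (circ s *s (r *\<^sub>R (z + 0 *s w))) = f (circ s *s (r *\<^sub>R (z + 0 *s w)))"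
      using small[of "circ s" 0] by (simp add: F_def indicator_def)
    ultimately show ?thesis by simp
  qed
  have "(LINT t|unit_interval_measure. taylor_part f m (z + circ t *s w) * exp (circ t * a))
     = (LINT t|unit_interval_measure. of_real (1 / r) ^ m * (LINT s|unit_interval_measure. G t s))"
  proof (rule Bochner_Integration.integral_cong)
    fix t
    have "(LINT s|unit_interval_measure. G t s) =
      (LINT s|unit_interval_measure. F (circ s *s (r *\<^sub>R (z + circ t *s w))) * cnj (circ s) ^ m) * exp (circ t * a)"
      unfolding G_def by (rule integral_mult_left_zero)
    moreover have "taylor_part f m (z + circ t *s w) = of_real (1 / r) ^ m *
       (LINT s|unit_interval_measure. F (circ s *s (r *\<^sub>R (z + circ t *s w))) * cnj (circ s) ^ m)"
      by (rule mean) simp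
    ultimately show "taylor_part f m (z + circ t *s w) * exp (circ t * a)
      = of_real (1 / r) ^ m * (LINT s|unit_interval_measure. G t s)"
      by (simp only: mult.assoc)
  qed simp
  also have "\<dots> = of_real (1 / r) ^ m * (LINT t|unit_interval_measure. LINT s|unit_interval_measure. G t s)"
    by simp
  also have "(LINT t|unit_interval_measure. LINT s|unit_interval_measure. G t s)
    = (LINT s|unit_interval_measure. LINT t|unit_interval_measure. G t s)"
    by (rule UU.Fubini_integral[OF int, symmetric])
  also have "of_real (1 / r) ^ m * (LINT s|unit_interval_measure. LINT t|unit_interval_measure. G t s)
     = taylor_part f m z"
    unfolding inner using mean[of 0] by simp
  finally show ?thesis .
qed

lemma taylor_part_exp_bound: "\<exists>M. \<forall>x. cmod (taylor_part f m x) \<le> M * exp (norm x)"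
proof -
  obtain M where M: "M \<ge> 0" "\<And>x. cmod (taylor_part f m x) \<le> M * norm x ^ m"
    using taylor_part_bound[OF f] by blast
  have "cmod (taylor_part f m x) \<le> M * fact m * exp (norm x)" for x
    using M(2)[of x] mult_left_mono[OF power_le_fact_exp[of "norm x" m] M(1)] by (simp add: mult.assoc)
  then show ?thesis by blast
qed

text \<open>The substitution \<open>\<xi> = z + w\<close> turns the Fock kernel into a factor that is holomorphic in
  \<open>w\<close>, so that the mean value property applies.\<close>

lemma gaussian_reproducing:
  "(LINT x|lborel. taylor_part f m x * exp (hermitian_inner z x) * of_real (exp (- (norm x)\<^sup>2)))
    = taylor_part f m z * of_real (LINT x|(lborel :: (complex ^ 'n) measure). exp (- (norm x)\<^sup>2))"
proof -
  note [measurable] = borel_measurable_taylor_part[OF f]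
  obtain M where M: "\<And>x. cmod (taylor_part f m x) \<le> M * exp (norm x)"
    using taylor_part_exp_bound by blast
  have int: "integrable lborel (\<lambda>w. (taylor_part f m (z + w) * exp (- hermitian_inner w z)) * of_real (exp (- (norm w)\<^sup>2)))"
  proof (rule integrable_gaussian_growth)
    fix w
    have "M * exp (norm (0 :: complex ^ 'n)) \<ge> 0" using M[of 0] norm_ge_zero order_trans by blast
    then have "M \<ge> 0" by simp
    then have "M * exp (norm (z + w)) \<le> M * exp (norm z + norm w)"
      by (intro mult_left_mono) (auto intro: norm_triangle_ineq)
    then have 1: "cmod (taylor_part f m (z + w)) \<le> M * exp (norm z + norm w)"
      using M order_trans by blast
    have "cmod (exp (- hermitian_inner w z)) \<le> exp (cmod (- hermitian_inner w z))" by (rule norm_exp)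
    also have "\<dots> \<le> exp (norm w * norm z)" by (simp add: cmod_hermitian_inner_le)
    finally have "cmod (taylor_part f m (z + w) * exp (- hermitian_inner w z))
        \<le> M * exp (norm z + norm w) * exp (norm w * norm z)"
      unfolding norm_mult using 1 \<open>M \<ge> 0\<close> by (intro mult_mono) auto
    then show "cmod (taylor_part f m (z + w) * exp (- hermitian_inner w z))
        \<le> M * exp (norm z) * exp ((1 + norm z) * norm w)"
      by (simp add: mult.assoc algebra_simps flip: exp_add)
  qed measurable
  have "(LINT x|lborel. taylor_part f m x * exp (hermitian_inner z x) * of_real (exp (- (norm x)\<^sup>2)))
     = (LINT x|distr lborel borel ((+) z). taylor_part f m x * exp (hermitian_inner z x) * of_real (exp (- (norm x)\<^sup>2)))"
    by (simp only: lborel_distr_plus)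
  also have "\<dots> = (LINT w|lborel. taylor_part f m (z + w) * exp (hermitian_inner z (z + w)) * of_real (exp (- (norm (z + w))\<^sup>2)))"
    by (rule integral_distr) measurable
  also have "\<dots> = (LINT w|lborel. (taylor_part f m (z + w) * exp (- hermitian_inner w z)) * of_real (exp (- (norm w)\<^sup>2)))"
  proof (rule Bochner_Integration.integral_cong)
    fix w
    have e: "of_real ((norm (z + w))\<^sup>2) = of_real ((norm z)\<^sup>2) + hermitian_inner z w
        + (hermitian_inner w z + of_real ((norm w)\<^sup>2))"
      by (simp only: hermitian_inner_self[symmetric] hermitian_inner_add_left hermitian_inner_add_right add_ac)
    have "hermitian_inner z (z + w) - of_real ((norm (z + w))\<^sup>2) = - hermitian_inner w z - of_real ((norm w)\<^sup>2)"
      unfolding e by (simp add: hermitian_inner_add_right hermitian_inner_self)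
    then have "exp (hermitian_inner z (z + w)) * of_real (exp (- (norm (z + w))\<^sup>2))
      = exp (- hermitian_inner w z) * of_real (exp (- (norm w)\<^sup>2))"
      by (simp flip: exp_add exp_of_real)
    then show "taylor_part f m (z + w) * exp (hermitian_inner z (z + w)) * of_real (exp (- (norm (z + w))\<^sup>2))
      = (taylor_part f m (z + w) * exp (- hermitian_inner w z)) * of_real (exp (- (norm w)\<^sup>2))"
      by (simp only: mult.assoc)
  qed simp
  also have "\<dots> = (LINT w|lborel. (LINT t|unit_interval_measure. (taylor_part f m (z + circ t *s w)
      * exp (- hermitian_inner (circ t *s w) z)) * of_real (exp (- (norm (circ t *s w))\<^sup>2))))"
    by (rule rotation_average[OF int]) auto
  also have "\<dots> = (LINT w|(lborel :: (complex ^ 'n) measure). taylor_part f m z * of_real (exp (- (norm w)\<^sup>2)))"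
    using taylor_part_translate_mean[of m z w "- hermitian_inner w z" for w]
    by (simp add: hermitian_inner_scale_left norm_vec_scale)
  also have "\<dots> = taylor_part f m z * of_real (LINT x|(lborel :: (complex ^ 'n) measure). exp (- (norm x)\<^sup>2))"
    by (simp only: integral_mult_right_zero integral_complex_of_real)
  finally show ?thesis .
qed

text \<open>Up to conjugation this is the m-th Taylor coefficient of c \<mapsto> exp (c cnj
  a).\<close>

lemma exp_circle_coeff: "(LINT t|unit_interval_measure. circ t ^ m * exp (cnj (circ t) * a)) = a ^ m / fact m"
proof -
  have der: "(deriv ^^ m) (\<lambda>c. exp (c * b)) 0 = b ^ m" for b :: complex
  proof -
    have "(deriv ^^ m) (\<lambda>c. exp (b * c)) 0 = b ^ m * (deriv ^^ m) exp (b * 0)"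
      by (rule higher_deriv_compose_linear[where S=UNIV and T=UNIV]) (auto intro: holomorphic_intros)
    also have "(deriv ^^ m) exp = (exp :: complex \<Rightarrow> complex)"
    proof (induction m)
      case (Suc m)
      have "deriv exp = (exp :: complex \<Rightarrow> complex)"
        by (intro ext DERIV_imp_deriv DERIV_exp)
      then show ?case by (simp add: Suc)
    qed simp
    finally show ?thesis by (simp add: mult.commute)
  qed
  have "(LINT t|unit_interval_measure. exp (circ t * cnj a) * cnj (circ t) ^ m) = (cnj a) ^ m / fact m"
    using circle_mean_coeff[of "\<lambda>c. exp (c * cnj a)" 2 m] by (simp add: der holomorphic_intros)
  then have "cnj (LINT t|unit_interval_measure. exp (circ t * cnj a) * cnj (circ t) ^ m) = a ^ m / fact m"
    by simp
  then show ?thesis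
    by (subst (asm) Bochner_Integration.integral_cnj[symmetric]) (simp add: exp_cnj mult.commute)
qed

text \<open>Rotating x by \<open>circ t\<close> multiplies the Taylor part by the m-th power of
  \<open>circ t\<close>, so the mean over t retains only the term of degree m in the exponential
  series of <z,x>. This turns the reproducing formula into a moment with factor m!.\<close>

lemma gaussian_moment:
  "(LINT x|lborel. taylor_part f m x * hermitian_inner z x ^ m * of_real (exp (- (norm x)\<^sup>2)))
    = fact m * taylor_part f m z * of_real (LINT x|(lborel :: (complex ^ 'n) measure). exp (- (norm x)\<^sup>2))"
proof -
  note [measurable] = borel_measurable_taylor_part[OF f]
  obtain M where M: "\<And>x. cmod (taylor_part f m x) \<le> M * exp (norm x)"
    using taylor_part_exp_bound by blast
  have int: "integrable lborel (\<lambda>w. (taylor_part f m w * exp (hermitian_inner z w)) * of_real (exp (- (norm w)\<^sup>2)))"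
  proof (rule integrable_gaussian_growth)
    fix w
    have "M * exp (norm (0 :: complex ^ 'n)) \<ge> 0" using M[of 0] norm_ge_zero order_trans by blast
    then have "M \<ge> 0" by simp
    have "cmod (exp (hermitian_inner z w)) \<le> exp (cmod (hermitian_inner z w))" by (rule norm_exp)
    also have "\<dots> \<le> exp (norm z * norm w)" by (simp add: cmod_hermitian_inner_le)
    finally have "cmod (taylor_part f m w * exp (hermitian_inner z w))
        \<le> M * exp (norm w) * exp (norm z * norm w)"
      unfolding norm_mult using M \<open>M \<ge> 0\<close> by (intro mult_mono) auto
    then show "cmod (taylor_part f m w * exp (hermitian_inner z w)) \<le> M * exp ((1 + norm z) * norm w)"
      by (simp add: mult.assoc algebra_simps flip: exp_add)
  qed measurable
  have "taylor_part f m z * of_real (LINT x|(lborel :: (complex ^ 'n) measure). exp (- (norm x)\<^sup>2))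
    = (LINT x|lborel. (LINT t|unit_interval_measure. (taylor_part f m (circ t *s x)
      * exp (hermitian_inner z (circ t *s x))) * of_real (exp (- (norm (circ t *s x))\<^sup>2))))"
    by (subst gaussian_reproducing[symmetric], rule rotation_average[OF int]) auto
  also have "\<dots> = (LINT x|lborel. taylor_part f m x * (hermitian_inner z x ^ m / fact m) * of_real (exp (- (norm x)\<^sup>2)))"
  proof (rule Bochner_Integration.integral_cong)
    fix x
    have "(LINT t|unit_interval_measure. (taylor_part f m (circ t *s x)
      * exp (hermitian_inner z (circ t *s x))) * of_real (exp (- (norm (circ t *s x))\<^sup>2)))
      = (LINT t|unit_interval_measure. (taylor_part f m x * of_real (exp (- (norm x)\<^sup>2)))
           * (circ t ^ m * exp (cnj (circ t) * hermitian_inner z x)))"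
      by (simp add: taylor_part_scale[OF f] hermitian_inner_scale_right norm_vec_scale mult_ac)
    also have "\<dots> = (taylor_part f m x * of_real (exp (- (norm x)\<^sup>2))) * (hermitian_inner z x ^ m / fact m)"
      by (simp only: integral_mult_right_zero exp_circle_coeff)
    finally show "(LINT t|unit_interval_measure. (taylor_part f m (circ t *s x)
      * exp (hermitian_inner z (circ t *s x))) * of_real (exp (- (norm (circ t *s x))\<^sup>2)))
      = taylor_part f m x * (hermitian_inner z x ^ m / fact m) * of_real (exp (- (norm x)\<^sup>2))"
      by (simp only: mult_ac)
  qed simp
  also have "\<dots> = (LINT x|lborel. 1 / fact m * (taylor_part f m x * hermitian_inner z x ^ m * of_real (exp (- (norm x)\<^sup>2))))"
    by (simp add: mult_ac)
  also have "\<dots> = 1 / fact m * (LINT x|lborel. taylor_part f m x * hermitian_inner z x ^ m * of_real (exp (- (norm x)\<^sup>2)))"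
    by (rule integral_mult_right_zero)
  finally show ?thesis by (simp add: field_simps)
qed

end

section \<open>The Bergman projection\<close>

lemma space_weighted_measure [simp]: "space (weighted_measure \<alpha>) = ball 0 1"
  by (simp add: weighted_measure_def space_restrict_space)

lemma sets_weighted_measure:
  "sets (weighted_measure \<alpha>) = sets (restrict_space borel (ball 0 1))"
  by (simp add: weighted_measure_def sets_restrict_space)

lemma sets_unit_ball [measurable]: "ball (0 :: complex ^ 'n) 1 \<in> sets borel"
  by simp

lemma borel_measurable_weightedI:
  "f \<in> borel_measurable borel \<Longrightarrow> f \<in> borel_measurable (weighted_measure \<alpha>)"
  unfolding measurable_cong_sets[OF sets_weighted_measure refl]
  by (rule measurable_restrict_space1)

lemma borel_measurable_weighted_continuous:
  assumes "continuous_on (ball 0 1) f"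
  shows "f \<in> borel_measurable (weighted_measure \<alpha>)"
  unfolding measurable_cong_sets[OF sets_weighted_measure refl]
  using assms by (rule borel_measurable_continuous_on_restrict)

abbreviation ball_weight :: "real \<Rightarrow> (complex ^ 'n) \<Rightarrow> real" where
  "ball_weight \<alpha> x \<equiv> weight_const TYPE('n) \<alpha> * (1 - (norm x)\<^sup>2) powr \<alpha>"

lemma norm_lt_1_iff_square: "norm x < 1 \<longleftrightarrow> 0 < 1 - (norm x)\<^sup>2"
  by (simp add: abs_square_less_1)

lemma weight_const_nonneg: "weight_const TYPE('n::finite) \<alpha> \<ge> 0"
  unfolding weight_const_def by (intro divide_nonneg_nonneg integral_nonneg) auto

text \<open>Moves integrals over the ball to \<open>lborel\<close>, where rotation invariance and
  the radial formula are available.\<close>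

lemma has_bochner_integral_weighted_iff:
  fixes f :: "complex ^ 'n \<Rightarrow> complex"
  assumes f: "f \<in> borel_measurable (weighted_measure \<alpha>)"
  shows "has_bochner_integral (weighted_measure \<alpha>) f c \<longleftrightarrow>
    has_bochner_integral lborel (\<lambda>x. indicator (ball 0 1) x * (of_real (ball_weight \<alpha> x) * f x)) c"
proof -
  have fr: "f \<in> borel_measurable (restrict_space lborel (ball 0 1))"
    using f by (simp add: measurable_cong_sets[OF sets_weighted_measure refl]
        measurable_cong_sets[OF sets_restrict_space_cong[OF sets_lborel] refl])
  have w: "(\<lambda>x::complex ^ 'n. ball_weight \<alpha> x) \<in> borel_measurable (restrict_space lborel (ball 0 1))"
    by (rule measurable_restrict_space1) measurable
  have "has_bochner_integral (weighted_measure \<alpha>) f c \<longleftrightarrow>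
     has_bochner_integral (restrict_space lborel (ball 0 1)) (\<lambda>x. ball_weight \<alpha> x *\<^sub>R f x) c"
    unfolding weighted_measure_def has_bochner_integral_iff
    using weight_const_nonneg[of \<alpha>, where 'n='n]
      integrable_density[OF fr w] integral_density[OF fr w] by simp
  also have "\<dots> \<longleftrightarrow> has_bochner_integral lborel (\<lambda>x. indicator (ball 0 1) x *\<^sub>R (ball_weight \<alpha> x *\<^sub>R f x)) c"
    unfolding has_bochner_integral_iff
    by (simp add: integrable_restrict_space integral_restrict_space set_integrable_def)
  finally show ?thesis unfolding indicator_scaleR unfolding scaleR_conv_of_real .
qed

lemma nn_integral_weighted:
  fixes f :: "complex ^ 'n \<Rightarrow> ennreal"
  assumes f: "f \<in> borel_measurable (weighted_measure \<alpha>)"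
  shows "(\<integral>\<^sup>+x. f x \<partial>weighted_measure \<alpha>)
    = (\<integral>\<^sup>+x. ennreal (ball_weight \<alpha> x) * f x * indicator (ball 0 1) x \<partial>lborel)"
proof -
  have fr: "f \<in> borel_measurable (restrict_space lborel (ball 0 1))"
    using f by (simp add: measurable_cong_sets[OF sets_weighted_measure refl]
        measurable_cong_sets[OF sets_restrict_space_cong[OF sets_lborel] refl])
  have w: "(\<lambda>x::complex ^ 'n. ennreal (ball_weight \<alpha> x)) \<in> borel_measurable (restrict_space lborel (ball 0 1))"
    by (rule measurable_restrict_space1) measurable
  show ?thesis
    unfolding weighted_measure_def using fr w
    by (simp add: nn_integral_density nn_integral_restrict_space)
qed

lemma holomorphic_ball_const: "holomorphic_ball (\<lambda>_. c)"
  unfolding holomorphic_ball_def by (intro ballI exI[of _ "\<lambda>_. 0"]) simp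

lemma taylor_part_one: "taylor_part (\<lambda>_. 1) 0 z = 1"
  by (simp add: taylor_part_def)

section \<open>Moments for the ball weight and its normalising constant\<close>

context
  fixes f :: "complex ^ 'n \<Rightarrow> complex" and m :: nat and z :: "complex ^ 'n"
  assumes f: "holomorphic_ball f"
begin

text \<open>The integrand without the weight is homogeneous of degree 2m, so the Gaussian and the
  ball weight see it through the same factor \<open>H\<close>. The Gaussian moment determines H
  \<Gamma>(k + 1) with k = m + n, and the ball profile contributes k B(k, \<alpha> + 1), which is
  \<Gamma>(k + 1) \<Gamma>(\<alpha> + 1) / \<Gamma>(k + \<alpha> + 1).\<close>

lemma taylor_part_moments:
  assumes "\<alpha> > -1"
  shows "has_bochner_integral lborel (\<lambda>x. taylor_part f m x * hermitian_inner z x ^ m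
      * of_real (indicator {..<1} ((norm x)\<^sup>2) * (1 - (norm x)\<^sup>2) powr \<alpha>))
    (fact m * taylor_part f m z * of_real (LINT x|(lborel :: (complex ^ 'n) measure). exp (- (norm x)\<^sup>2))
      * of_real (Gamma (\<alpha> + 1) / Gamma (real m + real CARD('n) + \<alpha> + 1)))"
proof -
  note [measurable] = borel_measurable_taylor_part[OF f]
  define h where "h x = taylor_part f m x * hermitian_inner z x ^ m" for x
  have [measurable]: "h \<in> borel_measurable borel"
    unfolding h_def[abs_def] by measurable
  define k where "k = (real (2 * m) + real DIM(complex ^ 'n)) / 2"
  have k: "k = real m + real CARD('n)" by (simp add: k_def)
  have kpos: "k > 0" by (simp add: k add_nonneg_pos)
  have hom: "h (t *\<^sub>R x) = of_real t ^ (2 * m) * h x" if "t > 0" for t x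
  proof -
    have "h (of_real t *s x) = of_real t ^ (2 * m) * h x"
      by (simp add: h_def taylor_part_scale[OF f] hermitian_inner_scale_right power_mult_distrib power_mult power2_eq_square mult_ac)
    then show ?thesis by (simp add: of_real_vec_scale)
  qed
  obtain M where M: "M \<ge> 0" "\<And>x. cmod (taylor_part f m x) \<le> M * norm x ^ m"
    using taylor_part_bound[OF f] by blast
  have int: "integrable lborel (\<lambda>x. indicator (ball 0 1) x * h x)"
  proof (rule Bochner_Integration.integrable_bound)
    show "integrable lborel (\<lambda>x::complex ^ 'n. (M * norm z ^ m) * indicator (ball 0 1) x)"
      using emeasure_lborel_ball_finite[of "0::complex ^ 'n" 1]
      by (intro integrable_mult_right integrable_real_indicator) auto
    have "cmod (h x) \<le> M * norm z ^ m" if "norm x < 1" for x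
    proof -
      have "cmod (taylor_part f m x) \<le> M"
        using M(2)[of x] mult_left_mono[OF power_le_one[of "norm x" m] M(1)] that by simp
      moreover have "cmod (hermitian_inner z x ^ m) \<le> norm z ^ m"
        unfolding norm_power using cmod_hermitian_inner_le[of z x] mult_left_mono[of "norm x" 1 "norm z"] that
        by (intro power_mono) auto
      ultimately show ?thesis unfolding h_def norm_mult using M(1) by (intro mult_mono) auto
    qed
    then show "AE x in lborel. norm (indicator (ball 0 1) x * h x) \<le> norm ((M * norm z ^ m) * indicator (ball 0 1) x)"
      using M(1) by (auto simp: indicator_def)
  qed measurable
  define H where "H = (LINT x|lborel. indicator (ball 0 1) x * h x)"
  have g: "has_bochner_integral lborel (\<lambda>x. h x * of_real (exp (- (norm x)\<^sup>2))) (H * of_real (Gamma (k + 1)))"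
    unfolding H_def
    using nn_integral_gaussian_radial[OF kpos] kpos int hom
    by (intro has_bochner_integral_radial[where d="2*m" and h=h and \<phi>="\<lambda>s. exp (- s)", folded k_def]) auto
  have b: "has_bochner_integral lborel (\<lambda>x. h x * of_real (indicator {..<1} ((norm x)\<^sup>2) * (1 - (norm x)\<^sup>2) powr \<alpha>))
     (H * of_real (k * Beta k (\<alpha> + 1)))"
    unfolding H_def
    using nn_integral_ball_radial[OF kpos assms] kpos int hom assms
    by (intro has_bochner_integral_radial[where d="2*m" and h=h and \<phi>="\<lambda>s. indicator {..<1} s * (1 - s) powr \<alpha>", folded k_def])
      (auto simp: Beta_def intro!: mult_nonneg_nonneg divide_nonneg_nonneg Gamma_real_nonneg)
  have "H * of_real (Gamma (k + 1)) = fact m * taylor_part f m z * of_real (LINT x|(lborel :: (complex ^ 'n) measure). exp (- (norm x)\<^sup>2))"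
    using has_bochner_integral_integral_eq[OF g] gaussian_moment[OF f, of m z] by (simp add: h_def)
  moreover have "k * Beta k (\<alpha> + 1) = Gamma (k + 1) * (Gamma (\<alpha> + 1) / Gamma (k + \<alpha> + 1))"
    using kpos by (subst Gamma_plus1) (auto simp: Beta_def add_ac elim!: nonpos_Ints_cases)
  ultimately have "H * of_real (k * Beta k (\<alpha> + 1)) = fact m * taylor_part f m z * of_real (LINT x|(lborel :: (complex ^ 'n) measure). exp (- (norm x)\<^sup>2))
      * of_real (Gamma (\<alpha> + 1) / Gamma (real m + real CARD('n) + \<alpha> + 1))"
    by (metis k mult.assoc of_real_mult)
  then show ?thesis using b by (simp add: h_def)
qed

end

lemma gaussian_integral_pos: "(LINT x|(lborel :: 'a::euclidean_space measure). exp (- (norm x)\<^sup>2)) > 0"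
proof -
  have "(LINT x|(lborel :: 'a measure). exp (- (norm x)\<^sup>2)) \<noteq> 0"
  proof
    assume "(LINT x|(lborel :: 'a measure). exp (- (norm x)\<^sup>2)) = 0"
    then have "AE x in (lborel :: 'a measure). exp (- (norm x)\<^sup>2) = 0"
      by (subst (asm) integral_nonneg_eq_0_iff_AE) (auto intro: integrable_gaussian)
    then have "AE x in (lborel :: 'a measure). False" by simp
    then show False by (simp add: AE_iff_null emeasure_lborel_UNIV null_sets_def)
  qed
  moreover have "(LINT x|(lborel :: 'a measure). exp (- (norm x)\<^sup>2)) \<ge> 0"
    by (intro Bochner_Integration.integral_nonneg) auto
  ultimately show ?thesis by linarith
qed

lemma indicator_lessThan_square: "indicator {..<1} ((norm x)\<^sup>2) = indicator (ball 0 1) x"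
  by (simp add: indicator_def abs_square_less_1)

text \<open>The moment of degree 0 of the constant function 1. The Gaussian integral is left
  unevaluated because it cancels in all normalised moments.\<close>

lemma weight_const_eq:
  assumes "\<alpha> > -1"
  shows "weight_const TYPE('n::finite) \<alpha> = Gamma (real CARD('n) + \<alpha> + 1)
    / ((LINT x|(lborel :: (complex ^ 'n) measure). exp (- (norm x)\<^sup>2)) * Gamma (\<alpha> + 1))"
proof -
  have "has_bochner_integral lborel (\<lambda>x::complex ^ 'n. complex_of_real (indicator (ball 0 1) x * (1 - (norm x)\<^sup>2) powr \<alpha>))
    (of_real ((LINT x|(lborel :: (complex ^ 'n) measure). exp (- (norm x)\<^sup>2))
      * (Gamma (\<alpha> + 1) / Gamma (real CARD('n) + \<alpha> + 1))))"
    using taylor_part_moments[OF holomorphic_ball_const[of 1] assms, of 0 "0::complex ^ 'n"]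
    by (simp add: taylor_part_one indicator_lessThan_square)
  from has_bochner_integral_integral_eq[OF this]
  have "(LINT x|lborel. indicator (ball 0 1) x * (1 - (norm (x :: complex ^ 'n))\<^sup>2) powr \<alpha>)
     = (LINT x|(lborel :: (complex ^ 'n) measure). exp (- (norm x)\<^sup>2))
      * (Gamma (\<alpha> + 1) / Gamma (real CARD('n) + \<alpha> + 1))"
    by (simp only: integral_complex_of_real of_real_eq_iff)
  then show ?thesis
    by (simp add: weight_const_def integral_restrict_space)
qed

lemma weight_const_pos:
  assumes "\<alpha> > -1"
  shows "weight_const TYPE('n::finite) \<alpha> > 0"
  using assms gaussian_integral_pos[where 'a="complex ^ 'n"] by (simp add: weight_const_eq)

text \<open>The constant is the reciprocal of the coefficient of x^m in (1 - x)^(-N), which is why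
  the kernel with exponent N reproduces.\<close>

lemma weighted_moments:
  fixes f :: "complex ^ 'n \<Rightarrow> complex"
  assumes "\<alpha> > -1" and f: "holomorphic_ball f"
  defines "N \<equiv> real CARD('n) + 1 + \<alpha>"
  shows "has_bochner_integral (weighted_measure \<alpha>) (\<lambda>x. taylor_part f m x * hermitian_inner z x ^ m)
    (of_real (fact m * Gamma N / Gamma (N + real m)) * taylor_part f m z)"
proof -
  note [measurable] = borel_measurable_taylor_part[OF f]
  define Z where "Z = (LINT x|(lborel :: (complex ^ 'n) measure). exp (- (norm x)\<^sup>2))"
  have "Z > 0" using gaussian_integral_pos[where 'a="complex ^ 'n"] by (simp add: Z_def)
  have c: "weight_const TYPE('n) \<alpha> = Gamma N / (Z * Gamma (\<alpha> + 1))"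
    using weight_const_eq[OF assms(1), where 'n='n] by (simp add: N_def Z_def add_ac)
  have "has_bochner_integral lborel (\<lambda>x. of_real (weight_const TYPE('n) \<alpha>) * (taylor_part f m x * hermitian_inner z x ^ m
      * of_real (indicator {..<1} ((norm x)\<^sup>2) * (1 - (norm x)\<^sup>2) powr \<alpha>)))
    (of_real (weight_const TYPE('n) \<alpha>) * (fact m * taylor_part f m z * of_real Z
      * of_real (Gamma (\<alpha> + 1) / Gamma (N + real m))))"
    using taylor_part_moments[OF f assms(1), of m z]
    by (intro has_bochner_integral_mult_right) (simp_all add: Z_def N_def add_ac)
  moreover have "of_real (weight_const TYPE('n) \<alpha>) * (fact m * taylor_part f m z * of_real Z
      * of_real (Gamma (\<alpha> + 1) / Gamma (N + real m)))
    = of_real (fact m * Gamma N / Gamma (N + real m)) * taylor_part f m z"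
  proof -
    have "Gamma (\<alpha> + 1) \<noteq> 0" using assms(1) Gamma_real_pos[of "\<alpha> + 1"] by linarith
    then show ?thesis using \<open>Z > 0\<close> unfolding c by (simp add: field_simps del: Gamma_eq_zero_iff)
  qed
  moreover have "(\<lambda>x. of_real (weight_const TYPE('n) \<alpha>) * (taylor_part f m x * hermitian_inner z x ^ m
      * of_real (indicator {..<1} ((norm x)\<^sup>2) * (1 - (norm x)\<^sup>2) powr \<alpha>)))
    = (\<lambda>x. indicator (ball 0 1) x * (of_real (ball_weight \<alpha> x) * (taylor_part f m x * hermitian_inner z x ^ m)))"
    by (rule ext) (simp add: indicator_lessThan_square split: split_indicator)
  ultimately have "has_bochner_integral lborel
      (\<lambda>x. indicator (ball 0 1) x * (of_real (ball_weight \<alpha> x) * (taylor_part f m x * hermitian_inner z x ^ m)))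
      (of_real (fact m * Gamma N / Gamma (N + real m)) * taylor_part f m z)"
    by (simp only:)
  moreover have "(\<lambda>x. taylor_part f m x * hermitian_inner z x ^ m) \<in> borel_measurable (weighted_measure \<alpha>)"
    by (rule borel_measurable_weightedI) measurable
  ultimately show ?thesis
    by (simp only: has_bochner_integral_weighted_iff)
qed

lemma emeasure_weighted_space:
  assumes "\<alpha> > -1"
  shows "emeasure (weighted_measure \<alpha> :: (complex ^ 'n) measure) (ball 0 1) = 1"
proof -
  have "Gamma (real CARD('n) + 1 + \<alpha>) > 0" using assms by (intro Gamma_real_pos) (simp add: add_pos_nonneg)
  then have h: "has_bochner_integral (weighted_measure \<alpha> :: (complex ^ 'n) measure) (\<lambda>_. 1 :: complex) 1"
    using weighted_moments[OF assms holomorphic_ball_const[of 1], of 0 "0 :: complex ^ 'n"]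
    by (simp add: taylor_part_one)
  then have "has_bochner_integral (weighted_measure \<alpha> :: (complex ^ 'n) measure) (\<lambda>_. Re 1) (Re 1)"
    by (rule has_bochner_integral_Re)
  then have i: "has_bochner_integral (weighted_measure \<alpha> :: (complex ^ 'n) measure) (\<lambda>_. 1 :: real) 1" by simp
  have "(\<integral>\<^sup>+x. ennreal 1 \<partial>(weighted_measure \<alpha> :: (complex ^ 'n) measure))
    = ennreal (LINT x|(weighted_measure \<alpha> :: (complex ^ 'n) measure). 1)"
    using i by (intro nn_integral_eq_integral) (auto simp: has_bochner_integral_iff)
  also have "\<dots> = 1" using has_bochner_integral_integral_eq[OF i] by (metis ennreal_1)
  finally show ?thesis by simp
qed

lemma finite_measure_weighted: "\<alpha> > -1 \<Longrightarrow> finite_measure (weighted_measure \<alpha>)"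
  by (intro finite_measureI) (simp add: emeasure_weighted_space)

text \<open>The coefficients are written with Gamma functions in order to cancel against the
  moments.\<close>

lemma negative_binomial_series:
  assumes "N > 0" "cmod x < 1"
  shows "(\<lambda>m. of_real (Gamma (N + real m) / (Gamma N * fact m)) * x ^ m) sums (1 / (1 - x) powr of_real N)"
proof -
  have "(\<lambda>m. ((- of_real N) gchoose m) * (- x) ^ m) sums (1 + - x) powr (- of_real N)"
    using assms by (intro gen_binomial_complex) simp
  moreover have "((- of_real N) gchoose m) * (- x) ^ m = of_real (Gamma (N + real m) / (Gamma N * fact m)) * x ^ m" for m
  proof -
    have "pochhammer N m = Gamma (N + real m) / Gamma N"
      using assms by (intro pochhammer_Gamma) (auto elim!: nonpos_Ints_cases)
    then have "of_real (Gamma (N + real m) / (Gamma N * fact m)) = (pochhammer (of_real N) m / fact m :: complex)"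
      by (simp add: pochhammer_of_real)
    moreover have "((- of_real N) gchoose m :: complex) = (- 1) ^ m * (pochhammer (of_real N) m / fact m)"
      by (simp only: gbinomial_pochhammer minus_minus times_divide_eq_right)
    moreover have "(- 1) ^ m * (- 1) ^ m = (1 :: complex)"
      by (simp only: power_mult_distrib[symmetric]) simp
    ultimately show ?thesis
      by (simp only: power_minus[of x] mult_ac) (simp only: mult.assoc[symmetric] mult_1_left)
  qed
  ultimately show ?thesis by (simp add: powr_minus_divide)
qed

text \<open>The kernel is expanded in powers of <z,x> and integrated term by term, with |f| times
  the convergent series of C_m |z|^m as majorant. The m-th term gives back the m-th Taylor part of
  \<open>f\<close>, and these sum to \<open>f z\<close>.\<close>

theorem bergman_reproducing:
  fixes f :: "complex ^ 'n \<Rightarrow> complex"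
  assumes "\<alpha> > -1" and f: "holomorphic_ball f" and int: "integrable (weighted_measure \<alpha>) f"
    and z: "norm z < 1"
  shows "bergman_projection \<alpha> f z = f z"
proof -
  define N where "N = real CARD('n) + 1 + \<alpha>"
  have "N > 0" using assms(1) by (simp add: N_def add_pos_nonneg)
  define C where "C m = Gamma (N + real m) / (Gamma N * fact m)" for m
  have C: "C m > 0" for m using \<open>N > 0\<close> by (simp add: C_def add_pos_nonneg)
  have zx: "cmod (hermitian_inner z x) \<le> norm z" if "norm x < 1" for x
    using cmod_hermitian_inner_le[of z x] mult_left_mono[of "norm x" 1 "norm z"] that by simp
  define g where "g m x = f x * (of_real (C m) * hermitian_inner z x ^ m)" for m x
  have meas: "(\<lambda>x. hermitian_inner z x) \<in> borel_measurable (weighted_measure \<alpha>)"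
    by (rule borel_measurable_weightedI) measurable
  have fm: "f \<in> borel_measurable (weighted_measure \<alpha>)" using int by auto
  have gm: "g m \<in> borel_measurable (weighted_measure \<alpha>)" for m
    unfolding g_def[abs_def] using meas fm by measurable
  have gb: "cmod (g m x) \<le> cmod (f x) * (C m * norm z ^ m)" if "norm x < 1" for m x
    unfolding g_def norm_mult norm_power using C[of m] zx[OF that]
    by (intro mult_left_mono mult_mono power_mono) auto
  have gi: "integrable (weighted_measure \<alpha>) (g m)" for m
  proof (rule Bochner_Integration.integrable_bound)
    show "integrable (weighted_measure \<alpha>) (\<lambda>x. cmod (f x) * (C m * norm z ^ m))"
      using int by (intro integrable_mult_left integrable_norm)
    show "AE x in weighted_measure \<alpha>. norm (g m x) \<le> norm (cmod (f x) * (C m * norm z ^ m))"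
      using gb C[of m] by (intro AE_I2) (simp add: norm_mult)
  qed (rule gm)
  have sC: "summable (\<lambda>m. C m * norm z ^ m)"
  proof -
    have "(\<lambda>m. of_real (C m) * of_real (norm z) ^ m) sums (1 / (1 - of_real (norm z)) powr of_real N :: complex)"
      unfolding C_def using negative_binomial_series[of N "of_real (norm z)"] \<open>N > 0\<close> z by simp
    then have "summable (\<lambda>m. Re (of_real (C m) * of_real (norm z) ^ m))"
      by (intro summable_Re) (rule sums_summable)
    then show ?thesis by (simp flip: of_real_power of_real_mult)
  qed
  have sn: "summable (\<lambda>m. cmod (g m x))" if "norm x < 1" for x
    using gb[OF that] by (intro summable_comparison_test'[OF summable_mult[OF sC]]) auto
  have "(\<lambda>m. LINT x|weighted_measure \<alpha>. g m x) sums (LINT x|weighted_measure \<alpha>. (\<Sum>m. g m x))"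
  proof (rule sums_integral[OF gi])
    show "AE x in weighted_measure \<alpha>. summable (\<lambda>m. norm (g m x))"
      using sn by (intro AE_I2) simp
    have "norm (LINT x|weighted_measure \<alpha>. norm (g m x)) \<le> (LINT x|weighted_measure \<alpha>. cmod (f x)) * (C m * norm z ^ m)" for m
    proof -
      have "(LINT x|weighted_measure \<alpha>. norm (g m x)) \<le> (LINT x|weighted_measure \<alpha>. cmod (f x) * (C m * norm z ^ m))"
        using gi[of m] int gb by (intro integral_mono integrable_norm integrable_mult_left) auto
      then show ?thesis by simp
    qed
    then show "summable (\<lambda>m. LINT x|weighted_measure \<alpha>. norm (g m x))"
      by (intro summable_comparison_test'[OF summable_mult[OF sC]]) auto
  qed
  also have "(LINT x|weighted_measure \<alpha>. (\<Sum>m. g m x)) = bergman_projection \<alpha> f z"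
    unfolding bergman_projection_def
  proof (rule Bochner_Integration.integral_cong)
    fix x assume "x \<in> space (weighted_measure \<alpha> :: (complex ^ 'n) measure)"
    then have "cmod (hermitian_inner z x) < 1" using zx[of x] z by simp
    then have "(\<lambda>m. g m x) sums (f x * (1 / (1 - hermitian_inner z x) powr of_real N))"
      unfolding g_def C_def using \<open>N > 0\<close> by (intro sums_mult negative_binomial_series)
    then show "(\<Sum>m. g m x) = f x / (1 - hermitian_inner z x) powr complex_of_real (real CARD('n) + 1 + \<alpha>)"
      by (simp add: sums_iff N_def)
  qed simp
  finally have "(\<lambda>m. LINT x|weighted_measure \<alpha>. g m x) sums bergman_projection \<alpha> f z" .
  moreover have "(LINT x|weighted_measure \<alpha>. g m x) = taylor_part f m z" for m
  proof -
    define G where "G x = indicator (ball 0 1) x * (of_real (ball_weight \<alpha> x) * g m x)" for x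
    have G: "has_bochner_integral lborel G (LINT x|weighted_measure \<alpha>. g m x)"
      using has_bochner_integral_integrable[OF gi] has_bochner_integral_weighted_iff[OF gm]
      unfolding G_def[abs_def] by blast
    have "(LINT x|weighted_measure \<alpha>. g m x) = (LINT x|lborel. G x)"
      using has_bochner_integral_integral_eq[OF G] by simp
    \<comment> \<open>Rotation of x produces the m-th power of \<open>cnj (circ t)\<close> from the
      inner product, so the mean over t replaces \<open>f\<close> by its m-th Taylor part.\<close>
    also have "\<dots> = (LINT x|lborel. (LINT t|unit_interval_measure. G (circ t *s x)))"
      using G by (intro rotation_average) (auto simp: has_bochner_integral_iff)
    also have "\<dots> = (LINT x|lborel. indicator (ball 0 1) x * (of_real (ball_weight \<alpha> x)
        * (of_real (C m) * (taylor_part f m x * hermitian_inner z x ^ m))))"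
    proof (rule Bochner_Integration.integral_cong)
      fix x :: "complex ^ 'n"
      show "(LINT t|unit_interval_measure. G (circ t *s x)) = indicator (ball 0 1) x * (of_real (ball_weight \<alpha> x)
        * (of_real (C m) * (taylor_part f m x * hermitian_inner z x ^ m)))"
      proof (cases "norm x < 1")
        case True
        have "(LINT t|unit_interval_measure. G (circ t *s x)) = (LINT t|unit_interval_measure.
          (of_real (ball_weight \<alpha> x) * of_real (C m) * hermitian_inner z x ^ m) * (f (circ t *s x) * cnj (circ t) ^ m))"
          using True by (simp add: G_def g_def indicator_def norm_vec_scale hermitian_inner_scale_right power_mult_distrib mult_ac)
        also have "\<dots> = (of_real (ball_weight \<alpha> x) * of_real (C m) * hermitian_inner z x ^ m) * taylor_part f m x"
          unfolding taylor_part_circle_mean[OF f True] by (rule integral_mult_right_zero)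
        finally show ?thesis using True by (simp add: mult_ac)
      qed (simp add: G_def indicator_def norm_vec_scale)
    qed simp
    also have "\<dots> = (LINT x|weighted_measure \<alpha>. of_real (C m) * (taylor_part f m x * hermitian_inner z x ^ m))"
    proof (rule has_bochner_integral_integral_eq, subst has_bochner_integral_weighted_iff[symmetric])
      note [measurable] = borel_measurable_taylor_part[OF f]
      show "(\<lambda>x. of_real (C m) * (taylor_part f m x * hermitian_inner z x ^ m)) \<in> borel_measurable (weighted_measure \<alpha>)"
        by (rule borel_measurable_weightedI) measurable
      show "has_bochner_integral (weighted_measure \<alpha>) (\<lambda>x. of_real (C m) * (taylor_part f m x * hermitian_inner z x ^ m))
         (LINT x|weighted_measure \<alpha>. of_real (C m) * (taylor_part f m x * hermitian_inner z x ^ m))"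
        using weighted_moments[OF assms(1) f, of m z]
        by (intro has_bochner_integral_integrable integrable_mult_right) (auto simp: has_bochner_integral_iff)
    qed
    also have "\<dots> = of_real (C m) * (of_real (fact m * Gamma N / Gamma (N + real m)) * taylor_part f m z)"
      using has_bochner_integral_integral_eq[OF weighted_moments[OF assms(1) f, of m z]]
      by (simp add: N_def)
    also have "\<dots> = of_real (C m * (fact m * Gamma N / Gamma (N + real m))) * taylor_part f m z"
      by simp
    also have "C m * (fact m * Gamma N / Gamma (N + real m)) = 1"
    proof -
      have "Gamma N \<noteq> 0" "Gamma (N + real m) \<noteq> 0"
        using \<open>N > 0\<close> Gamma_real_pos by (metis less_irrefl, metis add_pos_nonneg less_irrefl of_nat_0_le_iff)
      then show ?thesis by (simp add: C_def)
    qed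
    finally show ?thesis by simp
  qed
  ultimately have "(\<lambda>m. taylor_part f m z) sums bergman_projection \<alpha> f z" by simp
  then show ?thesis using taylor_part_sums[OF f z] by (rule sums_unique2)
qed

section \<open>Kernel estimates\<close>

text \<open>The modulus of the denominator of the kernel. It behaves as a quasi-metric up to the
  boundary, but on the diagonal its value is 1 - |z|^2 and not 0.\<close>

definition bdist :: "complex ^ 'n \<Rightarrow> complex ^ 'n \<Rightarrow> real" where
  "bdist z w = cmod (1 - hermitian_inner z w)"

lemma bdist_commute: "bdist z w = bdist w z"
  unfolding bdist_def by (metis cnj_hermitian_inner complex_cnj_diff complex_cnj_one complex_mod_cnj)

lemma borel_measurable_bdist [measurable (raw)]:
  assumes [measurable]: "f \<in> borel_measurable M" "g \<in> borel_measurable M"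
  shows "(\<lambda>x. bdist (f x) (g x)) \<in> borel_measurable M"
  unfolding bdist_def by measurable

lemma hermitian_inner_less_one:
  assumes "norm z < 1" "norm w < 1"
  shows "cmod (hermitian_inner z w) \<le> norm z" "cmod (hermitian_inner z w) < 1"
proof -
  show "cmod (hermitian_inner z w) \<le> norm z"
    using cmod_hermitian_inner_le[of z w] mult_left_mono[of "norm w" 1 "norm z"] assms by simp
  then show "cmod (hermitian_inner z w) < 1" using assms by simp
qed

lemma bdist_ge: assumes "norm z < 1" "norm w < 1" shows "1 - norm z \<le> bdist z w" "1 - norm w \<le> bdist z w"
proof -
  have "1 - cmod (hermitian_inner z w) \<le> bdist z w" for z w :: "complex ^ 'n"
    unfolding bdist_def using norm_triangle_ineq2[of 1 "hermitian_inner z w"] by simp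
  from this[of z w] this[of w z] show "1 - norm z \<le> bdist z w" "1 - norm w \<le> bdist z w"
    using hermitian_inner_less_one(1)[OF assms] hermitian_inner_less_one(1)[OF assms(2,1)]
    by (auto simp: bdist_commute[of w z])
qed

lemma one_minus_square_le: "0 \<le> r \<Longrightarrow> r \<le> 1 \<Longrightarrow> 1 - r\<^sup>2 \<le> 2 * (1 - (r::real))"
  using zero_le_power2[of "1 - r"] by (simp add: power2_diff)

lemma bdist_ge_square:
  assumes "norm z < 1" "norm w < 1"
  shows "1 - (norm z)\<^sup>2 \<le> 2 * bdist z w" "1 - (norm w)\<^sup>2 \<le> 2 * bdist z w"
  using bdist_ge[OF assms] one_minus_square_le[of "norm z"] one_minus_square_le[of "norm w"] assms by auto

lemma bdist_pos: "norm z < 1 \<Longrightarrow> norm w < 1 \<Longrightarrow> bdist z w > 0"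
  using bdist_ge[of z w] by simp

lemma bdist_le_2: "norm z < 1 \<Longrightarrow> norm w < 1 \<Longrightarrow> bdist z w \<le> 2"
  unfolding bdist_def using hermitian_inner_less_one[of z w] norm_triangle_ineq4[of 1 "hermitian_inner z w"] by simp

text \<open>|z - w|^2 is 2 Re (1 - <z,w>) minus the nonnegative numbers 1 - |z|^2 and 1 -
  |w|^2.\<close>

lemma norm_diff_square_le_bdist:
  assumes "norm z < 1" "norm w < 1"
  shows "(norm (z - w))\<^sup>2 \<le> 2 * bdist z w"
proof -
  have "of_real ((norm (z - w))\<^sup>2) = of_real ((norm z)\<^sup>2) + of_real ((norm w)\<^sup>2) - (hermitian_inner z w + cnj (hermitian_inner z w))"
    by (simp only: hermitian_inner_self[symmetric] hermitian_inner_diff_left hermitian_inner_diff_right cnj_hermitian_inner)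
      (simp add: algebra_simps)
  also have "hermitian_inner z w + cnj (hermitian_inner z w) = of_real (2 * Re (hermitian_inner z w))"
    by (rule complex_add_cnj)
  also have "of_real ((norm z)\<^sup>2) + of_real ((norm w)\<^sup>2) - of_real (2 * Re (hermitian_inner z w))
    = (of_real ((norm z)\<^sup>2 + (norm w)\<^sup>2 - 2 * Re (hermitian_inner z w)) :: complex)" by simp
  finally have "(norm (z - w))\<^sup>2 = (norm z)\<^sup>2 + (norm w)\<^sup>2 - 2 * Re (hermitian_inner z w)"
    by (simp only: of_real_eq_iff)
  moreover have "(norm z)\<^sup>2 \<le> 1" "(norm w)\<^sup>2 \<le> 1"
    using assms by (simp_all add: abs_square_le_1)
  moreover have "1 - Re (hermitian_inner z w) \<le> bdist z w"
    unfolding bdist_def using complex_Re_le_cmod[of "1 - hermitian_inner z w"] by simp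
  ultimately show ?thesis by linarith
qed

text \<open>Writing \<open>1 - \<langle>z,w\<rangle> = (1 - \<langle>z,u\<rangle>) + \<langle>z-u,u-w\<rangle> + (1 - \<langle>u,w\<rangle>) - (1 - \<bar>u\<bar>\<^sup>2)\<close>,
  the second term is controlled by the Euclidean distances.\<close>

lemma bdist_triangle:
  assumes "norm z < 1" "norm u < 1" "norm w < 1"
  shows "bdist z w \<le> 4 * (bdist z u + bdist u w)"
proof -
  have "1 - hermitian_inner z w = (1 - hermitian_inner z u) + hermitian_inner (z - u) (u - w)
      + (1 - hermitian_inner u w) - of_real (1 - (norm u)\<^sup>2)"
    by (simp add: hermitian_inner_diff_left hermitian_inner_diff_right of_real_diff
        hermitian_inner_self[symmetric] del: of_real_power)
  then have "bdist z w \<le> cmod (1 - hermitian_inner z u) + cmod (hermitian_inner (z - u) (u - w))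
      + cmod (1 - hermitian_inner u w) + cmod (of_real (1 - (norm u)\<^sup>2))"
    unfolding bdist_def by (metis norm_triangle_le norm_triangle_le_diff add_right_mono norm_triangle_ineq order_refl)
  also have "cmod (of_real (1 - (norm u)\<^sup>2)) \<le> 2 * bdist u w"
    using bdist_ge_square[OF assms(2,3)] assms(2) norm_lt_1_iff_square[of u]
    by (simp only: norm_of_real)
  also have "cmod (hermitian_inner (z - u) (u - w)) \<le> bdist z u + bdist u w"
  proof -
    have "cmod (hermitian_inner (z - u) (u - w)) \<le> norm (z - u) * norm (u - w)"
      by (rule cmod_hermitian_inner_le)
    also have "\<dots> \<le> ((norm (z - u))\<^sup>2 + (norm (u - w))\<^sup>2) / 2"
      using zero_le_power2[of "norm (z - u) - norm (u - w)"] by (simp add: power2_diff)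
    also have "\<dots> \<le> bdist z u + bdist u w"
      using norm_diff_square_le_bdist[OF assms(1,2)] norm_diff_square_le_bdist[OF assms(2,3)] by simp
    finally show ?thesis .
  qed
  finally have "bdist z w \<le> 2 * bdist z u + 4 * bdist u w"
    by (simp add: bdist_def)
  then show ?thesis using bdist_pos[OF assms(1,2)] by simp
qed

section \<open>Holomorphic functions of the inner product\<close>

lemma cmod_one_minus_powr:
  "cmod ((1 - hermitian_inner z w) powr of_real s) = bdist z w powr s"
  by (simp add: bdist_def norm_powr_real_powr')

lemma has_derivative_hermitian_inner:
  "((\<lambda>z. hermitian_inner z (w :: complex ^ 'n)) has_derivative (\<lambda>v. hermitian_inner v w)) F"
proof -
  have "bounded_linear (\<lambda>z. hermitian_inner z w)"
  proof (rule linear_conv_bounded_linear[THEN iffD1], rule linearI)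
    fix r and x :: "complex ^ 'n"
    show "hermitian_inner (r *\<^sub>R x) w = r *\<^sub>R hermitian_inner x w"
      by (simp only: of_real_vec_scale[symmetric] hermitian_inner_scale_left scaleR_conv_of_real)
  qed (rule hermitian_inner_add_left)
  then show ?thesis by (rule bounded_linear_imp_has_derivative)
qed

lemma holomorphic_ball_inner:
  assumes G: "G holomorphic_on ball 0 1" and a: "norm (a :: complex ^ 'n) < 1"
  shows "holomorphic_ball (\<lambda>z. G (hermitian_inner z a))"
  unfolding holomorphic_ball_def
proof
  fix z assume "z \<in> ball (0 :: complex ^ 'n) 1"
  then have "hermitian_inner z a \<in> ball 0 1" using hermitian_inner_less_one[of z a] a by simp
  then have "(G has_derivative (*) (deriv G (hermitian_inner z a))) (at (hermitian_inner z a))"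
    using holomorphic_derivI[OF G] by (auto simp: has_field_derivative_def)
  then have "((\<lambda>z. G (hermitian_inner z a)) has_derivative (\<lambda>v. deriv G (hermitian_inner z a) * hermitian_inner v a)) (at z)"
    by (rule has_derivative_compose[OF has_derivative_hermitian_inner])
  then show "\<exists>D. ((\<lambda>z. G (hermitian_inner z a)) has_derivative D) (at z) \<and> (\<forall>c v. D (c *s v) = c * D v)"
    by (intro exI[of _ "\<lambda>v. deriv G (hermitian_inner z a) * hermitian_inner v a"])
      (simp add: hermitian_inner_scale_left)
qed

lemma holomorphic_ball_mult:
  fixes f g :: "complex ^ 'n \<Rightarrow> complex"
  assumes "holomorphic_ball f" "holomorphic_ball g"
  shows "holomorphic_ball (\<lambda>z. f z * g z)"
  unfolding holomorphic_ball_def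
proof
  fix z assume "z \<in> ball (0 :: complex ^ 'n) 1"
  then obtain D D' where D: "(f has_derivative D) (at z)" "(g has_derivative D') (at z)"
    "\<And>c v. D (c *s v) = c * D v" "\<And>c v. D' (c *s v) = c * D' v"
    using assms unfolding holomorphic_ball_def by meson
  then show "\<exists>D. ((\<lambda>z. f z * g z) has_derivative D) (at z) \<and> (\<forall>c v. D (c *s v) = c * D v)"
    by (intro exI[of _ "\<lambda>h. f z * D' h + D h * g z"] conjI has_derivative_mult D(1,2)) (simp add: D(3,4) algebra_simps)
qed

lemma holomorphic_kernel: "(\<lambda>x. 1 / (1 - x) powr of_real s) holomorphic_on ball 0 1"
proof -
  have "1 - x \<notin> \<real>\<^sub>\<le>\<^sub>0" if "x \<in> ball 0 1" for x :: complex
  proof -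
    have "Re x < 1" using that complex_Re_le_cmod[of x] by simp
    then show ?thesis by (auto simp: complex_nonpos_Reals_iff)
  qed
  then show ?thesis by (intro holomorphic_intros) auto
qed

lemma borel_measurable_weighted_ident: "(\<lambda>x. x) \<in> borel_measurable (weighted_measure \<alpha>)"
  by (rule borel_measurable_weightedI) simp

text \<open>1 - <z,w> has positive real part, hence stays off the branch cut, and conjugation passes
  through the principal power.\<close>

lemma cnj_one_minus_powr:
  assumes "norm z < 1" "norm w < 1"
  shows "cnj ((1 - hermitian_inner z w) powr of_real s) = (1 - hermitian_inner w z) powr of_real s"
proof -
  have "Re (hermitian_inner z w) < 1"
    using hermitian_inner_less_one[OF assms] complex_Re_le_cmod[of "hermitian_inner z w"] by linarith
  then show ?thesis by (subst cnj_powr) (simp_all add: cnj_hermitian_inner)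
qed

section \<open>Volumes of quasi-balls and integrals of kernel powers\<close>

lemma integrable_weighted_bounded:
  fixes f :: "complex ^ 'n \<Rightarrow> complex"
  assumes "\<alpha> > -1" "f \<in> borel_measurable (weighted_measure \<alpha>)" "\<And>x. norm x < 1 \<Longrightarrow> cmod (f x) \<le> B"
  shows "integrable (weighted_measure \<alpha>) f"
  using assms finite_measure_weighted[OF assms(1)]
  by (intro finite_measure.integrable_const_bound[where B=B] AE_I2) auto

lemma integrable_weighted_holomorphic:
  assumes "\<alpha> > -1" "holomorphic_ball f" "bounded (f ` ball 0 1)"
  shows "integrable (weighted_measure \<alpha>) f"
proof -
  obtain B where "\<forall>x\<in>ball 0 1. cmod (f x) \<le> B" using assms(3) by (auto simp: bounded_iff)
  then show ?thesis
    using assms by (intro integrable_weighted_bounded[where B=B] borel_measurable_weighted_continuous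
      holomorphic_ball_imp_continuous_on) auto
qed

text \<open>The reproducing formula at \<open>a\<close> for F w = (1 - <w,a>)^(-N): the integrand F
  w times the kernel is the squared modulus of the kernel, and F a is the right-hand side.\<close>

lemma kernel_square_integral:
  assumes "\<alpha> > -1" and a: "norm (a :: complex ^ 'n) < 1"
  defines "N \<equiv> real CARD('n) + 1 + \<alpha>"
  shows "(\<integral>\<^sup>+w. ennreal (bdist a w powr (- (2 * N))) \<partial>weighted_measure \<alpha>) = ennreal ((1 - (norm a)\<^sup>2) powr (- N))"
proof -
  have N: "N > 0" using assms(1) by (simp add: N_def add_pos_nonneg)
  define F where "F w = 1 / (1 - hermitian_inner w a) powr of_real N" for w
  have F: "holomorphic_ball F" unfolding F_def using a by (intro holomorphic_ball_inner holomorphic_kernel)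
  have Fb: "cmod (F w) \<le> (1 - norm a) powr (- N)" if "norm w < 1" for w
    unfolding F_def norm_divide cmod_one_minus_powr using bdist_ge(2)[OF that a] a N bdist_pos[OF that a]
    by (simp add: powr_minus_divide[symmetric] powr_mono2')
  have Fi: "integrable (weighted_measure \<alpha>) F"
    using assms(1) F Fb
    by (intro integrable_weighted_holomorphic) (auto simp: bounded_iff intro!: exI[of _ "(1 - norm a) powr (- N)"])
  have "(LINT w|weighted_measure \<alpha>. of_real (bdist a w powr (- (2 * N)))) = bergman_projection \<alpha> F a"
    unfolding bergman_projection_def
  proof (rule Bochner_Integration.integral_cong)
    fix w assume "w \<in> space (weighted_measure \<alpha> :: (complex ^ 'n) measure)"
    then have w: "norm w < 1" by simp
    have "F w / (1 - hermitian_inner a w) powr of_real N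
      = 1 / (cnj ((1 - hermitian_inner a w) powr of_real N) * (1 - hermitian_inner a w) powr of_real N)"
      using cnj_one_minus_powr[OF a w, of N] by (simp add: F_def)
    also have "\<dots> = 1 / of_real ((bdist a w powr N)\<^sup>2)"
      using complex_norm_square[of "(1 - hermitian_inner a w) powr of_real N"]
      by (simp add: cmod_one_minus_powr mult.commute)
    also have "\<dots> = of_real (bdist a w powr (- (2 * N)))"
    proof -
      have "(bdist a w powr N)\<^sup>2 = bdist a w powr (2 * N)"
        by (simp add: power2_eq_square flip: powr_add)
      then show ?thesis by (simp add: powr_minus inverse_eq_divide)
    qed
    finally show "of_real (bdist a w powr (- (2 * N))) = F w / (1 - hermitian_inner a w) powr complex_of_real (real CARD('n) + 1 + \<alpha>)"
      by (simp add: N_def)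
  qed simp
  also have "\<dots> = F a" by (rule bergman_reproducing[OF assms(1) F Fi a])
  also have "F a = of_real ((1 - (norm a)\<^sup>2) powr (- N))"
  proof -
    have "0 \<le> 1 - (norm a)\<^sup>2" using a norm_lt_1_iff_square[of a] by simp
    moreover have "1 - hermitian_inner a a = of_real (1 - (norm a)\<^sup>2)" by (simp add: hermitian_inner_self)
    ultimately have "(1 - hermitian_inner a a) powr of_real N = of_real ((1 - (norm a)\<^sup>2) powr N)"
      by (simp only: powr_of_real)
    then show ?thesis by (simp add: F_def powr_minus inverse_eq_divide)
  qed
  finally have eq: "(LINT w|weighted_measure \<alpha>. bdist a w powr (- (2 * N))) = (1 - (norm a)\<^sup>2) powr (- N)"
    by (simp only: integral_complex_of_real of_real_eq_iff)
  note [measurable] = borel_measurable_weighted_ident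
  have "integrable (weighted_measure \<alpha>) (\<lambda>w. bdist a w powr (- (2 * N)))"
  proof (rule finite_measure.integrable_const_bound[where B="(1 - norm a) powr (- (2 * N))"])
    show "AE w in weighted_measure \<alpha>. norm (bdist a w powr (- (2 * N))) \<le> (1 - norm a) powr (- (2 * N))"
      using bdist_ge(1)[OF a] a N by (intro AE_I2) (auto intro!: powr_mono2')
  qed (auto simp: finite_measure_weighted assms(1))
  then show ?thesis using eq by (subst nn_integral_eq_integral) auto
qed

lemma sets_bdist_ball: "{w \<in> ball 0 1. bdist z w \<le> r} \<in> sets (weighted_measure \<alpha>)"
proof -
  note [measurable] = borel_measurable_weighted_ident
  have "{w \<in> space (weighted_measure \<alpha>). bdist z w \<le> r} \<in> sets (weighted_measure \<alpha>)" by measurable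
  then show ?thesis by simp
qed

text \<open>The kernel centred at \<open>(1 - r) z\<close> is at least \<open>(2 r) powr (- 2 N)\<close> on the ball of
  radius \<open>r\<close> around \<open>z\<close>.\<close>

lemma emeasure_bdist_ball_le:
  assumes "\<alpha> > -1" and z: "norm (z :: complex ^ 'n) < 1" and "r > 0"
  defines "N \<equiv> real CARD('n) + 1 + \<alpha>"
  shows "emeasure (weighted_measure \<alpha>) {w \<in> ball 0 1. bdist z w \<le> r} \<le> ennreal (4 powr N * r powr N)"
proof (cases "r \<le> 1")
  case False
  have N: "N > 0" using assms(1) by (simp add: N_def add_pos_nonneg)
  have "emeasure (weighted_measure \<alpha>) {w \<in> ball 0 1. bdist z w \<le> r} \<le> emeasure (weighted_measure \<alpha> :: (complex ^ 'n) measure) (ball 0 1)"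
    using emeasure_space[of "weighted_measure \<alpha> :: (complex ^ 'n) measure"] by simp
  also have "\<dots> = 1" by (rule emeasure_weighted_space[OF assms(1)])
  also have "1 \<le> ennreal (4 powr N * r powr N)"
    using False N mult_mono[of 1 "4 powr N" 1 "r powr N"] by (simp add: ge_one_powr_ge_zero)
  finally show ?thesis .
next
  case True
  have N: "N > 0" using assms(1) by (simp add: N_def add_pos_nonneg)
  \<comment> \<open>Moving \<open>z\<close> towards the origin makes 1 - |a|^2 at least
    \<open>r\<close> while \<open>bdist a w\<close> stays below 2 r on the ball; both sides of the
    kernel integral then become powers of \<open>r\<close>.\<close>
  define a where "a = (1 - r) *\<^sub>R z"
  have na: "norm a \<le> 1 - r" using True z \<open>r > 0\<close> mult_left_mono[of "norm z" 1 "1 - r"] by (simp add: a_def)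
  then have a: "norm a < 1" using \<open>r > 0\<close> by simp
  have "(norm a)\<^sup>2 \<le> (1 - r)\<^sup>2" using na by (intro power_mono) auto
  also have "\<dots> \<le> 1 - r" using True \<open>r > 0\<close> mult_right_mono[of "1 - r" 1 "1 - r"] by (simp add: power2_eq_square)
  finally have ra: "r \<le> 1 - (norm a)\<^sup>2" by simp
  let ?S = "{w \<in> ball 0 1. bdist z w \<le> r}"
  have lower: "(2 * r) powr (- (2 * N)) \<le> bdist a w powr (- (2 * N))" if "w \<in> ?S" for w
  proof -
    have "1 - hermitian_inner a w = (1 - hermitian_inner z w) + of_real r * hermitian_inner z w"
    proof -
      have "hermitian_inner a w = of_real (1 - r) * hermitian_inner z w"
        by (simp only: a_def of_real_vec_scale[symmetric] hermitian_inner_scale_left)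
      then show ?thesis by (simp add: algebra_simps)
    qed
    then have "bdist a w \<le> bdist z w + cmod (of_real r * hermitian_inner z w)"
      unfolding bdist_def by (metis norm_triangle_ineq)
    also have "\<dots> \<le> r + r * 1"
      using that z hermitian_inner_less_one[of z w] \<open>r > 0\<close>
      by (intro add_mono) (auto simp: norm_mult)
    finally show ?thesis using bdist_pos[of a w] a that N by (intro powr_mono2') auto
  qed
  have "ennreal ((2 * r) powr (- (2 * N))) * emeasure (weighted_measure \<alpha>) ?S
    = (\<integral>\<^sup>+w. ennreal ((2 * r) powr (- (2 * N))) * indicator ?S w \<partial>weighted_measure \<alpha>)"
    using sets_bdist_ball by (subst nn_integral_cmult_indicator) auto
  also have "\<dots> \<le> (\<integral>\<^sup>+w. ennreal (bdist a w powr (- (2 * N))) \<partial>weighted_measure \<alpha>)"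
    using lower by (intro nn_integral_mono) (auto simp: indicator_def intro!: ennreal_leI)
  also have "\<dots> = ennreal ((1 - (norm a)\<^sup>2) powr (- N))"
    unfolding N_def by (rule kernel_square_integral[OF assms(1) a])
  also have "\<dots> \<le> ennreal (r powr (- N))"
    using ra \<open>r > 0\<close> N by (intro ennreal_leI powr_mono2') auto
  finally have "ennreal ((2 * r) powr (2 * N)) * (ennreal ((2 * r) powr (- (2 * N))) * emeasure (weighted_measure \<alpha>) ?S)
     \<le> ennreal ((2 * r) powr (2 * N)) * ennreal (r powr (- N))"
    by (rule mult_left_mono) simp
  moreover have "ennreal ((2 * r) powr (2 * N)) * ennreal ((2 * r) powr (- (2 * N))) = 1"
    using \<open>r > 0\<close> by (simp flip: ennreal_mult powr_add)
  moreover have "(2 * r) powr (2 * N) * r powr (- N) = 4 powr N * r powr N"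
  proof -
    have "(2 * r) powr (2 * N) = 2 powr (2 * N) * r powr (2 * N)"
      using \<open>r > 0\<close> by (simp add: powr_mult)
    moreover have "2 powr (2 * N) = 4 powr N"
      using powr_powr[of 2 2 N] by simp
    moreover have "r powr (2 * N) * r powr (- N) = r powr N"
      by (simp flip: powr_add)
    ultimately show ?thesis by simp
  qed
  ultimately show ?thesis
    by (simp add: mult.assoc[symmetric] flip: ennreal_mult)
qed

text \<open>The Forelli--Rudin estimate follows by integrating the volume bound over all radii.\<close>

lemma forelli_rudin:
  fixes \<alpha> c :: real
  assumes "\<alpha> > -1" "c > 0"
  defines "N \<equiv> real CARD('n::finite) + 1 + \<alpha>"
  obtains C where "C > 0"
    "\<And>z :: complex ^ 'n. norm z < 1 \<Longrightarrow> (\<integral>\<^sup>+w. ennreal (bdist z w powr (- (N + c))) \<partial>weighted_measure \<alpha>)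
      \<le> ennreal (C * (1 - (norm z)\<^sup>2) powr (- c))"
proof
  have N: "N > 0" using assms(1) by (simp add: N_def add_pos_nonneg)
  define k where "k = N + c"
  have k: "k > 0" using N assms by (simp add: k_def)
  \<comment> \<open>4^N is the volume constant, k/c compares the layer densities of the powers -k
    and -c, and 2^c passes from 1 - |z| to 1 - |z|^2.\<close>
  define C where "C = 4 powr N * k / c * 2 powr c"
  show "C > 0" using k assms by (simp add: C_def)
  fix z :: "complex ^ 'n" assume z: "norm z < 1"
  interpret finite_measure "weighted_measure \<alpha> :: (complex ^ 'n) measure"
    by (rule finite_measure_weighted[OF assms(1)])
  note [measurable] = borel_measurable_weighted_ident
  interpret pair_sigma_finite lborel "weighted_measure \<alpha> :: (complex ^ 'n) measure" ..
  \<comment> \<open>Layer formula: a negative power of \<open>b\<close> is an integral over all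
    radii r \<ge> b.\<close>
  have tail: "(\<integral>\<^sup>+r. ennreal (e * r powr (- e - 1)) * indicator {b..} r \<partial>lborel) = ennreal (b powr (- e))"
    if "b > 0" "e > 0" for b e :: real
  proof -
    have "((\<lambda>r. e * r powr (- e - 1)) has_integral e * (- (b powr (- e - 1 + 1)) / (- e - 1 + 1))) {b..}"
      using that by (intro has_integral_mult_right has_integral_powr_to_inf) auto
    then show ?thesis
      using that nn_integral_has_integral_lebesgue'[of "{b..}" "\<lambda>r. e * r powr (- e - 1)"] by simp
  qed
  have "(\<integral>\<^sup>+w. ennreal (bdist z w powr (- (N + c))) \<partial>weighted_measure \<alpha>)
    = (\<integral>\<^sup>+w. (\<integral>\<^sup>+r. ennreal (k * r powr (- k - 1)) * indicator {bdist z w..} r \<partial>lborel) \<partial>weighted_measure \<alpha>)"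
    unfolding k_def[symmetric] using z k by (intro nn_integral_cong) (simp add: tail bdist_pos)
  also have "\<dots> = (\<integral>\<^sup>+r. (\<integral>\<^sup>+w. ennreal (k * r powr (- k - 1)) * indicator {bdist z w..} r \<partial>weighted_measure \<alpha>) \<partial>lborel)"
  proof (rule Fubini')
    have "(\<lambda>p. ennreal (k * fst p powr (- k - 1)) * (if bdist z (snd p) \<le> fst p then 1 else 0))
        \<in> borel_measurable (lborel \<Otimes>\<^sub>M weighted_measure \<alpha>)"
      by measurable
    then show "(\<lambda>(r, w). ennreal (k * r powr (- k - 1)) * indicator {bdist z w..} r)
        \<in> borel_measurable (lborel \<Otimes>\<^sub>M weighted_measure \<alpha>)"
      by (simp add: case_prod_beta' indicator_def of_bool_def)
  qed
  also have "\<dots> \<le> (\<integral>\<^sup>+r. ennreal (4 powr N * k / c) * (ennreal (c * r powr (- c - 1)) * indicator {1 - norm z..} r) \<partial>lborel)"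
  proof (rule nn_integral_mono)
    fix r :: real
    show "(\<integral>\<^sup>+w. ennreal (k * r powr (- k - 1)) * indicator {bdist z w..} r \<partial>weighted_measure \<alpha>)
      \<le> ennreal (4 powr N * k / c) * (ennreal (c * r powr (- c - 1)) * indicator {1 - norm z..} r)"
    proof (cases "1 - norm z \<le> r")
      case True
      then have r: "r > 0" using z by simp
      have "(\<integral>\<^sup>+w. ennreal (k * r powr (- k - 1)) * indicator {bdist z w..} r \<partial>weighted_measure \<alpha>)
        = (\<integral>\<^sup>+w. ennreal (k * r powr (- k - 1)) * indicator {w \<in> ball 0 1. bdist z w \<le> r} w \<partial>weighted_measure \<alpha>)"
        by (intro nn_integral_cong) (auto simp: indicator_def)
      also have "\<dots> = ennreal (k * r powr (- k - 1)) * emeasure (weighted_measure \<alpha>) {w \<in> ball 0 1. bdist z w \<le> r}"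
        by (rule nn_integral_cmult_indicator[OF sets_bdist_ball])
      also have "\<dots> \<le> ennreal (k * r powr (- k - 1)) * ennreal (4 powr N * r powr N)"
        unfolding N_def using assms(1) z r by (intro mult_left_mono emeasure_bdist_ball_le) auto
      also have "\<dots> = ennreal (4 powr N * k / c) * ennreal (c * r powr (- c - 1))"
      proof -
        have "r powr (- k - 1) * r powr N = r powr (- c - 1)" by (simp add: k_def flip: powr_add)
        then have "k * r powr (- k - 1) * (4 powr N * r powr N) = 4 powr N * k / c * (c * r powr (- c - 1))"
          using assms(2) by (simp add: mult_ac)
        then show ?thesis using k assms(2) by (simp flip: ennreal_mult)
      qed
      finally show ?thesis using True by simp
    next
      \<comment> \<open>By \<open>bdist_ge\<close>, balls of radius below 1 - |z| are empty; this
        cutoff makes the integral over radii converge at its lower end.\<close>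
      case False
      have "(\<integral>\<^sup>+w. ennreal (k * r powr (- k - 1)) * indicator {bdist z w..} r \<partial>weighted_measure \<alpha>)
        = (\<integral>\<^sup>+w. 0 \<partial>(weighted_measure \<alpha> :: (complex ^ 'n) measure))"
        using False bdist_ge(1)[OF z] by (intro nn_integral_cong) (auto simp: indicator_def dest: order_trans)
      then show ?thesis by simp
    qed
  qed
  also have "\<dots> = ennreal (4 powr N * k / c) * ennreal ((1 - norm z) powr (- c))"
    using z assms(2) by (subst nn_integral_cmult) (simp_all add: tail)
  also have "\<dots> \<le> ennreal (C * (1 - (norm z)\<^sup>2) powr (- c))"
  proof -
    have "(1 - norm z) powr (- c) \<le> ((1 - (norm z)\<^sup>2) / 2) powr (- c)"
      using one_minus_square_le[of "norm z"] z norm_lt_1_iff_square[of z] assms(2) by (intro powr_mono2') auto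
    also have "\<dots> = 2 powr c * (1 - (norm z)\<^sup>2) powr (- c)"
      using z norm_lt_1_iff_square[of z] by (simp add: powr_divide powr_minus divide_simps)
    finally have "4 powr N * k / c * (1 - norm z) powr (- c) \<le> 4 powr N * k / c * (2 powr c * (1 - (norm z)\<^sup>2) powr (- c))"
      using k assms(2) by (intro mult_left_mono) auto
    then show ?thesis using k assms(2) by (simp add: C_def mult.assoc ennreal_leI flip: ennreal_mult)
  qed
  finally show "(\<integral>\<^sup>+w. ennreal (bdist z w powr (- (N + c))) \<partial>weighted_measure \<alpha>)
      \<le> ennreal (C * (1 - (norm z)\<^sup>2) powr (- c))" .
qed

lemma nn_integral_weighted_shift:
  fixes f :: "complex ^ 'n \<Rightarrow> ennreal"
  assumes "\<alpha> > -1" "\<alpha> + t > -1" and f: "f \<in> borel_measurable (weighted_measure \<alpha>)"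
  shows "(\<integral>\<^sup>+w. f w * ennreal ((1 - (norm w)\<^sup>2) powr t) \<partial>weighted_measure \<alpha>)
    = ennreal (weight_const TYPE('n) \<alpha> / weight_const TYPE('n) (\<alpha> + t)) * (\<integral>\<^sup>+w. f w \<partial>weighted_measure (\<alpha> + t))"
proof -
  define r where "r = weight_const TYPE('n) \<alpha> / weight_const TYPE('n) (\<alpha> + t)"
  have r: "r > 0" "weight_const TYPE('n) \<alpha> = r * weight_const TYPE('n) (\<alpha> + t)"
    using weight_const_pos[OF assms(1), where 'n='n] weight_const_pos[OF assms(2), where 'n='n] by (simp_all add: r_def)
  have f': "f \<in> borel_measurable (weighted_measure (\<alpha> + t))"
    using f unfolding measurable_cong_sets[OF sets_weighted_measure refl] .
  have fr: "f \<in> borel_measurable (restrict_space lborel (ball 0 1))"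
    using f by (simp add: measurable_cong_sets[OF sets_weighted_measure refl]
        measurable_cong_sets[OF sets_restrict_space_cong[OF sets_lborel] refl])
  have "(\<integral>\<^sup>+w. f w * ennreal ((1 - (norm w)\<^sup>2) powr t) \<partial>weighted_measure \<alpha>)
    = (\<integral>\<^sup>+w. ennreal (ball_weight \<alpha> w) * (f w * ennreal ((1 - (norm w)\<^sup>2) powr t)) * indicator (ball 0 1) w \<partial>lborel)"
    by (intro nn_integral_weighted borel_measurable_times_ennreal f
      borel_measurable_weightedI[of "\<lambda>w. ennreal ((1 - (norm w)\<^sup>2) powr t)"]) simp
  also have "\<dots> = (\<integral>\<^sup>+w\<in>ball 0 1. ennreal r * (ennreal (ball_weight (\<alpha> + t) w) * f w) \<partial>lborel)"
    using r weight_const_pos[OF assms(2), where 'n='n]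
    by (intro nn_integral_cong) (auto simp: indicator_def powr_add ennreal_mult mult_ac)
  also have "\<dots> = (\<integral>\<^sup>+w. ennreal r * (ennreal (ball_weight (\<alpha> + t) w) * f w) \<partial>restrict_space lborel (ball 0 1))"
    by (simp add: nn_integral_restrict_space)
  also have "\<dots> = ennreal r * (\<integral>\<^sup>+w. ennreal (ball_weight (\<alpha> + t) w) * f w \<partial>restrict_space lborel (ball 0 1))"
  proof (intro nn_integral_cmult borel_measurable_times_ennreal fr)
    show "(\<lambda>w::complex ^ 'n. ennreal (ball_weight (\<alpha> + t) w)) \<in> borel_measurable (restrict_space lborel (ball 0 1))"
      by (rule measurable_restrict_space1) measurable
  qed
  also have "(\<integral>\<^sup>+w. ennreal (ball_weight (\<alpha> + t) w) * f w \<partial>restrict_space lborel (ball 0 1))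
     = (\<integral>\<^sup>+w. f w \<partial>weighted_measure (\<alpha> + t))"
    by (simp add: nn_integral_weighted[OF f'] nn_integral_restrict_space)
  finally show ?thesis by (simp add: r_def)
qed

text \<open>The factor (1 - |w|^2)^(-e) changes the weight to \<alpha> - e. For that weight the
  exponent N exceeds the critical one by exactly e, so the Forelli-Rudin estimate returns the same
  power -e of 1 - |z|^2.\<close>

lemma schur_bound:
  fixes \<alpha> e :: real
  assumes "\<alpha> > -1" "0 < e" "e < \<alpha> + 1"
  defines "N \<equiv> real CARD('n::finite) + 1 + \<alpha>"
  obtains C where "C > 0"
    "\<And>z :: complex ^ 'n. norm z < 1 \<Longrightarrow>
      (\<integral>\<^sup>+w. ennreal (bdist z w powr (- N)) * ennreal ((1 - (norm w)\<^sup>2) powr (- e)) \<partial>weighted_measure \<alpha>)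
      \<le> ennreal (C * (1 - (norm z)\<^sup>2) powr (- e))"
proof -
  have a: "\<alpha> - e > -1" using assms by simp
  obtain C where C: "C > 0" "\<And>z :: complex ^ 'n. norm z < 1 \<Longrightarrow>
      (\<integral>\<^sup>+w. ennreal (bdist z w powr (- ((real CARD('n) + 1 + (\<alpha> - e)) + e))) \<partial>weighted_measure (\<alpha> - e))
      \<le> ennreal (C * (1 - (norm z)\<^sup>2) powr (- e))"
    using forelli_rudin[OF a assms(2), where 'n='n] by blast
  define r where "r = weight_const TYPE('n) \<alpha> / weight_const TYPE('n) (\<alpha> - e)"
  have r: "r > 0" using weight_const_pos[OF assms(1), where 'n='n] weight_const_pos[OF a, where 'n='n] by (simp add: r_def)
  show ?thesis
  proof (rule that[of "r * C"])
    fix z :: "complex ^ 'n" assume z: "norm z < 1"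
    have "(\<integral>\<^sup>+w. ennreal (bdist z w powr (- N)) * ennreal ((1 - (norm w)\<^sup>2) powr (- e)) \<partial>weighted_measure \<alpha>)
      = ennreal r * (\<integral>\<^sup>+w. ennreal (bdist z w powr (- N)) \<partial>weighted_measure (\<alpha> - e))"
      using nn_integral_weighted_shift[of \<alpha> "- e" "\<lambda>w :: complex ^ 'n. ennreal (bdist z w powr (- N))"] assms
      by (simp add: r_def borel_measurable_weightedI)
    also have "\<dots> \<le> ennreal r * ennreal (C * (1 - (norm z)\<^sup>2) powr (- e))"
      using C(2)[OF z] by (intro mult_left_mono) (simp_all add: N_def algebra_simps)
    finally show "(\<integral>\<^sup>+w. ennreal (bdist z w powr (- N)) * ennreal ((1 - (norm w)\<^sup>2) powr (- e)) \<partial>weighted_measure \<alpha>)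
      \<le> ennreal (r * C * (1 - (norm z)\<^sup>2) powr (- e))"
      using r C(1) by (simp add: mult.assoc flip: ennreal_mult)
  qed (use r C in simp)
qed

section \<open>Weak type estimate and parameter integrals\<close>

text \<open>Schur's test shows that the potential of the kernel restricted to a set \<open>E\<close> has bounded mean
  over \<open>E\<close>; on the half of \<open>E\<close> where it is at most twice that mean, the quasi-triangle inequality
  yields a maximum principle, and duality gives the weak type estimate without any covering
  argument.\<close>

lemma bergman_kernel_weak_type:
  fixes \<alpha> :: real
  assumes \<alpha>: "\<alpha> > -1"
  defines "N \<equiv> real CARD('n::finite) + 1 + \<alpha>"
  obtains C where "C > 0"
    "\<And>(g :: complex ^ 'n \<Rightarrow> ennreal) l. g \<in> borel_measurable (weighted_measure \<alpha>) \<Longrightarrow> l > 0 \<Longrightarrow>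
      ennreal l * emeasure (weighted_measure \<alpha>)
        {z \<in> ball 0 1. ennreal l < (\<integral>\<^sup>+w. g w * ennreal (bdist z w powr (- N)) \<partial>weighted_measure \<alpha>)}
      \<le> ennreal C * (\<integral>\<^sup>+w. g w \<partial>weighted_measure \<alpha>)"
proof -
  define M where "M = (weighted_measure \<alpha> :: (complex ^ 'n) measure)"
  interpret finite_measure M unfolding M_def by (rule finite_measure_weighted[OF \<alpha>])
  interpret P: pair_sigma_finite M M ..
  have [measurable]: "(\<lambda>x. x) \<in> borel_measurable M"
    unfolding M_def by (rule borel_measurable_weighted_ident)
  have space [simp]: "space M = ball 0 1" by (simp add: M_def)
  have N: "N > 0" using \<alpha> by (simp add: N_def add_pos_nonneg)
  \<comment> \<open>The midpoint of the range of exponents allowed by the Schur bound.\<close>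
  define e where "e = (\<alpha> + 1) / 2"
  have e: "0 < e" "e < \<alpha> + 1" using \<alpha> by (simp_all add: e_def)
  define y where "y z = 1 - (norm z)\<^sup>2" for z :: "complex ^ 'n"
  have y: "y z > 0" if "norm z < 1" for z using that norm_lt_1_iff_square[of z] by (simp add: y_def)
  have [measurable]: "y \<in> borel_measurable M" unfolding y_def[abs_def] by measurable
  define K where "K z w = ennreal (bdist z w powr (- N))" for z w :: "complex ^ 'n"
  have [measurable]: "(\<lambda>p. K (fst p) (snd p)) \<in> borel_measurable (M \<Otimes>\<^sub>M M)"
     "(\<lambda>p. K (snd p) (fst p)) \<in> borel_measurable (M \<Otimes>\<^sub>M M)" "\<And>z. K z \<in> borel_measurable M"
    unfolding K_def[abs_def] by measurable
  have K_sym: "K z w = K w z" for z w unfolding K_def by (simp add: bdist_commute)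
  obtain C where C: "C > 0" "\<And>z :: complex ^ 'n. norm z < 1 \<Longrightarrow>
      (\<integral>\<^sup>+w. K z w * ennreal (y w powr (- e)) \<partial>M) \<le> ennreal (C * y z powr (- e))"
    using schur_bound[OF \<alpha> e, where 'n='n] unfolding K_def M_def y_def N_def by blast
  \<comment> \<open>With a = (y z / y w)^e, the inequality 1 \<le> a + 1/a splits the symmetric
    kernel into two halves exchanged by swapping z and w. The Schur bound controls each of them by C
    times the mass of \<open>E\<close>.\<close>
  have energy: "(\<integral>\<^sup>+z\<in>E. (\<integral>\<^sup>+w\<in>E. K z w \<partial>M) \<partial>M) \<le> ennreal (2 * C) * emeasure M E"
    if E [measurable]: "E \<in> sets M" for E
  proof -
    define J where "J z w = K z w * ennreal (y w powr (- e) * y z powr e) * indicator E z * indicator E w" for z w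
    have J [measurable]: "(\<lambda>p. J (fst p) (snd p)) \<in> borel_measurable (M \<Otimes>\<^sub>M M)"
      "(\<lambda>p. J (snd p) (fst p)) \<in> borel_measurable (M \<Otimes>\<^sub>M M)"
      unfolding J_def[abs_def] by measurable
    have J1: "J z \<in> borel_measurable M" "(\<lambda>w. J w z) \<in> borel_measurable M" for z
      unfolding J_def[abs_def] K_sym[of _ z] by measurable
    have "(\<integral>\<^sup>+z\<in>E. (\<integral>\<^sup>+w\<in>E. K z w \<partial>M) \<partial>M) = (\<integral>\<^sup>+z. (\<integral>\<^sup>+w. K z w * indicator E w * indicator E z \<partial>M) \<partial>M)"
      by (intro nn_integral_cong nn_integral_multc[symmetric]) measurable
    also have "\<dots> \<le> (\<integral>\<^sup>+z. (\<integral>\<^sup>+w. J z w + J w z \<partial>M) \<partial>M)"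
    proof (intro nn_integral_mono)
      fix z w assume "z \<in> space M" "w \<in> space M"
      then have p: "y z > 0" "y w > 0" by (auto intro!: y)
      define a where "a = y w powr (- e) * y z powr e"
      have a: "a > 0" "y z powr (- e) * y w powr e = 1 / a"
        using p by (simp_all add: a_def powr_minus field_simps)
      have "1 \<le> a + 1 / a"
        using a(1) by (cases "a \<ge> 1") (auto simp: field_simps add_increasing add_increasing2)
      then have "1 \<le> ennreal a + ennreal (1 / a)" using a(1) by (simp flip: ennreal_plus)
      then have "K z w * 1 \<le> K z w * (ennreal a + ennreal (1 / a))" by (intro mult_left_mono) auto
      then show "K z w * indicator E w * indicator E z \<le> J z w + J w z"
        unfolding J_def a(2) K_sym[of w z] a_def[symmetric] by (auto simp: indicator_def distrib_left)
    qed
    also have "\<dots> = (\<integral>\<^sup>+z. (\<integral>\<^sup>+w. J z w \<partial>M) \<partial>M) + (\<integral>\<^sup>+z. (\<integral>\<^sup>+w. J w z \<partial>M) \<partial>M)"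
      using J by (simp add: J1 nn_integral_add borel_measurable_nn_integral case_prod_beta')
    also have "(\<integral>\<^sup>+z. (\<integral>\<^sup>+w. J w z \<partial>M) \<partial>M) = (\<integral>\<^sup>+z. (\<integral>\<^sup>+w. J z w \<partial>M) \<partial>M)"
      by (rule P.Fubini') (simp add: case_prod_beta')
    also have "(\<integral>\<^sup>+z. (\<integral>\<^sup>+w. J z w \<partial>M) \<partial>M) \<le> (\<integral>\<^sup>+z. ennreal C * indicator E z \<partial>M)"
    proof (rule nn_integral_mono)
      fix z assume "z \<in> space M"
      then have z: "norm z < 1" by simp
      have "(\<integral>\<^sup>+w. J z w \<partial>M) \<le> (\<integral>\<^sup>+w. (K z w * ennreal (y w powr (- e))) * (ennreal (y z powr e) * indicator E z) \<partial>M)"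
        by (intro nn_integral_mono) (auto simp: J_def indicator_def ennreal_mult mult_ac)
      also have "\<dots> = (\<integral>\<^sup>+w. K z w * ennreal (y w powr (- e)) \<partial>M) * (ennreal (y z powr e) * indicator E z)"
        by (intro nn_integral_multc) measurable
      also have "\<dots> \<le> ennreal (C * y z powr (- e)) * (ennreal (y z powr e) * indicator E z)"
        using C(2)[OF z] by (intro mult_right_mono) auto
      also have "\<dots> = ennreal C * indicator E z"
      proof -
        have "C * y z powr (- e) * y z powr e = C"
          using y[OF z] by (simp add: mult.assoc flip: powr_add)
        moreover have "ennreal (C * y z powr (- e)) * (ennreal (y z powr e) * indicator E z)
            = ennreal (C * y z powr (- e) * y z powr e) * indicator E z"
          using C(1) by (simp only: mult.assoc[symmetric] ennreal_mult[symmetric] mult_nonneg_nonneg less_imp_le powr_ge_zero)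
        ultimately show ?thesis by (simp only:)
      qed
      finally show "(\<integral>\<^sup>+w. J z w \<partial>M) \<le> ennreal C * indicator E z" .
    qed
    also have "(\<integral>\<^sup>+z. ennreal C * indicator E z \<partial>M) = ennreal C * emeasure M E"
      by (rule nn_integral_cmult_indicator[OF E])
    finally have "(\<integral>\<^sup>+z\<in>E. (\<integral>\<^sup>+w\<in>E. K z w \<partial>M) \<partial>M) \<le> ennreal C * emeasure M E + ennreal C * emeasure M E"
      by (simp add: add_mono)
    also have "\<dots> = (ennreal C + ennreal C) * emeasure M E" by (simp only: distrib_right)
    also have "ennreal C + ennreal C = ennreal (2 * C)"
      using C(1) by (subst ennreal_plus[symmetric]) simp_all
    finally show ?thesis .
  qed
  \<comment> \<open>12^N comes from comparing kernels at two points of \<open>E'\<close>, 4 C from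
    the level at which \<open>q\<close> is cut.\<close>
  define D where "D = 12 powr N * (4 * C)"
  have D: "D > 0" using C(1) by (simp add: D_def)
  show ?thesis
  proof (rule that[of "2 * D"])
    fix g :: "complex ^ 'n \<Rightarrow> ennreal" and l :: real
    assume g: "g \<in> borel_measurable (weighted_measure \<alpha>)" and l: "l > 0"
    have [measurable]: "g \<in> borel_measurable M" using g by (simp add: M_def)
    define u where "u z = (\<integral>\<^sup>+w. g w * K z w \<partial>M)" for z
    have [measurable]: "u \<in> borel_measurable M" unfolding u_def[abs_def] by measurable
    define E where "E = {z \<in> space M. ennreal l < u z}"
    have E [measurable]: "E \<in> sets M" unfolding E_def by measurable
    define q where "q z = (\<integral>\<^sup>+w\<in>E. K z w \<partial>M)" for z
    have [measurable]: "q \<in> borel_measurable M" unfolding q_def[abs_def] by measurable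
    \<comment> \<open>The level is twice the bound 2 C for the mean of \<open>q\<close> over
      \<open>E\<close>, so by Chebyshev's inequality at most half of \<open>E\<close> is
      discarded.\<close>
    define E' where "E' = {z \<in> E. q z \<le> ennreal (4 * C)}"
    have E'_eq: "E' = {z \<in> space M. z \<in> E \<and> q z \<le> ennreal (4 * C)}" unfolding E'_def E_def by auto
    have E' [measurable]: "E' \<in> sets M" unfolding E'_eq by measurable
    have E'sub: "E' \<subseteq> E" "\<And>z. z \<in> E' \<Longrightarrow> norm z < 1" by (auto simp: E'_def E_def)
    have half: "measure M E \<le> 2 * measure M E'"
    proof -
      have "ennreal (4 * C) * emeasure M (E - E') = (\<integral>\<^sup>+z. ennreal (4 * C) * indicator (E - E') z \<partial>M)"
        by (subst nn_integral_cmult_indicator) auto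
      also have "\<dots> \<le> (\<integral>\<^sup>+z\<in>E. q z \<partial>M)"
        by (intro nn_integral_mono) (auto simp: indicator_def E'_def)
      also have "\<dots> \<le> ennreal (2 * C) * emeasure M E"
        unfolding q_def by (rule energy[OF E])
      finally have "ennreal (4 * C * measure M (E - E')) \<le> ennreal (2 * C * measure M E)"
        using C(1) by (simp add: emeasure_eq_measure ennreal_mult)
      then have "4 * C * measure M (E - E') \<le> 2 * C * measure M E"
        using C(1) by (simp add: ennreal_le_iff)
      then have "2 * measure M (E - E') \<le> measure M E" using C(1) by simp
      moreover have "measure M (E - E') = measure M E - measure M E'"
        using E'sub by (intro finite_measure_Diff) auto
      ultimately show ?thesis by simp
    qed
    have max_principle: "(\<integral>\<^sup>+z\<in>E'. K z x \<partial>M) \<le> ennreal D" if x: "norm x < 1" for x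
    proof (cases "E' = {}")
      case False
      define I where "I = Inf (bdist x ` E')"
      \<comment> \<open>Positivity of the infimum provides a point \<open>z0\<close> of
        \<open>E'\<close> within twice the infimum; a nearest point need not exist.\<close>
      have "1 - norm x \<le> I"
        unfolding I_def using False bdist_ge(1)[OF x E'sub(2)] by (intro cInf_greatest) auto
      then have "I < 2 * I" using x by simp
      then obtain b where "b \<in> bdist x ` E'" "b < 2 * I"
        unfolding I_def using False by (meson cInf_lessD image_is_empty)
      then obtain z0 where z0: "z0 \<in> E'" "bdist x z0 < 2 * I" by blast
      have I_le: "I \<le> bdist x w" if "w \<in> E'" for w
        unfolding I_def using that by (intro cInf_lower bdd_belowI[of _ 0]) (auto simp: bdist_def)
      have "K w x \<le> ennreal (12 powr N) * K z0 w" if w: "w \<in> E'" for w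
      proof -
        have "bdist z0 w \<le> 4 * (bdist z0 x + bdist x w)"
          by (rule bdist_triangle) (use x z0(1) w E'sub(2) in auto)
        \<comment> \<open>The quasi-triangle constant 4 times 2 + 1, since \<open>bdist x z0\<close>
          is at most twice \<open>bdist x w\<close>. Thus the kernel at \<open>x\<close> is
          dominated by the kernel at \<open>z0\<close>, whose potential over \<open>E\<close> is at
          most 4 C.\<close>
        then have "bdist z0 w \<le> 12 * bdist x w"
          using z0(2) I_le[OF w] by (simp add: bdist_commute[of z0 x])
        moreover have pos: "bdist z0 w > 0" "bdist x w > 0" using bdist_pos z0(1) w E'sub(2) x by auto
        ultimately have "bdist x w powr (- N) \<le> (bdist z0 w / 12) powr (- N)"
          using N by (intro powr_mono2') auto
        also have "\<dots> = 12 powr N * bdist z0 w powr (- N)"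
          using pos by (simp add: powr_divide powr_minus field_simps)
        finally show ?thesis by (simp add: K_def bdist_commute[of w x] flip: ennreal_mult)
      qed
      then have "(\<integral>\<^sup>+z\<in>E'. K z x \<partial>M) \<le> (\<integral>\<^sup>+w. ennreal (12 powr N) * (K z0 w * indicator E w) \<partial>M)"
        using E'sub(1) by (intro nn_integral_mono) (auto simp: indicator_def)
      also have "\<dots> = ennreal (12 powr N) * q z0"
        unfolding q_def by (rule nn_integral_cmult) measurable
      also have "\<dots> \<le> ennreal (12 powr N) * ennreal (4 * C)"
        using z0(1) by (intro mult_left_mono) (auto simp: E'_def)
      finally show ?thesis using C(1) by (simp add: D_def flip: ennreal_mult)
    qed simp
    \<comment> \<open>Duality: \<open>u\<close> exceeds \<open>l\<close> on \<open>E'\<close>, and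
      Fubini turns the integral of \<open>u\<close> over \<open>E'\<close> into an integral of
      \<open>g\<close> against the potential of \<open>E'\<close>, bounded by \<open>D\<close> at
      every point of the ball.\<close>
    have "ennreal l * emeasure M E' = (\<integral>\<^sup>+z. ennreal l * indicator E' z \<partial>M)"
      by (rule nn_integral_cmult_indicator[symmetric, OF E'])
    also have "\<dots> \<le> (\<integral>\<^sup>+z. (\<integral>\<^sup>+w. g w * K z w * indicator E' z \<partial>M) \<partial>M)"
    proof (rule nn_integral_mono)
      fix z assume "z \<in> space M"
      have "(\<integral>\<^sup>+w. g w * K z w * indicator E' z \<partial>M) = u z * indicator E' z"
        unfolding u_def by (rule nn_integral_multc) measurable
      then show "ennreal l * indicator E' z \<le> (\<integral>\<^sup>+w. g w * K z w * indicator E' z \<partial>M)"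
        using E'sub(1) by (auto simp: indicator_def E_def)
    qed
    also have "\<dots> = (\<integral>\<^sup>+w. (\<integral>\<^sup>+z. g w * K z w * indicator E' z \<partial>M) \<partial>M)"
      by (rule P.Fubini'[symmetric]) (simp add: case_prod_beta')
    also have "\<dots> \<le> (\<integral>\<^sup>+w. ennreal D * g w \<partial>M)"
    proof (rule nn_integral_mono)
      fix w assume "w \<in> space M"
      have "(\<integral>\<^sup>+z. g w * K z w * indicator E' z \<partial>M) = g w * (\<integral>\<^sup>+z\<in>E'. K z w \<partial>M)"
        unfolding mult.assoc K_sym[of _ w] by (rule nn_integral_cmult) measurable
      also have "\<dots> \<le> g w * ennreal D"
        using max_principle[of w] \<open>w \<in> space M\<close> by (intro mult_left_mono) auto
      finally show "(\<integral>\<^sup>+z. g w * K z w * indicator E' z \<partial>M) \<le> ennreal D * g w" by (simp add: mult.commute)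
    qed
    also have "\<dots> = ennreal D * (\<integral>\<^sup>+w. g w \<partial>M)" by (rule nn_integral_cmult) measurable
    finally have "2 * (ennreal l * emeasure M E') \<le> 2 * (ennreal D * (\<integral>\<^sup>+w. g w \<partial>M))"
      by (rule mult_left_mono) simp
    moreover have "ennreal l * emeasure M E \<le> 2 * (ennreal l * emeasure M E')"
    proof -
      have "ennreal (l * measure M E) \<le> ennreal (2 * (l * measure M E'))"
        using half l mult_left_mono[of "measure M E" "2 * measure M E'" l] by (intro ennreal_leI) simp
      then show ?thesis using l by (simp add: emeasure_eq_measure ennreal_mult)
    qed
    ultimately have "ennreal l * emeasure M E \<le> ennreal (2 * D) * (\<integral>\<^sup>+w. g w \<partial>M)"
      using D by (simp add: ennreal_mult mult.assoc)
    moreover have "E = {z \<in> ball 0 1. ennreal l < (\<integral>\<^sup>+w. g w * ennreal (bdist z w powr (- N)) \<partial>weighted_measure \<alpha>)}"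
      by (simp add: E_def u_def K_def M_def)
    ultimately show "ennreal l * emeasure (weighted_measure \<alpha>)
        {z \<in> ball 0 1. ennreal l < (\<integral>\<^sup>+w. g w * ennreal (bdist z w powr (- N)) \<partial>weighted_measure \<alpha>)}
      \<le> ennreal (2 * D) * (\<integral>\<^sup>+w. g w \<partial>weighted_measure \<alpha>)"
      by (simp add: M_def)
  qed (use D in simp)
qed

section \<open>Holomorphic parameter integrals and their radial derivatives\<close>

lemma integrable_weighted_mult:
  fixes g :: "complex ^ 'n \<Rightarrow> complex"
  assumes g: "integrable (weighted_measure \<alpha>) g" and k: "continuous_on (ball 0 1) k"
    and B: "\<And>w. norm w < 1 \<Longrightarrow> cmod (k w) \<le> B"
  shows "integrable (weighted_measure \<alpha>) (\<lambda>w. g w * k w)"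
proof (rule Bochner_Integration.integrable_bound)
  show "integrable (weighted_measure \<alpha>) (\<lambda>w. B * cmod (g w))"
    using g by (intro integrable_mult_right integrable_norm)
  show "AE w in weighted_measure \<alpha>. norm (g w * k w) \<le> norm (B * cmod (g w))"
  proof (rule AE_I2)
    fix w assume "w \<in> space (weighted_measure \<alpha> :: (complex ^ 'n) measure)"
    then have "cmod (k w) \<le> B" using B by simp
    moreover then have "0 \<le> B" using norm_ge_zero order_trans by blast
    ultimately show "norm (g w * k w) \<le> norm (B * cmod (g w))"
      using mult_right_mono[of "cmod (k w)" B "cmod (g w)"]
      by (simp add: norm_mult abs_mult mult.commute)
  qed
  show "(\<lambda>w. g w * k w) \<in> borel_measurable (weighted_measure \<alpha>)"
    by (intro borel_measurable_times borel_measurable_integrable[OF g] borel_measurable_weighted_continuous[OF k])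
qed

lemma continuous_on_inner_compose:
  fixes z :: "complex ^ 'n"
  assumes "G holomorphic_on ball 0 1" "norm z < 1"
  shows "continuous_on (ball 0 1) (\<lambda>w. G (hermitian_inner z w))"
  by (rule continuous_on_compose2[OF holomorphic_on_imp_continuous_on[OF assms(1)]])
    (auto intro!: continuous_intros hermitian_inner_less_one(2) assms(2))

text \<open>For fixed \<open>z\<close> all values <z,w> lie in the compact disc of radius |z| < 1,
  so \<open>G\<close> itself may blow up at the boundary.\<close>

lemma inner_compose_bounded:
  fixes z :: "complex ^ 'n"
  assumes "G holomorphic_on ball 0 1" "norm z < 1"
  obtains B where "B \<ge> 0" "\<And>w. norm w < 1 \<Longrightarrow> cmod (G (hermitian_inner z w)) \<le> B"
proof -
  have "compact (G ` cball 0 (norm z))"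
    using assms by (intro compact_continuous_image continuous_on_subset[OF holomorphic_on_imp_continuous_on[OF assms(1)]]) auto
  then have "bounded (G ` cball 0 (norm z))" by (rule compact_imp_bounded)
  then obtain B where "B > 0" "\<And>x. x \<in> cball 0 (norm z) \<Longrightarrow> cmod (G x) \<le> B"
    unfolding bounded_pos by blast
  then show ?thesis
    using hermitian_inner_less_one(1)[OF assms(2)] by (intro that[of B]) auto
qed

lemma integrable_weighted_inner:
  fixes g :: "complex ^ 'n \<Rightarrow> complex"
  assumes "integrable (weighted_measure \<alpha>) g" "G holomorphic_on ball 0 1" "norm z < 1"
  shows "integrable (weighted_measure \<alpha>) (\<lambda>w. g w * G (hermitian_inner z w))"
proof -
  obtain B where "\<And>w. norm w < 1 \<Longrightarrow> cmod (G (hermitian_inner z w)) \<le> B"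
    using inner_compose_bounded[OF assms(2,3)] by blast
  then show ?thesis
    by (intro integrable_weighted_mult[where B=B] assms(1) continuous_on_inner_compose[OF assms(2,3)])
qed

text \<open>A quadratic Taylor remainder, uniform in \<open>w\<close>: since |w| < 1, the second
  derivative of \<open>G\<close> is evaluated only on one compact disc. Integration against |g| then
  gives an error of order |x - z|^2 at once.\<close>

lemma param_integral_has_derivative:
  fixes g :: "complex ^ 'n \<Rightarrow> complex"
  assumes g: "integrable (weighted_measure \<alpha>) g" and G: "G holomorphic_on ball 0 1" and z: "norm z < 1"
  shows "((\<lambda>z. LINT w|weighted_measure \<alpha>. g w * G (hermitian_inner z w)) has_derivative
    (\<lambda>v. LINT w|weighted_measure \<alpha>. g w * (deriv G (hermitian_inner z w) * hermitian_inner v w))) (at z)"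
proof -
  have dG: "deriv G holomorphic_on ball 0 1" "deriv (deriv G) holomorphic_on ball 0 1"
    using G by (intro holomorphic_deriv; simp)+
  obtain B1 where B1: "B1 \<ge> 0" "\<And>w. norm w < 1 \<Longrightarrow> cmod (deriv G (hermitian_inner z w)) \<le> B1"
    using inner_compose_bounded[OF dG(1) z] by blast
  have int: "integrable (weighted_measure \<alpha>) (\<lambda>w. g w * (deriv G (hermitian_inner z w) * hermitian_inner v w))" for v
  proof (rule integrable_weighted_mult[OF g, where B="B1 * norm v"])
    show "continuous_on (ball 0 1) (\<lambda>w. deriv G (hermitian_inner z w) * hermitian_inner v w)"
      by (intro continuous_intros continuous_on_inner_compose dG z)
    show "cmod (deriv G (hermitian_inner z w) * hermitian_inner v w) \<le> B1 * norm v" if "norm w < 1" for w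
      unfolding norm_mult using B1 that cmod_hermitian_inner_le[of v w] mult_left_mono[of "norm w" 1 "norm v"]
      by (intro mult_mono) auto
  qed
  define D where "D v = (LINT w|weighted_measure \<alpha>. g w * (deriv G (hermitian_inner z w) * hermitian_inner v w))" for v
  have "linear D"
  proof (rule linearI)
    fix x v :: "complex ^ 'n" and r :: real
    show "D (x + v) = D x + D v"
      unfolding D_def by (subst Bochner_Integration.integral_add[OF int int, symmetric])
        (simp add: hermitian_inner_add_left algebra_simps)
    have "D (r *\<^sub>R x) = (LINT w|weighted_measure \<alpha>. of_real r * (g w * (deriv G (hermitian_inner z w) * hermitian_inner x w)))"
      unfolding D_def by (simp only: of_real_vec_scale[symmetric] hermitian_inner_scale_left mult_ac)
    also have "\<dots> = of_real r * D x" unfolding D_def by (rule integral_mult_right_zero)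
    finally show "D (r *\<^sub>R x) = r *\<^sub>R D x" by (simp add: scaleR_conv_of_real)
  qed
  \<comment> \<open>A radius strictly between |z| and 1; for \<open>x\<close> near \<open>z\<close>
    and every \<open>w\<close> in the ball the inner products stay in
    \<open>cball 0 r\<close>.\<close>
  define r where "r = (1 + norm z) / 2"
  have r: "norm z < r" "r < 1" using z by (simp_all add: r_def)
  have "compact (deriv (deriv G) ` cball 0 r)"
    using r by (intro compact_continuous_image continuous_on_subset[OF holomorphic_on_imp_continuous_on[OF dG(2)]]) auto
  then have "bounded (deriv (deriv G) ` cball 0 r)" by (rule compact_imp_bounded)
  then obtain B where B: "B > 0" "\<And>x. x \<in> cball 0 r \<Longrightarrow> cmod (deriv (deriv G) x) \<le> B"
    unfolding bounded_pos by blast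
  have taylor: "cmod (G y - G x - deriv G x * (y - x)) \<le> B * (cmod (y - x))\<^sup>2"
    if "x \<in> cball 0 r" "y \<in> cball 0 r" for x y
  proof -
    have "cmod (G y - (\<Sum>i\<le>1. (deriv ^^ i) G x * (y - x) ^ i / fact i)) \<le> B * cmod (y - x) ^ Suc 1 / fact 1"
    proof (rule complex_Taylor[where S="cball 0 r" and f="\<lambda>i. (deriv ^^ i) G", simplified funpow_0])
      fix i u assume u: "u \<in> cball (0::complex) r" "i \<le> (1::nat)"
      have "(deriv ^^ i) G holomorphic_on ball 0 1" using G by (intro holomorphic_higher_deriv) auto
      then have "((deriv ^^ i) G has_field_derivative deriv ((deriv ^^ i) G) u) (at u)"
        using u r by (intro holomorphic_derivI[where S="ball 0 1"]) auto
      then show "((deriv ^^ i) G has_field_derivative (deriv ^^ Suc i) G u) (at u within cball 0 r)"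
        by (simp add: has_field_derivative_at_within)
    next
      fix u assume "u \<in> cball (0::complex) r"
      then show "cmod ((deriv ^^ Suc 1) G u) \<le> B" using B(2)[of u] by simp
    qed (use that in auto)
    then show ?thesis by (simp add: power2_eq_square algebra_simps)
  qed
  define A where "A = (LINT w|weighted_measure \<alpha>. cmod (g w))"
  have "A \<ge> 0" unfolding A_def by (intro Bochner_Integration.integral_nonneg) auto
  have close: "cmod ((LINT w|weighted_measure \<alpha>. g w * G (hermitian_inner x w))
      - (LINT w|weighted_measure \<alpha>. g w * G (hermitian_inner z w)) - D (x - z)) \<le> B * A * (norm (x - z))\<^sup>2"
    if x: "norm (x - z) < r - norm z" for x
  proof -
    have "norm x \<le> norm z + norm (x - z)" using norm_triangle_ineq[of z "x - z"] by simp
    then have nx: "norm x < r" "norm x < 1" using x r by simp_all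
    have bnd: "cmod (g w * (G (hermitian_inner x w) - G (hermitian_inner z w) - deriv G (hermitian_inner z w) * hermitian_inner (x - z) w))
        \<le> cmod (g w) * (B * (norm (x - z))\<^sup>2)" if w: "norm w < 1" for w
    proof -
      have "cmod (G (hermitian_inner x w) - G (hermitian_inner z w) - deriv G (hermitian_inner z w) * (hermitian_inner x w - hermitian_inner z w))
        \<le> B * (cmod (hermitian_inner x w - hermitian_inner z w))\<^sup>2"
        using hermitian_inner_less_one(1)[OF z w] hermitian_inner_less_one(1)[OF nx(2) w] nx r
        by (intro taylor) auto
      also have "\<dots> \<le> B * (norm (x - z))\<^sup>2"
      proof -
        have "cmod (hermitian_inner x w - hermitian_inner z w) \<le> norm (x - z)"
          using cmod_hermitian_inner_le[of "x - z" w] mult_left_mono[of "norm w" 1 "norm (x - z)"] w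
          by (simp add: hermitian_inner_diff_left)
        then show ?thesis using B(1) by (intro mult_left_mono power_mono) auto
      qed
      finally show ?thesis
        unfolding norm_mult by (intro mult_left_mono) (simp_all add: hermitian_inner_diff_left)
    qed
    have i1: "integrable (weighted_measure \<alpha>) (\<lambda>w. g w * G (hermitian_inner x w))"
      "integrable (weighted_measure \<alpha>) (\<lambda>w. g w * G (hermitian_inner z w))"
      using g G nx z by (auto intro: integrable_weighted_inner)
    have eq: "(LINT w|weighted_measure \<alpha>. g w * G (hermitian_inner x w))
      - (LINT w|weighted_measure \<alpha>. g w * G (hermitian_inner z w)) - D (x - z)
      = (LINT w|weighted_measure \<alpha>. g w * (G (hermitian_inner x w) - G (hermitian_inner z w) - deriv G (hermitian_inner z w) * hermitian_inner (x - z) w))"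
      (is "_ = ?R")
    proof -
      have "(LINT w|weighted_measure \<alpha>. g w * G (hermitian_inner x w))
      - (LINT w|weighted_measure \<alpha>. g w * G (hermitian_inner z w)) - D (x - z)
      = (LINT w|weighted_measure \<alpha>. g w * G (hermitian_inner x w) - g w * G (hermitian_inner z w)
           - g w * (deriv G (hermitian_inner z w) * hermitian_inner (x - z) w))"
      unfolding D_def by (simp only: Bochner_Integration.integral_diff i1 int Bochner_Integration.integrable_diff)
      also have "\<dots> = ?R" by (simp add: algebra_simps)
      finally show ?thesis .
    qed
    have "cmod ?R \<le> (LINT w|weighted_measure \<alpha>. cmod (g w * (G (hermitian_inner x w) - G (hermitian_inner z w) - deriv G (hermitian_inner z w) * hermitian_inner (x - z) w)))"
      by (rule integral_norm_bound)
    also have "\<dots> \<le> (LINT w|weighted_measure \<alpha>. cmod (g w) * (B * (norm (x - z))\<^sup>2))"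
      using bnd g B(1) by (intro integral_mono' integrable_mult_left integrable_norm) auto
    also have "\<dots> = B * A * (norm (x - z))\<^sup>2" by (simp add: A_def)
    finally show ?thesis unfolding eq .
  qed
  show ?thesis
    unfolding has_derivative_at_alt D_def[symmetric]
  proof (intro conjI allI impI)
    show "bounded_linear D" using \<open>linear D\<close> by (simp add: linear_conv_bounded_linear)
    fix e :: real assume e: "0 < e"
    show "\<exists>d>0. \<forall>x. norm (x - z) < d \<longrightarrow> cmod ((LINT w|weighted_measure \<alpha>. g w * G (hermitian_inner x w))
      - (LINT w|weighted_measure \<alpha>. g w * G (hermitian_inner z w)) - D (x - z)) \<le> e * norm (x - z)"
    proof (intro exI[of _ "min (r - norm z) (e / (B * A + 1))"] conjI allI impI)
      have BA: "B * A \<ge> 0" using B \<open>A \<ge> 0\<close> by simp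
      then show "0 < min (r - norm z) (e / (B * A + 1))" using e r by simp
      fix x assume x: "norm (x - z) < min (r - norm z) (e / (B * A + 1))"
      then have "norm (x - z) \<le> e / (B * A + 1)" by simp
      then have "(B * A + 1) * norm (x - z) \<le> e" using BA by (simp add: field_simps)
      then have "B * A * norm (x - z) + norm (x - z) \<le> e" by (simp add: distrib_right)
      then have "B * A * norm (x - z) \<le> e" using norm_ge_zero[of "x - z"] by linarith
      then have "B * A * norm (x - z) * norm (x - z) \<le> e * norm (x - z)" by (rule mult_right_mono) simp
      then show "cmod ((LINT w|weighted_measure \<alpha>. g w * G (hermitian_inner x w))
      - (LINT w|weighted_measure \<alpha>. g w * G (hermitian_inner z w)) - D (x - z)) \<le> e * norm (x - z)"
        using close[of x] x by (simp add: power2_eq_square mult.assoc)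
    qed
  qed
qed

lemma holomorphic_ball_param_integral:
  fixes g :: "complex ^ 'n \<Rightarrow> complex"
  assumes "integrable (weighted_measure \<alpha>) g" "G holomorphic_on ball 0 1"
  shows "holomorphic_ball (\<lambda>z. LINT w|weighted_measure \<alpha>. g w * G (hermitian_inner z w))"
  unfolding holomorphic_ball_def
proof
  fix z assume "z \<in> ball (0 :: complex ^ 'n) 1"
  then have z: "norm z < 1" by simp
  have "(LINT w|weighted_measure \<alpha>. g w * (deriv G (hermitian_inner z w) * hermitian_inner (c *s v) w))
     = c * (LINT w|weighted_measure \<alpha>. g w * (deriv G (hermitian_inner z w) * hermitian_inner v w))" for c v
    by (subst integral_mult_right_zero[symmetric]) (simp add: hermitian_inner_scale_left mult_ac)
  then show "\<exists>D. ((\<lambda>z. LINT w|weighted_measure \<alpha>. g w * G (hermitian_inner z w)) has_derivative D) (at z)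
      \<and> (\<forall>c v. D (c *s v) = c * D v)"
    using param_integral_has_derivative[OF assms z] by blast
qed

text \<open>The sum over coordinate derivatives collapses to the total derivative in the direction
  \<open>z\<close>, the form in which parameter integrals can be differentiated.\<close>

lemma radial_deriv_eq:
  assumes D: "(f has_derivative D) (at z)" and lin: "\<And>c v. D (c *s v) = c * D v"
  shows "radial_deriv f z = D z"
proof -
  have axis: "axis j h = h *s axis j (1 :: complex)" for j h
    by (simp add: vec_eq_iff axis_def)
  have "deriv (\<lambda>h. f (z + axis j h)) 0 = D (axis j 1)" for j
  proof (rule DERIV_imp_deriv)
    have "bounded_linear (\<lambda>h. h *s axis j (1 :: complex))"
      by (rule linear_conv_bounded_linear[THEN iffD1], rule linearI) (simp_all add: vec_eq_iff algebra_simps)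
    then have "((\<lambda>h. z + h *s axis j 1) has_derivative (\<lambda>h. 0 + h *s axis j 1)) (at 0)"
      by (intro has_derivative_add has_derivative_const bounded_linear_imp_has_derivative)
    then have d: "((\<lambda>h. f (z + h *s axis j 1)) has_derivative (\<lambda>h. D (0 + h *s axis j 1))) (at 0)"
      by (rule has_derivative_compose[where f="\<lambda>h. z + h *s axis j 1" and g=f]) (use D in simp)
    have "(\<lambda>h. f (z + axis j h)) = (\<lambda>h. f (z + h *s axis j 1))"
      by (rule ext, subst axis, rule refl)
    moreover have "(\<lambda>h. D (0 + h *s axis j 1)) = (*) (D (axis j 1))"
      by (simp add: lin mult.commute fun_eq_iff)
    ultimately show "((\<lambda>h. f (z + axis j h)) has_field_derivative D (axis j 1)) (at 0)"
      using d by (simp only: has_field_derivative_def)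
  qed
  then have "radial_deriv f z = (\<Sum>j\<in>UNIV. D (z $ j *s axis j 1))"
    by (simp add: radial_deriv_def lin)
  also have "\<dots> = D (\<Sum>j\<in>UNIV. z $ j *s axis j 1)"
    using has_derivative_bounded_linear[OF D] by (simp add: linear_sum bounded_linear.linear)
  finally show ?thesis by (simp only: basis_expansion)
qed

lemma radial_deriv_param_integral:
  fixes g :: "complex ^ 'n \<Rightarrow> complex"
  assumes "integrable (weighted_measure \<alpha>) g" "G holomorphic_on ball 0 1" "norm z < 1"
  shows "radial_deriv (\<lambda>z. LINT w|weighted_measure \<alpha>. g w * G (hermitian_inner z w)) z
    = (LINT w|weighted_measure \<alpha>. g w * (hermitian_inner z w * deriv G (hermitian_inner z w)))"
proof -
  have "(LINT w|weighted_measure \<alpha>. g w * (deriv G (hermitian_inner z w) * hermitian_inner (c *s v) w))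
     = c * (LINT w|weighted_measure \<alpha>. g w * (deriv G (hermitian_inner z w) * hermitian_inner v w))" for c v
    by (subst integral_mult_right_zero[symmetric]) (simp add: hermitian_inner_scale_left mult_ac)
  from radial_deriv_eq[OF param_integral_has_derivative[OF assms] this] show ?thesis
    by (simp add: mult.commute)
qed

text \<open>The ball is open, so the derivative sees only values inside it. This is what permits
  iteration, as integral formulas for the iterates hold on the ball only.\<close>

lemma radial_deriv_cong:
  fixes f g :: "complex ^ 'n \<Rightarrow> complex"
  assumes "\<And>x. norm x < 1 \<Longrightarrow> f x = g x" "norm z < 1"
  shows "radial_deriv f z = radial_deriv g z"
  unfolding radial_deriv_def
proof (intro sum.cong refl arg_cong2[where f="(*)"] deriv_cong_ev)
  fix j :: 'n
  have "((\<lambda>x. if i = j then x else 0) \<longlongrightarrow> (0 :: complex)) (nhds 0)" for i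
    by (cases "i = j") (simp_all add: filterlim_ident)
  then have "((\<lambda>h. z + axis j h) \<longlongrightarrow> z + axis j 0) (nhds 0)"
    by (intro tendsto_intros) (auto simp: axis_def intro!: tendsto_vec_lambda)
  moreover have "axis j (0 :: complex) = 0" by (simp add: vec_eq_iff axis_def)
  ultimately have "((\<lambda>h. z + axis j h) \<longlongrightarrow> z) (nhds 0)" by simp
  then have "\<forall>\<^sub>F h in nhds 0. z + axis j h \<in> ball 0 1"
    using assms(2) by (intro topological_tendstoD) auto
  then show "\<forall>\<^sub>F h in nhds 0. f (z + axis j h) = g (z + axis j h)"
    by eventually_elim (simp add: assms(1))
qed

section \<open>Growth functions\<close>

locale growth =
  fixes \<Phi> :: "real \<Rightarrow> real" and p :: real
  assumes growth_class: "\<Phi> \<in> growth_class p" and p: "0 < p"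
begin

lemma phi_cont: "continuous_on {0..} \<Phi>"
  and phi_mono: "0 \<le> s \<Longrightarrow> s \<le> t \<Longrightarrow> \<Phi> s \<le> \<Phi> t"
  and phi_range: "\<Phi> ` {0..} = {0..}"
  and phi_quotient: "0 < s \<Longrightarrow> s \<le> t \<Longrightarrow> \<Phi> t / t \<le> \<Phi> s / s"
  using growth_class unfolding growth_class_def growth_function_def monotone_on_def by auto

lemma phi_nonneg: "0 \<le> t \<Longrightarrow> 0 \<le> \<Phi> t"
  using phi_range by force

lemma phi_zero [simp]: "\<Phi> 0 = 0"
proof -
  obtain t where "t \<ge> 0" "\<Phi> t = 0" using phi_range by (metis atLeast_iff imageE order_refl)
  then show ?thesis using phi_mono[of 0 t] phi_nonneg[of 0] by simp
qed

text \<open>A zero at t > 0 would, by the monotone quotient, force \<Phi> to vanish at all larger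
  arguments, against surjectivity.\<close>

lemma phi_pos:
  assumes "0 < t"
  shows "0 < \<Phi> t"
proof (rule ccontr)
  assume "\<not> 0 < \<Phi> t"
  then have t: "\<Phi> t = 0" using phi_nonneg[of t] assms by simp
  obtain s where s: "s \<ge> 0" "\<Phi> s = 1" using phi_range by (metis atLeast_iff imageE zero_le_one)
  have "t \<le> s" using phi_mono[of s t] s t by (cases "s \<le> t") auto
  then show False using phi_quotient[of t s] s t assms by simp
qed

lemma phi_derivative:
  "\<exists>c \<Phi>'. 0 < c \<and> continuous_on {0<..} \<Phi>' \<and> (\<forall>t>0. (\<Phi> has_real_derivative \<Phi>' t) (at t)
    \<and> c * (\<Phi> t / t) \<le> \<Phi>' t \<and> \<Phi>' t \<le> inverse c * (\<Phi> t / t))"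
proof -
  obtain \<Phi>' c where "\<forall>t>0. (\<Phi> has_real_derivative \<Phi>' t) (at t)" "continuous_on {0<..} \<Phi>'" "c > 0"
    "\<forall>t>0. c * (\<Phi> t / t) \<le> \<Phi>' t \<and> \<Phi>' t \<le> inverse c * (\<Phi> t / t)"
    using growth_class unfolding growth_class_def by auto
  then show ?thesis by (intro exI[of _ c] exI[of _ \<Phi>']) simp
qed

lemma phi_strict_mono:
  assumes "0 \<le> s" "s < t"
  shows "\<Phi> s < \<Phi> t"
proof -
  obtain c \<Phi>' where d: "0 < c" "\<forall>t>0. (\<Phi> has_real_derivative \<Phi>' t) (at t)
    \<and> c * (\<Phi> t / t) \<le> \<Phi>' t \<and> \<Phi>' t \<le> inverse c * (\<Phi> t / t)"
    using phi_derivative by auto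
  have pos: "\<Phi>' x > 0" if "x > 0" for x
  proof -
    have "0 < c * (\<Phi> x / x)" using d(1) phi_pos[OF that] that by simp
    moreover have "c * (\<Phi> x / x) \<le> \<Phi>' x" using d(2) that by simp
    ultimately show ?thesis by linarith
  qed
  \<comment> \<open>The derivative is available at positive arguments only and \<open>s\<close> may
    be 0; strictness is therefore obtained on the upper half of the interval.\<close>
  have "\<Phi> ((s + t) / 2) < \<Phi> t"
  proof (rule DERIV_pos_imp_increasing[where f=\<Phi>])
    fix x assume "(s + t) / 2 \<le> x" "x \<le> t"
    then have "x > 0" using assms by simp
    then show "\<exists>l. DERIV \<Phi> x :> l \<and> l > 0" using d(2) pos by blast
  qed (use assms in simp)
  moreover have "\<Phi> s \<le> \<Phi> ((s + t) / 2)" using assms by (intro phi_mono) auto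
  ultimately show ?thesis by simp
qed

definition "\<Psi> = inv_into {0..} \<Phi>"

lemma phi_inj: "inj_on \<Phi> {0..}"
proof (rule inj_onI)
  fix s t assume "s \<in> {0..}" "t \<in> {0..}" "\<Phi> s = \<Phi> t"
  then show "s = t"
    using phi_strict_mono[of s t] phi_strict_mono[of t s] by (cases s t rule: linorder_cases) auto
qed

lemma psi_nonneg: "0 \<le> u \<Longrightarrow> 0 \<le> \<Psi> u"
  unfolding \<Psi>_def using inv_into_into[of u \<Phi> "{0..}"] phi_range by simp

lemma phi_psi: "0 \<le> u \<Longrightarrow> \<Phi> (\<Psi> u) = u"
  unfolding \<Psi>_def using f_inv_into_f[of u \<Phi> "{0..}"] phi_range by simp

lemma psi_phi: "0 \<le> t \<Longrightarrow> \<Psi> (\<Phi> t) = t"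
  unfolding \<Psi>_def by (simp add: inv_into_f_f phi_inj)

lemma phi_le_iff: "0 \<le> s \<Longrightarrow> 0 \<le> t \<Longrightarrow> \<Phi> s \<le> \<Phi> t \<longleftrightarrow> s \<le> t"
  using phi_mono phi_strict_mono by (meson linorder_not_le)

lemma le_psi_iff: "0 \<le> t \<Longrightarrow> 0 \<le> u \<Longrightarrow> t \<le> \<Psi> u \<longleftrightarrow> \<Phi> t \<le> u"
  using phi_le_iff[of t "\<Psi> u"] by (simp add: psi_nonneg phi_psi)

lemma psi_le_iff: "0 \<le> t \<Longrightarrow> 0 \<le> u \<Longrightarrow> \<Psi> u \<le> t \<longleftrightarrow> u \<le> \<Phi> t"
  using phi_le_iff[of "\<Psi> u" t] by (simp add: psi_nonneg phi_psi)

lemma psi_mono: "0 \<le> u \<Longrightarrow> u \<le> v \<Longrightarrow> \<Psi> u \<le> \<Psi> v"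
  by (simp add: psi_le_iff psi_nonneg phi_psi)

lemma psi_pos: "0 < u \<Longrightarrow> 0 < \<Psi> u"
  using psi_le_iff[of 0 u] by (simp add: not_le[symmetric])

lemma lower_type_const:
  obtains L where "L \<ge> 1" "\<And>s t. 0 \<le> s \<Longrightarrow> 0 \<le> t \<Longrightarrow> t \<le> 1 \<Longrightarrow> \<Phi> (s * t) \<le> L * t powr p * \<Phi> s"
proof -
  obtain C where C: "C > 0" "\<And>s t. 0 < s \<Longrightarrow> 0 < t \<Longrightarrow> t \<le> 1 \<Longrightarrow> \<Phi> (s * t) \<le> C * t powr p * \<Phi> s"
    using growth_class unfolding growth_class_def lower_type_def by auto
  show ?thesis
  proof (rule that[of "max C 1"])
    fix s t :: real assume st: "0 \<le> s" "0 \<le> t" "t \<le> 1"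
    show "\<Phi> (s * t) \<le> max C 1 * t powr p * \<Phi> s"
    proof (cases "s = 0 \<or> t = 0")
      case True
      then have "s * t = 0" by auto
      moreover have "0 \<le> max C 1 * t powr p * \<Phi> s" using phi_nonneg[OF st(1)] by (intro mult_nonneg_nonneg) auto
      ultimately show ?thesis by (simp only: phi_zero)
    next
      case False
      then have "\<Phi> (s * t) \<le> C * (t powr p * \<Phi> s)" using C(2)[of s t] st by (simp add: mult.assoc)
      also have "\<dots> \<le> max C 1 * (t powr p * \<Phi> s)"
        using phi_nonneg[OF st(1)] by (intro mult_right_mono) auto
      finally show ?thesis by (simp add: mult.assoc)
    qed
  qed simp
qed

text \<open>Lower type p of \<Phi> is upper type 1/p of its inverse. The factor \<open>l\<close>
  solves L l^(-p) = u / v, so the lower type inequality at \<open>l * \<Psi> u\<close> reads u \<le>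
  (u / v) \<Phi> (l * \<Psi> u).\<close>

lemma psi_upper_type:
  obtains K where "K \<ge> 1" "\<And>u v. 0 < u \<Longrightarrow> u \<le> v \<Longrightarrow> \<Psi> v \<le> K * (v / u) powr (1 / p) * \<Psi> u"
proof -
  obtain L where L: "L \<ge> 1" "\<And>s t. 0 \<le> s \<Longrightarrow> 0 \<le> t \<Longrightarrow> t \<le> 1 \<Longrightarrow> \<Phi> (s * t) \<le> L * t powr p * \<Phi> s"
    using lower_type_const by blast
  show ?thesis
  proof (rule that[of "L powr (1 / p)"])
    show "L powr (1 / p) \<ge> 1" using L p by (intro ge_one_powr_ge_zero) auto
    fix u v :: real assume uv: "0 < u" "u \<le> v"
    define l where "l = (L * (v / u)) powr (1 / p)"
    have "L * (v / u) \<ge> 1" using L uv mult_mono[of 1 L 1 "v / u"] by simp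
    then have l: "l \<ge> 1" unfolding l_def using p by (intro ge_one_powr_ge_zero) auto
    have "\<Phi> (l * \<Psi> u * (1 / l)) \<le> L * (1 / l) powr p * \<Phi> (l * \<Psi> u)"
      using l psi_nonneg[of u] uv by (intro L(2)) auto
    moreover have "l * \<Psi> u * (1 / l) = \<Psi> u" using l by simp
    moreover have "(1 / l) powr p = 1 / (L * (v / u))"
      using p L uv by (simp add: l_def powr_divide powr_powr)
    ultimately have "u \<le> L * (1 / (L * (v / u))) * \<Phi> (l * \<Psi> u)" using uv by (simp add: phi_psi)
    also have "\<dots> = u / v * \<Phi> (l * \<Psi> u)" using L uv by simp
    finally have "v \<le> \<Phi> (l * \<Psi> u)" using uv by (simp add: field_simps)
    then have "\<Psi> v \<le> l * \<Psi> u" using uv l psi_nonneg[of u] by (subst psi_le_iff) auto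
    also have "l = L powr (1 / p) * (v / u) powr (1 / p)"
      unfolding l_def using L uv by (subst powr_mult) auto
    finally show "\<Psi> v \<le> L powr (1 / p) * (v / u) powr (1 / p) * \<Psi> u" .
  qed
qed

lemma phi_continuous_compose:
  assumes "continuous_on S f"
  shows "continuous_on S (\<lambda>x. \<Phi> (cmod (f x)))"
  by (rule continuous_on_compose2[OF phi_cont]) (auto intro!: continuous_intros assms)

lemma borel_measurable_phi_cmod:
  assumes [measurable]: "f \<in> borel_measurable M" and "r > 0"
  shows "(\<lambda>x. \<Phi> (cmod (f x) / r)) \<in> borel_measurable M"
proof -
  \<comment> \<open>Nothing is known about \<Phi> at negative arguments; \<open>max 0 t\<close>
    makes it continuous on the whole line.\<close>
  have "continuous_on UNIV (\<lambda>t. \<Phi> (max 0 t))"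
    by (rule continuous_on_compose2[OF phi_cont]) (auto intro!: continuous_intros)
  then have [measurable]: "(\<lambda>t. \<Phi> (max 0 t)) \<in> borel_measurable borel"
    by (rule borel_measurable_continuous_onI)
  have "(\<lambda>x. (\<lambda>t. \<Phi> (max 0 t)) (cmod (f x) / r)) \<in> borel_measurable M" by measurable
  then show ?thesis using \<open>r > 0\<close> by simp
qed

text \<open>Let \<open>m\<close> be the supremum of \<open>\<Phi> \<bar>f z\<bar> (1 - \<bar>z\<bar>\<^sup>2) powr N\<close>, and let \<open>S w\<close> be the bound for \<open>\<bar>f w\<bar>\<close> it
  encodes. In the reproducing formula with a larger weight, \<open>\<bar>f w\<bar>\<close> is at most
  \<open>\<Phi> \<bar>f w\<bar>\<close> times \<open>S w / \<Phi> (S w)\<close>, and the kernel absorbs \<open>S w / \<Phi> (S w)\<close> up to \<open>S z / m\<close>; at a point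
  where the supremum is nearly attained this bounds \<open>m\<close>.\<close>

lemma pointwise_estimate:
  fixes \<alpha> :: real
  assumes \<alpha>: "\<alpha> > -1"
  defines "N \<equiv> real CARD('n::finite) + 1 + \<alpha>"
  obtains C where "C > 0"
    "\<And>(f :: complex ^ 'n \<Rightarrow> complex) z. holomorphic_ball f \<Longrightarrow> bounded (f ` ball 0 1) \<Longrightarrow>
      (\<integral>\<^sup>+w. ennreal (\<Phi> (cmod (f w))) \<partial>weighted_measure \<alpha>) \<le> 1 \<Longrightarrow> norm z < 1 \<Longrightarrow>
      \<Phi> (cmod (f z)) * (1 - (norm z)\<^sup>2) powr N \<le> C"
proof -
  have N: "N > 0" using \<alpha> by (simp add: N_def add_pos_nonneg)
  \<comment> \<open>The upper type of \<Psi> at arguments m y^(-N) costs a ratio of the y's to the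
    power N/p; the weight \<alpha> + t brings a kernel with exponent N + t, large enough to absorb
    it.\<close>
  define t where "t = N / p"
  have t: "t > 0" using N p by (simp add: t_def)
  have \<beta>: "\<alpha> + t > -1" using \<alpha> t by simp
  obtain K where K: "K \<ge> 1" "\<And>u v. 0 < u \<Longrightarrow> u \<le> v \<Longrightarrow> \<Psi> v \<le> K * (v / u) powr (1 / p) * \<Psi> u"
    using psi_upper_type by blast
  define c where "c = weight_const TYPE('n) (\<alpha> + t) / weight_const TYPE('n) \<alpha>"
  have c: "c > 0" using weight_const_pos[OF \<alpha>, where 'n='n] weight_const_pos[OF \<beta>, where 'n='n] by (simp add: c_def)
  define A where "A = K * 2 powr (N + t)"
  have A: "A > 0" using K by (simp add: A_def)
  define C where "C = c * A * (K * 2 powr (1 / p))"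
  show ?thesis
  proof (rule that[of C])
    show "C > 0" using c A K by (simp add: C_def)
    fix f :: "complex ^ 'n \<Rightarrow> complex" and z :: "complex ^ 'n"
    assume f: "holomorphic_ball f" and bdd: "bounded (f ` ball 0 1)"
      and int: "(\<integral>\<^sup>+w. ennreal (\<Phi> (cmod (f w))) \<partial>weighted_measure \<alpha>) \<le> 1" and z: "norm z < 1"
    define y where "y w = 1 - (norm w)\<^sup>2" for w :: "complex ^ 'n"
    have y: "0 < y w" "y w \<le> 1" if "norm w < 1" for w
      using that norm_lt_1_iff_square[of w] by (simp_all add: y_def)
    define Q where "Q w = \<Phi> (cmod (f w)) * y w powr N" for w
    have Q0: "Q w \<ge> 0" for w by (simp add: Q_def phi_nonneg)
    obtain B where "\<forall>w\<in>ball 0 1. cmod (f w) \<le> B"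
      using bdd by (auto simp: bounded_iff)
    then have B: "\<And>w. norm w < 1 \<Longrightarrow> cmod (f w) \<le> B" by simp
    have QB: "Q w \<le> \<Phi> B" if "norm w < 1" for w
    proof -
      have "\<Phi> (cmod (f w)) * y w powr N \<le> \<Phi> B * 1"
        using B[OF that] y[OF that] N order_trans[OF norm_ge_zero B[OF that]]
        by (intro mult_mono phi_mono powr_le1 phi_nonneg) auto
      then show ?thesis by (simp add: Q_def)
    qed
    \<comment> \<open>Boundedness of \<open>f\<close> makes \<open>m\<close> finite. Without an a
      priori finite \<open>m\<close> the absorption at the end would be void; the resulting bound
      does not depend on the bound of \<open>f\<close>.\<close>
    then have bdQ: "bdd_above (Q ` ball 0 1)" by (intro bdd_aboveI[of _ "\<Phi> B"]) auto
    define m where "m = Sup (Q ` ball 0 1)"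
    have Qm: "Q w \<le> m" if "norm w < 1" for w
      unfolding m_def using that by (intro cSup_upper bdQ) auto
    have "m \<le> C"
    proof (cases "m > 0")
      case True
      then have "m / 2 < m" by simp
      then obtain x where x: "norm x < 1" "m / 2 < Q x"
        unfolding m_def by (subst (asm) less_cSup_iff) (auto intro: bdQ)
      define S where "S w = \<Psi> (m * y w powr (- N))" for w
      have S_pos: "S w > 0" if "norm w < 1" for w
        using True y[OF that] unfolding S_def by (intro psi_pos mult_pos_pos) auto
      have fS: "cmod (f w) \<le> S w" if "norm w < 1" for w
      proof -
        have "\<Phi> (cmod (f w)) \<le> m * y w powr (- N)"
          using Qm[OF that] y[OF that] by (simp add: Q_def powr_minus field_simps)
        then show ?thesis unfolding S_def using True y[OF that] by (simp add: le_psi_iff)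
      qed
      have key: "cmod (f w) * (bdist x w powr (- (N + t)) * y w powr t) \<le> A * S x / m * \<Phi> (cmod (f w))"
        if w: "norm w < 1" for w
      proof (cases "f w = 0")
        case False
        have pos: "y w > 0" "y x > 0" "bdist x w > 0" using y w x bdist_pos by auto
        have "\<Phi> (S w) / S w \<le> \<Phi> (cmod (f w)) / cmod (f w)"
          using False fS[OF w] by (intro phi_quotient) auto
        moreover have "\<Phi> (S w) = m * y w powr (- N)"
          unfolding S_def using True pos by (intro phi_psi) auto
        ultimately have "m * y w powr (- N) / S w \<le> \<Phi> (cmod (f w)) / cmod (f w)" by simp
        then have "cmod (f w) \<le> \<Phi> (cmod (f w)) * (S w * y w powr N) / m"
          using False S_pos[OF w] True pos by (simp add: powr_minus field_simps)
        then have "cmod (f w) * (bdist x w powr (- (N + t)) * y w powr t)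
            \<le> \<Phi> (cmod (f w)) * (S w * y w powr N) / m * (bdist x w powr (- (N + t)) * y w powr t)"
          by (intro mult_right_mono) auto
        also have "\<dots> = (S w * y w powr (N + t) * bdist x w powr (- (N + t))) * (\<Phi> (cmod (f w)) / m)"
          by (simp add: powr_add)
        also have "\<dots> \<le> (A * S x) * (\<Phi> (cmod (f w)) / m)"
        proof (intro mult_right_mono)
          have d2: "y w \<le> 2 * bdist x w" "y x \<le> 2 * bdist x w"
            unfolding y_def using bdist_ge_square[OF x(1) w] by auto
          have d3: "(2 * bdist x w) powr (N + t) * bdist x w powr (- (N + t)) = 2 powr (N + t)"
          proof -
            have "bdist x w powr (N + t) * bdist x w powr (- (N + t)) = 1"
              using pos by (simp flip: powr_add)
            then show ?thesis using pos by (simp add: powr_mult mult.assoc)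
          qed
          show "S w * y w powr (N + t) * bdist x w powr (- (N + t)) \<le> A * S x"
          \<comment> \<open>If \<open>w\<close> is the point deeper in the ball, S w \<le> S x by
            monotonicity. Otherwise S w exceeds S x by at most K (y x / y w)^t, and the factor (y
            w)^(N + t) turns this into (y x)^t (y w)^N. In both cases y w and y x are at most 2
            \<open>bdist x w\<close>.\<close>
          proof (cases "y x \<le> y w")
            case le: True
            have "y w powr (- N) \<le> y x powr (- N)" using le pos N by (intro powr_mono2') auto
            then have "S w \<le> S x" unfolding S_def using True pos by (intro psi_mono mult_left_mono) auto
            moreover have "y w powr (N + t) \<le> (2 * bdist x w) powr (N + t)"
              using d2 pos N t by (intro powr_mono2) auto
            ultimately have "S w * y w powr (N + t) * bdist x w powr (- (N + t)) \<le> S x * (2 * bdist x w) powr (N + t) * bdist x w powr (- (N + t))"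
              using S_pos[OF w] by (intro mult_right_mono mult_mono) auto
            also have "\<dots> = 1 * (S x * 2 powr (N + t))" using d3 by (simp add: mult.assoc)
            also have "\<dots> \<le> K * (S x * 2 powr (N + t))"
              using K S_pos[OF x(1)] by (intro mult_right_mono) auto
            finally show ?thesis by (simp add: A_def mult_ac)
          next
            case False
            have "m * y x powr (- N) \<le> m * y w powr (- N)"
              using False pos N True by (intro mult_left_mono powr_mono2') auto
            then have "S w \<le> K * (m * y w powr (- N) / (m * y x powr (- N))) powr (1 / p) * S x"
              unfolding S_def using True pos by (intro K(2)) auto
            also have "(m * y w powr (- N) / (m * y x powr (- N))) powr (1 / p) = (y x powr N / y w powr N) powr (1 / p)"
              using True pos by (simp add: powr_minus field_simps)
            also have "\<dots> = y x powr t / y w powr t"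
              using pos by (simp add: powr_divide powr_powr t_def)
            finally have "S w * y w powr (N + t) \<le> K * (y x powr t / y w powr t) * S x * y w powr (N + t)"
              by (intro mult_right_mono) auto
            also have "\<dots> = K * S x * (y x powr t * y w powr N)"
              using pos by (simp add: powr_add)
            also have "\<dots> \<le> K * S x * ((2 * bdist x w) powr t * (2 * bdist x w) powr N)"
              using K S_pos[OF x(1)] d2 pos N t by (intro mult_left_mono mult_mono powr_mono2) auto
            also have "\<dots> = K * S x * (2 * bdist x w) powr (N + t)" by (simp add: powr_add)
            finally have "S w * y w powr (N + t) * bdist x w powr (- (N + t)) \<le> K * S x * (2 * bdist x w) powr (N + t) * bdist x w powr (- (N + t))"
              by (rule mult_right_mono) simp
            also have "\<dots> = A * S x" using d3 by (simp add: A_def mult.assoc)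
            finally show ?thesis .
          qed
        qed (use True phi_nonneg in auto)
        finally show ?thesis by simp
      qed (use A S_pos[OF x(1)] True phi_nonneg in auto)
      have fm: "f \<in> borel_measurable (weighted_measure a)" for a
        using f by (intro borel_measurable_weighted_continuous holomorphic_ball_imp_continuous_on)
      have "f x = (LINT w|weighted_measure (\<alpha> + t). f w / (1 - hermitian_inner x w) powr of_real (N + t))"
        using bergman_reproducing[OF \<beta> f integrable_weighted_holomorphic[OF \<beta> f bdd] x(1)]
        by (simp add: bergman_projection_def N_def add_ac)
      also have "ennreal (cmod \<dots>) \<le> (\<integral>\<^sup>+w. ennreal (cmod (f w / (1 - hermitian_inner x w) powr of_real (N + t))) \<partial>weighted_measure (\<alpha> + t))"
      proof (rule integral_norm_bound_ennreal)
        have "(\<lambda>v. 1 / (1 - v) powr of_real (N + t)) holomorphic_on ball 0 1" by (rule holomorphic_kernel)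
        from integrable_weighted_inner[OF integrable_weighted_holomorphic[OF \<beta> f bdd] this x(1)]
        show "integrable (weighted_measure (\<alpha> + t)) (\<lambda>w. f w / (1 - hermitian_inner x w) powr of_real (N + t))"
          by simp
      qed
      also have "\<dots> = (\<integral>\<^sup>+w. ennreal (cmod (f w) * bdist x w powr (- (N + t))) \<partial>weighted_measure (\<alpha> + t))"
        unfolding norm_divide cmod_one_minus_powr by (simp only: powr_minus_divide times_divide_eq_right mult_1_right)
      also have "\<dots> = ennreal c * (ennreal (1 / c) * (\<integral>\<^sup>+w. ennreal (cmod (f w) * bdist x w powr (- (N + t))) \<partial>weighted_measure (\<alpha> + t)))"
        using c by (simp add: mult.assoc[symmetric] flip: ennreal_mult)
      also have "ennreal (1 / c) * (\<integral>\<^sup>+w. ennreal (cmod (f w) * bdist x w powr (- (N + t))) \<partial>weighted_measure (\<alpha> + t))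
         = (\<integral>\<^sup>+w. ennreal (cmod (f w) * bdist x w powr (- (N + t))) * ennreal (y w powr t) \<partial>weighted_measure \<alpha>)"
      proof -
        note [measurable] = fm borel_measurable_weighted_ident
        have "1 / c = weight_const TYPE('n) \<alpha> / weight_const TYPE('n) (\<alpha> + t)" by (simp add: c_def)
        then show ?thesis
          unfolding y_def by (simp only:) (intro nn_integral_weighted_shift[symmetric] \<alpha> \<beta>, measurable)
      qed
      also have "\<dots> \<le> (\<integral>\<^sup>+w. ennreal (A * S x / m) * ennreal (\<Phi> (cmod (f w))) \<partial>weighted_measure \<alpha>)"
      proof (rule nn_integral_mono)
        fix w assume "w \<in> space (weighted_measure \<alpha> :: (complex ^ 'n) measure)"
        then show "ennreal (cmod (f w) * bdist x w powr (- (N + t))) * ennreal (y w powr t) \<le> ennreal (A * S x / m) * ennreal (\<Phi> (cmod (f w)))"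
          using key[of w] A S_pos[OF x(1)] True
          by (simp add: phi_nonneg mult.assoc ennreal_leI flip: ennreal_mult)
      qed
      also have "\<dots> = ennreal (A * S x / m) * (\<integral>\<^sup>+w. ennreal (\<Phi> (cmod (f w))) \<partial>weighted_measure \<alpha>)"
        using borel_measurable_phi_cmod[OF fm, of 1] by (intro nn_integral_cmult) simp
      also have "\<dots> \<le> ennreal (A * S x / m) * 1" using int by (intro mult_left_mono) auto
      finally have "ennreal (cmod (f x)) \<le> ennreal c * (ennreal (A * S x / m) * 1)"
        by (simp add: mult_left_mono)
      then have fx: "cmod (f x) \<le> c * (A * S x / m)"
        using c A S_pos[OF x(1)] True by (simp flip: ennreal_mult)
      have pos: "y x > 0" using y x by auto
      have "f x \<noteq> 0" using x(2) True by (auto simp: Q_def)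
      then have fpos: "\<Phi> (cmod (f x)) > 0" by (intro phi_pos) simp
      \<comment> \<open>Since \<open>x\<close> nearly attains the supremum, \<open>S x\<close> is at
        most a constant times |f x|; so |f x| stands on both sides of the estimate and cancels,
        leaving m \<le> C.\<close>
      have "m * y x powr (- N) \<le> 2 * \<Phi> (cmod (f x))"
        using x(2) pos by (simp add: Q_def powr_minus field_simps)
      then have "S x \<le> \<Psi> (2 * \<Phi> (cmod (f x)))"
        unfolding S_def using True by (intro psi_mono) auto
      also have "\<dots> \<le> K * (2 * \<Phi> (cmod (f x)) / \<Phi> (cmod (f x))) powr (1 / p) * \<Psi> (\<Phi> (cmod (f x)))"
        using fpos by (intro K(2)) auto
      also have "\<dots> = K * 2 powr (1 / p) * cmod (f x)" using fpos by (simp add: psi_phi)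
      finally have "c * (A * S x / m) \<le> c * (A * (K * 2 powr (1 / p) * cmod (f x)) / m)"
        using c A True by (intro mult_left_mono divide_right_mono) auto
      also have "\<dots> = C * cmod (f x) / m" by (simp add: C_def)
      finally have "cmod (f x) * m \<le> C * cmod (f x)" using fx True by (simp add: field_simps)
      then show ?thesis using \<open>f x \<noteq> 0\<close> by (simp add: mult.commute)
    qed (use \<open>C > 0\<close> in simp)
    then show "\<Phi> (cmod (f z)) * (1 - (norm z)\<^sup>2) powr N \<le> C"
      using Qm[OF z] by (simp add: Q_def y_def)
  qed
qed

end

section \<open>Powers of the kernel\<close>

definition kernel_power :: "real \<Rightarrow> complex \<Rightarrow> complex" where
  "kernel_power s x = 1 / (1 - x) powr of_real s"

lemma holomorphic_kernel_power: "kernel_power s holomorphic_on ball 0 1"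
  unfolding kernel_power_def[abs_def] by (rule holomorphic_kernel)

lemma cmod_kernel_power: "cmod (kernel_power s (hermitian_inner z w)) = bdist z w powr (- s)"
  by (simp add: kernel_power_def norm_divide cmod_one_minus_powr powr_minus_divide)

lemma cnj_kernel_power:
  assumes "norm z < 1" "norm w < 1"
  shows "cnj (kernel_power s (hermitian_inner z w)) = kernel_power s (hermitian_inner w z)"
  by (simp add: kernel_power_def cnj_one_minus_powr[OF assms])

lemma kernel_power_Suc:
  assumes "x \<in> ball 0 1"
  shows "(1 - x) * kernel_power (s + 1) x = kernel_power s x"
proof -
  have "1 - x \<noteq> 0" using assms by auto
  then show ?thesis by (simp add: kernel_power_def powr_add)
qed

lemma has_field_derivative_kernel_power:
  assumes "x \<in> ball 0 1"
  shows "(kernel_power s has_field_derivative of_real s * kernel_power (s + 1) x) (at x)"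
proof -
  have "Re x < 1" using assms complex_Re_le_cmod[of x] by simp
  then have "1 - x \<notin> \<real>\<^sub>\<le>\<^sub>0" by (auto simp: complex_nonpos_Reals_iff)
  then have "((\<lambda>x. (1 - x) powr (- of_real s)) has_field_derivative
      (- of_real s) * (1 - x) powr (- of_real s - 1) * (0 - 1)) (at x)"
    by (intro DERIV_chain2[OF has_field_derivative_powr] derivative_intros)
  moreover have "(\<lambda>x. (1 - x) powr (- of_real s)) = kernel_power s"
    by (simp add: kernel_power_def powr_minus_divide fun_eq_iff)
  moreover have "(1 - x) powr (- of_real s - 1) = kernel_power (s + 1) x"
    using powr_minus_divide[of "1 - x" "of_real s + 1"] by (simp add: kernel_power_def)
  ultimately show ?thesis by simp
qed

lemma bergman_projection_eq:
  "bergman_projection \<alpha> g (z :: complex ^ 'n)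
    = (LINT w|weighted_measure \<alpha>. g w * kernel_power (real CARD('n) + 1 + \<alpha>) (hermitian_inner z w))"
  by (simp add: bergman_projection_def kernel_power_def)

lemma bergman_projection_zero:
  "bergman_projection \<alpha> g (0 :: complex ^ 'n) = (LINT w|weighted_measure \<alpha>. g w)"
  by (simp add: bergman_projection_def)

text \<open>The iterates of x d/dx on the kernel: this is how the radial derivative in z acts on a
  function of <z,w>.\<close>

fun kernel_deriv :: "real \<Rightarrow> nat \<Rightarrow> complex \<Rightarrow> complex" where
  "kernel_deriv N 0 = kernel_power N"
| "kernel_deriv N (Suc k) = (\<lambda>x. x * deriv (kernel_deriv N k) x)"

lemma holomorphic_kernel_deriv: "kernel_deriv N k holomorphic_on ball 0 1"
  by (induction k) (auto intro!: holomorphic_intros holomorphic_kernel_power holomorphic_deriv)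

text \<open>By the identity x (1 - x)^(-s-1) = (1 - x)^(-s-1) - (1 - x)^(-s), x d/dx maps the power
  of exponent s to s times the difference of the powers of exponents s + 1 and s.\<close>

lemma kernel_deriv_expansion:
  "\<exists>c :: nat \<Rightarrow> real. \<forall>x\<in>ball 0 1. kernel_deriv N k x = (\<Sum>j\<le>k. of_real (c j) * kernel_power (N + real j) x)"
proof (induction k)
  case 0
  show ?case by (intro exI[of _ "\<lambda>_. 1"]) simp
next
  case (Suc k)
  then obtain c :: "nat \<Rightarrow> real" where c: "\<forall>x\<in>ball 0 1. kernel_deriv N k x = (\<Sum>j\<le>k. of_real (c j) * kernel_power (N + real j) x)"
    by blast
  define d where "d j = c j * (N + real j)" for j
  define c' where "c' j = (case j of 0 \<Rightarrow> 0 | Suc i \<Rightarrow> d i) - (if j \<le> k then d j else 0)" for j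
  show ?case
  proof (intro exI[of _ c'] ballI)
    fix x :: complex assume x: "x \<in> ball 0 1"
    have "((\<lambda>x. \<Sum>j\<le>k. of_real (c j) * kernel_power (N + real j) x) has_field_derivative
        (\<Sum>j\<le>k. of_real (c j) * (of_real (N + real j) * kernel_power (N + real j + 1) x))) (at x)"
      by (intro DERIV_sum DERIV_cmult has_field_derivative_kernel_power x)
    then have "(kernel_deriv N k has_field_derivative
        (\<Sum>j\<le>k. of_real (c j) * (of_real (N + real j) * kernel_power (N + real j + 1) x))) (at x)"
      by (rule has_field_derivative_transform_within_open[OF _ open_ball x]) (use c in simp)
    then have "kernel_deriv N (Suc k) x = (\<Sum>j\<le>k. of_real (d j) * (x * kernel_power (N + real j + 1) x))"
      by (simp add: DERIV_imp_deriv sum_distrib_left d_def mult_ac)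
    also have "\<dots> = (\<Sum>j\<le>k. of_real (d j) * kernel_power (N + real (Suc j)) x) - (\<Sum>j\<le>k. of_real (d j) * kernel_power (N + real j) x)"
    proof -
      have "x * kernel_power (N + real j + 1) x = kernel_power (N + real (Suc j)) x - kernel_power (N + real j) x" for j
      proof -
        have "x * kernel_power (N + real j + 1) x = kernel_power (N + real j + 1) x - (1 - x) * kernel_power (N + real j + 1) x"
          by (simp add: algebra_simps)
        then show ?thesis by (simp only: kernel_power_Suc[OF x]) (simp add: add_ac)
      qed
      then show ?thesis by (simp add: right_diff_distrib sum_subtractf)
    qed
    also have "(\<Sum>j\<le>k. of_real (d j) * kernel_power (N + real (Suc j)) x)
        = (\<Sum>j\<le>Suc k. of_real (case j of 0 \<Rightarrow> 0 | Suc i \<Rightarrow> d i) * kernel_power (N + real j) x)"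
      by (subst sum.atMost_Suc_shift) simp
    also have "(\<Sum>j\<le>k. of_real (d j) * kernel_power (N + real j) x)
        = (\<Sum>j\<le>Suc k. of_real (if j \<le> k then d j else 0) * kernel_power (N + real j) x)"
      by simp
    finally show "kernel_deriv N (Suc k) x = (\<Sum>j\<le>Suc k. of_real (c' j) * kernel_power (N + real j) x)"
      by (simp only: c'_def of_real_diff left_diff_distrib sum_subtractf)
  qed
qed

text \<open>The triangular relation between powers and derivatives read backwards; the division by s
  = N + k is where N > 0 enters. It lets the integral of a symbol against a higher kernel power be
  computed from its radial derivatives.\<close>

lemma kernel_power_expansion:
  assumes "N > 0"
  shows "\<exists>c :: nat \<Rightarrow> real. \<forall>x\<in>ball 0 1. kernel_power (N + real k) x = (\<Sum>j\<le>k. of_real (c j) * kernel_deriv N j x)"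
proof (induction k)
  case 0
  show ?case by (intro exI[of _ "\<lambda>_. 1"]) simp
next
  case (Suc k)
  then obtain c :: "nat \<Rightarrow> real" where c: "\<forall>x\<in>ball 0 1. kernel_power (N + real k) x = (\<Sum>j\<le>k. of_real (c j) * kernel_deriv N j x)"
    by blast
  define s where "s = N + real k"
  have s: "s > 0" using assms by (simp add: s_def add_pos_nonneg)
  define c' where "c' j = (case j of 0 \<Rightarrow> 0 | Suc i \<Rightarrow> c i / s) + (if j \<le> k then c j else 0)" for j
  show ?case
  proof (intro exI[of _ c'] ballI)
    fix x :: complex assume x: "x \<in> ball 0 1"
    have "(kernel_deriv N j has_field_derivative deriv (kernel_deriv N j) x) (at x)" for j
      using holomorphic_derivI[OF holomorphic_kernel_deriv open_ball x] by simp
    then have "((\<lambda>x. \<Sum>j\<le>k. of_real (c j) * kernel_deriv N j x) has_field_derivative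
        (\<Sum>j\<le>k. of_real (c j) * deriv (kernel_deriv N j) x)) (at x)"
      by (intro DERIV_sum DERIV_cmult)
    then have "(kernel_power s has_field_derivative (\<Sum>j\<le>k. of_real (c j) * deriv (kernel_deriv N j) x)) (at x)"
      by (rule has_field_derivative_transform_within_open[OF _ open_ball x]) (use c in \<open>simp add: s_def\<close>)
    then have "of_real s * kernel_power (s + 1) x = (\<Sum>j\<le>k. of_real (c j) * deriv (kernel_deriv N j) x)"
      using has_field_derivative_kernel_power[OF x, of s] by (rule DERIV_unique[rotated])
    then have "x * (of_real s * kernel_power (s + 1) x) = (\<Sum>j\<le>k. of_real (c j) * kernel_deriv N (Suc j) x)"
      by (simp add: sum_distrib_left mult_ac)
    moreover have "x * kernel_power (s + 1) x = kernel_power (s + 1) x - kernel_power s x"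
    proof -
      have "x * kernel_power (s + 1) x = kernel_power (s + 1) x - (1 - x) * kernel_power (s + 1) x"
        by (simp add: algebra_simps)
      then show ?thesis by (simp only: kernel_power_Suc[OF x])
    qed
    ultimately have "of_real s * (kernel_power (s + 1) x - kernel_power s x) = (\<Sum>j\<le>k. of_real (c j) * kernel_deriv N (Suc j) x)"
      by (metis mult.left_commute)
    then have "kernel_power (s + 1) x = (\<Sum>j\<le>k. of_real (c j) * kernel_deriv N (Suc j) x) / of_real s + kernel_power s x"
      using s by (simp add: field_simps)
    also have "(\<Sum>j\<le>k. of_real (c j) * kernel_deriv N (Suc j) x) / of_real s = (\<Sum>j\<le>k. of_real (c j / s) * kernel_deriv N (Suc j) x)"
      by (simp add: sum_divide_distrib)
    also have "\<dots> = (\<Sum>j\<le>Suc k. of_real (case j of 0 \<Rightarrow> 0 | Suc i \<Rightarrow> c i / s) * kernel_deriv N j x)"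
      by (subst sum.atMost_Suc_shift) simp
    also have "kernel_power s x = (\<Sum>j\<le>Suc k. of_real (if j \<le> k then c j else 0) * kernel_deriv N j x)"
      using c x by (simp add: s_def)
    finally show "kernel_power (N + real (Suc k)) x = (\<Sum>j\<le>Suc k. of_real (c' j) * kernel_deriv N j x)"
      by (simp only: c'_def of_real_add distrib_right sum.distrib) (simp add: s_def add_ac)
  qed
qed

text \<open>In the expansion the highest power dominates: \<open>bdist\<close> is at most 2, so each
  lower one costs only a factor 2^(k-j).\<close>

lemma kernel_deriv_bound:
  obtains M where "M > 0" "\<And>z w :: complex ^ 'n. norm z < 1 \<Longrightarrow> norm w < 1 \<Longrightarrow>
    cmod (kernel_deriv N k (hermitian_inner z w)) \<le> M * bdist z w powr (- (N + real k))"
proof -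
  obtain c :: "nat \<Rightarrow> real" where c: "\<forall>x\<in>ball 0 1. kernel_deriv N k x = (\<Sum>j\<le>k. of_real (c j) * kernel_power (N + real j) x)"
    using kernel_deriv_expansion by blast
  define M where "M = 1 + (\<Sum>j\<le>k. \<bar>c j\<bar> * 2 powr (real k - real j))"
  have M: "M > 0" unfolding M_def by (intro add_pos_nonneg sum_nonneg) auto
  show ?thesis
  proof (rule that[OF M])
    fix z w :: "complex ^ 'n" assume zw: "norm z < 1" "norm w < 1"
    have b: "0 < bdist z w" "bdist z w \<le> 2" using zw by (auto simp: bdist_pos bdist_le_2)
    have "cmod (kernel_deriv N k (hermitian_inner z w)) \<le> (\<Sum>j\<le>k. cmod (of_real (c j) * kernel_power (N + real j) (hermitian_inner z w)))"
      using c hermitian_inner_less_one(2)[OF zw] by (simp add: norm_sum)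
    also have "\<dots> = (\<Sum>j\<le>k. \<bar>c j\<bar> * bdist z w powr (- (N + real j)))"
      by (simp add: norm_mult cmod_kernel_power)
    also have "\<dots> \<le> (\<Sum>j\<le>k. \<bar>c j\<bar> * (2 powr (real k - real j) * bdist z w powr (- (N + real k))))"
    proof (intro sum_mono mult_left_mono)
      fix j assume "j \<in> {..k}"
      then have "bdist z w powr (real k - real j) \<le> 2 powr (real k - real j)"
        using b by (intro powr_mono2) auto
      then have "bdist z w powr (real k - real j) * bdist z w powr (- (N + real k)) \<le> 2 powr (real k - real j) * bdist z w powr (- (N + real k))"
        by (rule mult_right_mono) simp
      then show "bdist z w powr (- (N + real j)) \<le> 2 powr (real k - real j) * bdist z w powr (- (N + real k))"
        by (simp add: algebra_simps flip: powr_add)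
    qed simp
    also have "\<dots> = (\<Sum>j\<le>k. \<bar>c j\<bar> * 2 powr (real k - real j)) * bdist z w powr (- (N + real k))"
      by (simp add: sum_distrib_right mult.assoc)
    also have "\<dots> \<le> M * bdist z w powr (- (N + real k))"
      unfolding M_def by (intro mult_right_mono) auto
    finally show "cmod (kernel_deriv N k (hermitian_inner z w)) \<le> M * bdist z w powr (- (N + real k))" .
  qed
qed

text \<open>The expansion has real coefficients, so the symmetry of the kernel powers carries
  over.\<close>

lemma cnj_kernel_deriv:
  fixes z w :: "complex ^ 'n"
  assumes "norm z < 1" "norm w < 1"
  shows "cnj (kernel_deriv N k (hermitian_inner z w)) = kernel_deriv N k (hermitian_inner w z)"
proof -
  obtain c :: "nat \<Rightarrow> real" where "\<forall>x\<in>ball 0 1. kernel_deriv N k x = (\<Sum>j\<le>k. of_real (c j) * kernel_power (N + real j) x)"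
    using kernel_deriv_expansion by blast
  then show ?thesis
    using hermitian_inner_less_one(2)[OF assms] hermitian_inner_less_one(2)[OF assms(2,1)]
    by (simp add: cnj_kernel_power[OF assms])
qed

text \<open>The reproducing formula differentiated k times under the integral sign.\<close>

lemma radial_deriv_iterate:
  fixes b :: "complex ^ 'n \<Rightarrow> complex"
  assumes "\<alpha> > -1" "holomorphic_ball b" "integrable (weighted_measure \<alpha>) b" "norm z < 1"
  shows "(radial_deriv ^^ k) b z
    = (LINT w|weighted_measure \<alpha>. b w * kernel_deriv (real CARD('n) + 1 + \<alpha>) k (hermitian_inner z w))"
  using assms(4)
proof (induction k arbitrary: z)
  case 0
  then show ?case using bergman_reproducing[OF assms(1-3)] by (simp add: bergman_projection_eq)
next
  case (Suc k)
  have "(radial_deriv ^^ Suc k) b z = radial_deriv (\<lambda>z. LINT w|weighted_measure \<alpha>. b w * kernel_deriv (real CARD('n) + 1 + \<alpha>) k (hermitian_inner z w)) z"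
    using Suc by (simp add: radial_deriv_cong[of "(radial_deriv ^^ k) b"])
  also have "\<dots> = (LINT w|weighted_measure \<alpha>. b w * kernel_deriv (real CARD('n) + 1 + \<alpha>) (Suc k) (hermitian_inner z w))"
    using radial_deriv_param_integral[OF assms(3) holomorphic_kernel_deriv Suc.prems] by simp
  finally show ?case .
qed

lemma holomorphic_ball_radial_deriv_iterate:
  fixes b :: "complex ^ 'n \<Rightarrow> complex"
  assumes "\<alpha> > -1" "holomorphic_ball b" "integrable (weighted_measure \<alpha>) b"
  shows "holomorphic_ball ((radial_deriv ^^ k) b)"
proof -
  have h: "holomorphic_ball (\<lambda>z. LINT w|weighted_measure \<alpha>. b w * kernel_deriv (real CARD('n) + 1 + \<alpha>) k (hermitian_inner z w))"
    by (rule holomorphic_ball_param_integral[OF assms(3) holomorphic_kernel_deriv])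
  show ?thesis
    unfolding holomorphic_ball_def
  proof
    fix z assume z: "z \<in> ball (0 :: complex ^ 'n) 1"
    with h obtain D where D: "((\<lambda>z. LINT w|weighted_measure \<alpha>. b w * kernel_deriv (real CARD('n) + 1 + \<alpha>) k (hermitian_inner z w)) has_derivative D) (at z)"
      "\<forall>c v. D (c *s v) = c * D v"
      unfolding holomorphic_ball_def by blast
    have "((radial_deriv ^^ k) b has_derivative D) (at z)"
      by (rule has_derivative_transform_within_open[OF D(1) open_ball z]) (simp add: radial_deriv_iterate[OF assms])
    with D(2) show "\<exists>D. ((radial_deriv ^^ k) b has_derivative D) (at z) \<and> (\<forall>c v. D (c *s v) = c * D v)" by blast
  qed
qed

lemma bergman_orlicz_2D:
  fixes b :: "complex ^ 'n \<Rightarrow> complex"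
  assumes "\<alpha> > -1" "b \<in> bergman_orlicz \<alpha> (\<lambda>t. t\<^sup>2)"
  shows "holomorphic_ball b" "(\<integral>\<^sup>+z. ennreal ((cmod (b z))\<^sup>2) \<partial>weighted_measure \<alpha>) < \<infinity>"
    "b \<in> borel_measurable (weighted_measure \<alpha>)" "integrable (weighted_measure \<alpha>) b"
proof -
  show b: "holomorphic_ball b" "(\<integral>\<^sup>+z. ennreal ((cmod (b z))\<^sup>2) \<partial>weighted_measure \<alpha>) < \<infinity>"
    using assms(2) by (simp_all add: bergman_orlicz_def)
  show m: "b \<in> borel_measurable (weighted_measure \<alpha>)"
    by (intro borel_measurable_weighted_continuous holomorphic_ball_imp_continuous_on b)
  note [measurable] = m
  show "integrable (weighted_measure \<alpha>) b"
  proof (rule integrableI_bounded)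
    have "x \<le> 1 + x\<^sup>2" for x :: real using zero_le_power2[of "x - 1/2"] by (simp add: power2_diff power_divide)
    then have "(\<integral>\<^sup>+z. ennreal (norm (b z)) \<partial>weighted_measure \<alpha>)
        \<le> (\<integral>\<^sup>+z. 1 + ennreal ((cmod (b z))\<^sup>2) \<partial>weighted_measure \<alpha>)"
      by (intro nn_integral_mono) (simp add: ennreal_leI flip: ennreal_1 ennreal_plus)
    also have "\<dots> = 1 + (\<integral>\<^sup>+z. ennreal ((cmod (b z))\<^sup>2) \<partial>weighted_measure \<alpha>)"
      using emeasure_weighted_space[OF assms(1), where 'n='n] by (subst nn_integral_add) simp_all
    also have "\<dots> < \<infinity>" using b(2) by simp
    finally show "(\<integral>\<^sup>+z. ennreal (norm (b z)) \<partial>weighted_measure \<alpha>) < \<infinity>" .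
  qed simp
qed

context growth
begin

text \<open>Functions such as h_b f need not be bounded, so the pointwise estimate does not apply to
  them directly. It is applied to a small multiple of the dilate x \<mapsto> g (x/2), which is
  bounded on the ball; with weight 0 the dilation is a mere change of variables in Lebesgue
  measure.\<close>

lemma origin_estimate:
  fixes \<alpha> :: real
  assumes \<alpha>: "\<alpha> > -1"
  obtains C where "C > 0" "\<And>g :: complex ^ 'n \<Rightarrow> complex. holomorphic_ball g \<Longrightarrow>
    (\<integral>\<^sup>+w. ennreal (\<Phi> (cmod (g w))) \<partial>weighted_measure \<alpha>) \<le> 1 \<Longrightarrow> cmod (g 0) \<le> C"
proof -
  have pe: "\<exists>C>0. \<forall>(f :: complex ^ 'n \<Rightarrow> complex) z. holomorphic_ball f \<longrightarrow> bounded (f ` ball 0 1) \<longrightarrow>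
      (\<integral>\<^sup>+w. ennreal (\<Phi> (cmod (f w))) \<partial>weighted_measure 0) \<le> 1 \<longrightarrow> norm z < 1 \<longrightarrow>
      \<Phi> (cmod (f z)) * (1 - (norm z)\<^sup>2) powr (real CARD('n) + 1 + 0) \<le> C"
  proof (rule pointwise_estimate[of 0, where 'n='n], goal_cases)
    case (2 C)
    then show ?case by (intro exI[of _ C] conjI allI impI 2)
  qed simp
  then obtain C0 where "C0 > 0" and C0': "\<forall>(f :: complex ^ 'n \<Rightarrow> complex) z. holomorphic_ball f \<longrightarrow> bounded (f ` ball 0 1) \<longrightarrow>
      (\<integral>\<^sup>+w. ennreal (\<Phi> (cmod (f w))) \<partial>weighted_measure 0) \<le> 1 \<longrightarrow> norm z < 1 \<longrightarrow>
      \<Phi> (cmod (f z)) * (1 - (norm z)\<^sup>2) powr (real CARD('n) + 1 + 0) \<le> C0" by blast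
  have C0: "C0 > 0" "\<And>(f :: complex ^ 'n \<Rightarrow> complex). holomorphic_ball f \<Longrightarrow> bounded (f ` ball 0 1) \<Longrightarrow>
      (\<integral>\<^sup>+w. ennreal (\<Phi> (cmod (f w))) \<partial>weighted_measure 0) \<le> 1 \<Longrightarrow> \<Phi> (cmod (f 0)) \<le> C0"
    using \<open>C0 > 0\<close> C0'[rule_format, of _ 0] by simp_all
  obtain L where L: "L \<ge> 1" "\<And>s t. 0 \<le> s \<Longrightarrow> 0 \<le> t \<Longrightarrow> t \<le> 1 \<Longrightarrow> \<Phi> (s * t) \<le> L * t powr p * \<Phi> s"
    using lower_type_const by blast
  define c0 where "c0 = weight_const TYPE('n) 0"
  define ca where "ca = weight_const TYPE('n) \<alpha>"
  have c: "c0 > 0" "ca > 0" unfolding c0_def ca_def using \<alpha> by (auto intro!: weight_const_pos)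
  \<comment> \<open>The cost of the dilation: the Jacobian, the lower type constant, and the
    comparison of the weights 0 and \<alpha> on the ball of radius 1/2.\<close>
  define E where "E = 2 ^ DIM(complex ^ 'n) * (c0 * L * (1/2) powr (- \<bar>\<alpha>\<bar>) / ca)"
  have E: "E > 0" using c L by (simp add: E_def)
  \<comment> \<open>By the lower type the factor \<open>t\<close> shrinks the modular by t^p; this
    choice brings it down to at most 1.\<close>
  define t where "t = min 1 (E powr (- (1 / p)))"
  have t: "0 < t" "t \<le> 1" using E by (simp_all add: t_def)
  have tE: "t powr p * E \<le> 1"
  proof -
    have "t powr p \<le> (E powr (- (1 / p))) powr p" using t p by (intro powr_mono2) (auto simp: t_def)
    also have "\<dots> = E powr (- 1)" using p by (simp only: powr_powr) simp
    also have "\<dots> = 1 / E" using E by (simp add: powr_minus_divide)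
    finally show ?thesis using E by (simp add: field_simps)
  qed
  show ?thesis
  proof (rule that[of "\<Psi> C0 / t"])
    show "\<Psi> C0 / t > 0" using psi_pos[OF C0(1)] t by simp
    fix g :: "complex ^ 'n \<Rightarrow> complex"
    assume g: "holomorphic_ball g" and int: "(\<integral>\<^sup>+w. ennreal (\<Phi> (cmod (g w))) \<partial>weighted_measure \<alpha>) \<le> 1"
    define f where "f x = of_real t * g ((1/2) *\<^sub>R x)" for x
    have f: "holomorphic_ball f"
      unfolding holomorphic_ball_def
    proof
      fix z assume "z \<in> ball (0 :: complex ^ 'n) 1"
      then have "(1/2) *\<^sub>R z \<in> ball 0 1" by simp
      then obtain D where D: "(g has_derivative D) (at ((1/2) *\<^sub>R z))" "\<forall>c v. D (c *s v) = c * D v"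
        using g unfolding holomorphic_ball_def by blast
      have "((\<lambda>x. g ((1/2) *\<^sub>R x)) has_derivative (\<lambda>x. D ((1/2) *\<^sub>R x))) (at z)"
        by (rule has_derivative_compose[where f="\<lambda>x. (1/2) *\<^sub>R x" and g=g]) (use D(1) in \<open>auto intro!: derivative_eq_intros\<close>)
      then have "(f has_derivative (\<lambda>x. of_real t * D ((1/2) *\<^sub>R x))) (at z)"
        unfolding f_def[abs_def] by (rule has_derivative_mult_right)
      moreover have "(1/2) *\<^sub>R (c *s v) = c *s ((1/2) *\<^sub>R v)" for c and v :: "complex ^ 'n"
        by (simp add: vec_eq_iff)
      ultimately show "\<exists>D. (f has_derivative D) (at z) \<and> (\<forall>c v. D (c *s v) = c * D v)"
        using D(2) by (intro exI[of _ "\<lambda>x. of_real t * D ((1/2) *\<^sub>R x)"]) simp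
    qed
    have fb: "bounded (f ` ball 0 1)"
    proof -
      have "compact (g ` cball 0 (1/2))"
        by (intro compact_continuous_image continuous_on_subset[OF holomorphic_ball_imp_continuous_on[OF g]]) auto
      then obtain B where B: "\<forall>x\<in>cball 0 (1/2). cmod (g x) \<le> B"
        by (auto dest!: compact_imp_bounded simp: bounded_iff)
      have "cmod (f x) \<le> B" if "x \<in> ball 0 1" for x
      proof -
        have "cmod (f x) \<le> 1 * cmod (g ((1/2) *\<^sub>R x))"
          unfolding f_def norm_mult using t by (intro mult_right_mono) auto
        then show ?thesis using B[rule_format, of "(1/2) *\<^sub>R x"] that by simp
      qed
      then show ?thesis unfolding bounded_iff by (intro exI[of _ B]) auto
    qed
    define G where "G x = indicator (ball 0 1) x * g x" for x
    have [measurable]: "G \<in> borel_measurable borel"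
      unfolding G_def[abs_def] by (rule borel_measurable_holomorphic_ball[OF g])
    have [measurable]: "(\<lambda>x. \<Phi> (cmod (G x))) \<in> borel_measurable borel"
      using borel_measurable_phi_cmod[of G borel 1] by simp
    have fm: "(\<lambda>x. ennreal (\<Phi> (cmod (f x)))) \<in> borel_measurable (weighted_measure 0)"
      by (intro measurable_compose[OF _ measurable_ennreal] borel_measurable_weighted_continuous
        phi_continuous_compose holomorphic_ball_imp_continuous_on f)
    have gm: "(\<lambda>x. ennreal (\<Phi> (cmod (g x)))) \<in> borel_measurable (weighted_measure \<alpha>)"
      by (intro measurable_compose[OF _ measurable_ennreal] borel_measurable_weighted_continuous
        phi_continuous_compose holomorphic_ball_imp_continuous_on g)
    define h where "h x = ennreal (c0 * (L * t powr p * \<Phi> (cmod (G x)))) * indicator (ball 0 (1/2)) x" for x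
    have [measurable]: "ball (0 :: complex ^ 'n) (1/2) \<in> sets borel" by simp
    have [measurable]: "h \<in> borel_measurable borel"
      unfolding h_def[abs_def] by measurable
    have "(\<integral>\<^sup>+x. ennreal (\<Phi> (cmod (f x))) \<partial>weighted_measure 0)
      = (\<integral>\<^sup>+x. ennreal (ball_weight 0 x) * ennreal (\<Phi> (cmod (f x))) * indicator (ball 0 1) x \<partial>lborel)"
      by (rule nn_integral_weighted[OF fm])
    also have "\<dots> \<le> (\<integral>\<^sup>+x. h ((1/2) *\<^sub>R x) \<partial>lborel)"
    proof (rule nn_integral_mono)
      fix x :: "complex ^ 'n"
      show "ennreal (ball_weight 0 x) * ennreal (\<Phi> (cmod (f x))) * indicator (ball 0 1) x \<le> h ((1/2) *\<^sub>R x)"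
      proof (cases "norm x < 1")
        case True
        have "\<Phi> (cmod (f x)) = \<Phi> (cmod (g ((1/2) *\<^sub>R x)) * t)"
          using t by (simp add: f_def norm_mult mult.commute)
        also have "\<dots> \<le> L * t powr p * \<Phi> (cmod (g ((1/2) *\<^sub>R x)))"
          using t by (intro L(2)) auto
        also have "g ((1/2) *\<^sub>R x) = G ((1/2) *\<^sub>R x)" using True by (simp add: G_def)
        finally have "c0 * \<Phi> (cmod (f x)) \<le> c0 * (L * t powr p * \<Phi> (cmod (G ((1/2) *\<^sub>R x))))"
          using c by (intro mult_left_mono) auto
        moreover have "ball_weight 0 x = c0" using norm_lt_1_iff_square[of x] True by (simp add: c0_def)
        ultimately show ?thesis
          using True c by (simp add: h_def phi_nonneg ennreal_leI flip: ennreal_mult)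
      qed simp
    qed
    also have "\<dots> = ennreal (2 ^ DIM(complex ^ 'n)) * (\<integral>\<^sup>+x. h ((1/2) *\<^sub>R (2 *\<^sub>R x)) \<partial>lborel)"
      by (rule nn_integral_lborel_scale) measurable
    also have "(\<integral>\<^sup>+x. h ((1/2) *\<^sub>R (2 *\<^sub>R x)) \<partial>lborel) = (\<integral>\<^sup>+x. h x \<partial>lborel)" by simp
    also have "(\<integral>\<^sup>+x. h x \<partial>lborel) \<le> (\<integral>\<^sup>+x. ennreal (t powr p * (c0 * L * (1/2) powr (- \<bar>\<alpha>\<bar>) / ca))
        * (ennreal (ball_weight \<alpha> x) * ennreal (\<Phi> (cmod (g x))) * indicator (ball 0 1) x) \<partial>lborel)"
    proof (rule nn_integral_mono)
      fix x :: "complex ^ 'n"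
      show "h x \<le> ennreal (t powr p * (c0 * L * (1/2) powr (- \<bar>\<alpha>\<bar>) / ca))
        * (ennreal (ball_weight \<alpha> x) * ennreal (\<Phi> (cmod (g x))) * indicator (ball 0 1) x)"
      proof (cases "norm x < 1/2")
        case True
        define y where "y = 1 - (norm x)\<^sup>2"
        have "(norm x)\<^sup>2 \<le> (1/2)\<^sup>2" using True by (intro power_mono) auto
        then have y: "1/2 \<le> y" "y \<le> 1" by (simp_all add: y_def power_divide)
        \<comment> \<open>Away from the boundary the weight is bounded below; the absolute value
          treats both signs of \<alpha> at once.\<close>
        have "(1/2) powr \<bar>\<alpha>\<bar> \<le> y powr \<alpha>"
        proof (cases "\<alpha> \<ge> 0")
          case True then show ?thesis using y powr_mono2[of \<alpha> "1/2" y] by simp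
        next
          case False
          have "(1/2) powr \<bar>\<alpha>\<bar> \<le> (1::real)" by (rule powr_le1) auto
          also have "1 \<le> y powr \<alpha>" using False y powr_mono2'[of \<alpha> y 1] by simp
          finally show ?thesis .
        qed
        then have "1 \<le> (1/2) powr (- \<bar>\<alpha>\<bar>) * y powr \<alpha>"
          by (simp add: powr_minus_divide pos_le_divide_eq)
        then have "c0 * (L * t powr p * \<Phi> (cmod (g x))) * 1 \<le> c0 * (L * t powr p * \<Phi> (cmod (g x))) * ((1/2) powr (- \<bar>\<alpha>\<bar>) * y powr \<alpha>)"
          using c L by (intro mult_left_mono mult_nonneg_nonneg phi_nonneg) auto
        also have "\<dots> = t powr p * (c0 * L * (1/2) powr (- \<bar>\<alpha>\<bar>) / ca) * (ball_weight \<alpha> x * \<Phi> (cmod (g x)))"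
          using c by (simp add: y_def ca_def)
        finally show ?thesis using True c L
          by (simp add: h_def G_def phi_nonneg ca_def[symmetric] ennreal_leI flip: ennreal_mult)
      qed (simp add: h_def)
    qed
    also have "\<dots> = ennreal (t powr p * (c0 * L * (1/2) powr (- \<bar>\<alpha>\<bar>) / ca)) * (\<integral>\<^sup>+x. ennreal (\<Phi> (cmod (g x))) \<partial>weighted_measure \<alpha>)"
    proof -
      have "(\<lambda>x. ennreal (\<Phi> (cmod (g x))) * indicator (ball 0 1) x) = (\<lambda>x. ennreal (\<Phi> (cmod (G x))) * indicator (ball 0 1) x)"
        by (auto simp: G_def indicator_def)
      then have m: "(\<lambda>x. ennreal (\<Phi> (cmod (g x))) * indicator (ball 0 1) x) \<in> borel_measurable lborel"
        by (simp only:) measurable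
      show ?thesis
        unfolding nn_integral_weighted[OF gm] mult.assoc
        by (rule nn_integral_cmult, rule borel_measurable_times_ennreal[OF _ m]) measurable
    qed
    also have "\<dots> \<le> ennreal (t powr p * (c0 * L * (1/2) powr (- \<bar>\<alpha>\<bar>) / ca)) * 1"
      using int by (intro mult_left_mono) auto
    finally have "(\<integral>\<^sup>+x. ennreal (\<Phi> (cmod (f x))) \<partial>weighted_measure 0)
        \<le> ennreal (2 ^ DIM(complex ^ 'n)) * (ennreal (t powr p * (c0 * L * (1/2) powr (- \<bar>\<alpha>\<bar>) / ca)) * 1)"
      by (simp add: mult_left_mono)
    also have "\<dots> = ennreal (t powr p * E)"
      using c L by (simp add: E_def mult_ac flip: ennreal_mult)
    also have "\<dots> \<le> 1" using tE by simp
    finally have "\<Phi> (cmod (f 0)) \<le> C0" by (intro C0(2) f fb)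
    then have "cmod (f 0) \<le> \<Psi> C0" using C0(1) by (simp add: le_psi_iff)
    then show "cmod (g 0) \<le> \<Psi> C0 / t" using t by (simp add: f_def norm_mult field_simps)
  qed
qed

end

section \<open>Necessity\<close>

lemma forelli_rudin_powr:
  fixes \<alpha> q :: real
  assumes "\<alpha> > -1" "q > real CARD('n::finite) + 1 + \<alpha>"
  obtains C where "C > 0"
    "\<And>z :: complex ^ 'n. norm z < 1 \<Longrightarrow> (\<integral>\<^sup>+w. ennreal (bdist z w powr (- q)) \<partial>weighted_measure \<alpha>)
      \<le> ennreal (C * (1 - (norm z)\<^sup>2) powr (real CARD('n) + 1 + \<alpha> - q))"
proof (rule forelli_rudin[of \<alpha> "q - (real CARD('n) + 1 + \<alpha>)", where 'n='n], goal_cases)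
  case (3 C)
  then show ?case by (intro that[of C]) (simp_all add: algebra_simps)
qed (use assms in auto)

lemma lux_norm_le:
  assumes "r > 0" "(\<integral>\<^sup>+z. ennreal (\<Phi> (cmod (f z) / r)) \<partial>weighted_measure \<alpha>) \<le> 1"
  shows "lux_norm \<alpha> \<Phi> f \<le> ennreal r"
  unfolding lux_norm_def using assms by (intro Inf_lower) blast

lemma lux_norm_lessE:
  assumes "lux_norm \<alpha> \<Phi> f < ennreal s"
  obtains r where "r > 0" "r < s" "(\<integral>\<^sup>+z. ennreal (\<Phi> (cmod (f z) / r)) \<partial>weighted_measure \<alpha>) \<le> 1"
  using assms unfolding lux_norm_def Inf_less_iff by (auto simp: ennreal_less_iff)

lemma hankel_integrand_integrable:
  fixes b f :: "complex ^ 'n \<Rightarrow> complex"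
  assumes "integrable (weighted_measure \<alpha>) b" "holomorphic_ball f" "bounded (f ` ball 0 1)"
  shows "integrable (weighted_measure \<alpha>) (\<lambda>w. b w * cnj (f w))"
proof -
  obtain B where "\<forall>w\<in>ball 0 1. cmod (f w) \<le> B" using assms(3) by (auto simp: bounded_iff)
  then show ?thesis
    using assms(1,2)
    by (intro integrable_weighted_mult[where B=B] continuous_intros holomorphic_ball_imp_continuous_on) auto
qed

lemma holomorphic_ball_small_hankel:
  fixes b f :: "complex ^ 'n \<Rightarrow> complex"
  assumes "integrable (weighted_measure \<alpha>) b" "holomorphic_ball f" "bounded (f ` ball 0 1)"
  shows "holomorphic_ball (small_hankel \<alpha> b f)"
proof -
  have "small_hankel \<alpha> b f = (\<lambda>z. LINT w|weighted_measure \<alpha>. b w * cnj (f w)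
      * kernel_power (real CARD('n) + 1 + \<alpha>) (hermitian_inner z w))"
    by (simp add: small_hankel_def bergman_projection_eq fun_eq_iff)
  then show ?thesis
    using holomorphic_ball_param_integral[OF hankel_integrand_integrable[OF assms] holomorphic_kernel_power]
    by simp
qed

lemma holomorphic_ball_divide:
  assumes "holomorphic_ball f"
  shows "holomorphic_ball (\<lambda>z. f z / c)"
  using holomorphic_ball_mult[OF assms holomorphic_ball_const[of "1 / c"]] by simp

lemma hankel_functional_bound:
  fixes b :: "complex ^ 'n \<Rightarrow> complex"
  assumes \<alpha>: "\<alpha> > -1" and "growth \<Phi>2 p" and b: "integrable (weighted_measure \<alpha>) b"
    and hankel: "hankel_extends_bounded \<alpha> \<Phi>1 \<Phi>2 b"
  obtains B where "B > 0" "\<And>f. holomorphic_ball f \<Longrightarrow> bounded (f ` ball 0 1) \<Longrightarrow>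
    (\<integral>\<^sup>+w. ennreal (\<Phi>1 (cmod (f w))) \<partial>weighted_measure \<alpha>) \<le> 1 \<Longrightarrow>
    cmod (LINT w|weighted_measure \<alpha>. b w * cnj (f w)) \<le> B"
proof -
  interpret growth \<Phi>2 p by fact
  obtain C where C: "\<And>f :: complex ^ 'n \<Rightarrow> complex. holomorphic_ball f \<Longrightarrow> bounded (f ` ball 0 1) \<Longrightarrow>
     lux_norm \<alpha> \<Phi>2 (small_hankel \<alpha> b f) \<le> ennreal C * lux_norm \<alpha> \<Phi>1 f"
    using hankel unfolding hankel_extends_bounded_def by blast
  obtain D where D: "D > 0" "\<And>g :: complex ^ 'n \<Rightarrow> complex. holomorphic_ball g \<Longrightarrow>
    (\<integral>\<^sup>+w. ennreal (\<Phi>2 (cmod (g w))) \<partial>weighted_measure \<alpha>) \<le> 1 \<Longrightarrow> cmod (g 0) \<le> D"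
    using origin_estimate[OF \<alpha>, where 'n='n] by blast
  show ?thesis
  \<comment> \<open>Adding 1 makes the inequality for the norm strict, so that an admissible
    \<open>r\<close> can be taken from the infimum; the modulus covers a negative
    \<open>C\<close>.\<close>
  proof (rule that[of "D * (\<bar>C\<bar> + 1)"])
    show "D * (\<bar>C\<bar> + 1) > 0" using D(1) by (simp add: add_nonneg_pos)
    fix f :: "complex ^ 'n \<Rightarrow> complex"
    assume f: "holomorphic_ball f" "bounded (f ` ball 0 1)"
      and int: "(\<integral>\<^sup>+w. ennreal (\<Phi>1 (cmod (f w))) \<partial>weighted_measure \<alpha>) \<le> 1"
    have "lux_norm \<alpha> \<Phi>1 f \<le> ennreal 1" using int by (intro lux_norm_le) auto
    then have "ennreal C * lux_norm \<alpha> \<Phi>1 f \<le> ennreal C * ennreal 1" by (rule mult_left_mono) simp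
    then have "lux_norm \<alpha> \<Phi>2 (small_hankel \<alpha> b f) \<le> ennreal C"
      using C[OF f] by simp
    also have "\<dots> < ennreal (\<bar>C\<bar> + 1)" by (rule ennreal_lessI) auto
    finally obtain r where r: "r > 0" "r < \<bar>C\<bar> + 1"
      "(\<integral>\<^sup>+z. ennreal (\<Phi>2 (cmod (small_hankel \<alpha> b f z) / r)) \<partial>weighted_measure \<alpha>) \<le> 1"
      by (rule lux_norm_lessE)
    have "cmod (small_hankel \<alpha> b f 0 / of_real r) \<le> D"
      using r by (intro D(2) holomorphic_ball_divide holomorphic_ball_small_hankel b f) (simp add: norm_divide)
    then have "cmod (small_hankel \<alpha> b f 0) \<le> D * r"
      using r(1) by (simp add: norm_divide pos_divide_le_eq)
    also have "\<dots> \<le> D * (\<bar>C\<bar> + 1)" using r D(1) by (intro mult_left_mono) auto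
    finally show "cmod (LINT w|weighted_measure \<alpha>. b w * cnj (f w)) \<le> D * (\<bar>C\<bar> + 1)"
      by (simp add: small_hankel_def bergman_projection_zero)
  qed
qed

context growth
begin

lemma dual_weight_eq:
  "y > 0 \<Longrightarrow> dual_weight \<Phi> (y powr N) = 1 / (y powr N * \<Psi> (y powr (- N)))"
  by (simp add: dual_weight_def \<Psi>_def powr_minus_divide)

text \<open>The bounded functional \<open>f \<mapsto> \<integral> b (cnj f)\<close> is tested on the \<open>k\<close>-fold radial derivatives of the
  kernel at \<open>a\<close>, which reproduce \<open>R\<^sup>k b a\<close>.\<close>

lemma necessity:
  fixes b :: "complex ^ 'n \<Rightarrow> complex"
  assumes \<alpha>: "\<alpha> > -1" and hol: "holomorphic_ball b" and b: "integrable (weighted_measure \<alpha>) b"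
    and "B > 0" and bound: "\<And>f. holomorphic_ball f \<Longrightarrow> bounded (f ` ball 0 1) \<Longrightarrow>
      (\<integral>\<^sup>+w. ennreal (\<Phi> (cmod (f w))) \<partial>weighted_measure \<alpha>) \<le> 1 \<Longrightarrow>
      cmod (LINT w|weighted_measure \<alpha>. b w * cnj (f w)) \<le> B"
  shows "b \<in> Gamma_space \<alpha> (1 / p - 1) (dual_weight \<Phi>)"
proof -
  define N where "N = real CARD('n) + 1 + \<alpha>"
  have N: "N > 0" using \<alpha> by (simp add: N_def add_pos_nonneg)
  obtain k :: nat where k: "real k > (1 / p - 1) * N" using reals_Archimedean2 by blast
  define q where "q = p * (N + real k)"
  have q: "q > N" using k p by (simp add: q_def field_simps)
  obtain F where F: "F > 0" "\<And>z :: complex ^ 'n. norm z < 1 \<Longrightarrow>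
      (\<integral>\<^sup>+w. ennreal (bdist z w powr (- q)) \<partial>weighted_measure \<alpha>) \<le> ennreal (F * (1 - (norm z)\<^sup>2) powr (N - q))"
    using forelli_rudin_powr[OF \<alpha>, where 'n='n, of q] q unfolding N_def by blast
  obtain M where M: "M > 0" "\<And>z w :: complex ^ 'n. norm z < 1 \<Longrightarrow> norm w < 1 \<Longrightarrow>
    cmod (kernel_deriv N k (hermitian_inner z w)) \<le> M * bdist z w powr (- (N + real k))"
    using kernel_deriv_bound[where 'n='n, of N k] by blast
  obtain L where L: "L \<ge> 1" "\<And>s t. 0 \<le> s \<Longrightarrow> 0 \<le> t \<Longrightarrow> t \<le> 1 \<Longrightarrow> \<Phi> (s * t) \<le> L * t powr p * \<Phi> s"
    using lower_type_const by blast
  \<comment> \<open>The first entry keeps the factor \<open>t\<close> below at most 1, as the lower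
    type demands; the second makes the modular of the test function at most 1.\<close>
  define d where "d = min (2 powr (- (N + real k))) ((L * F) powr (- (1 / p)))"
  have d: "d > 0" using L F by (simp add: d_def)
  have dp: "L * d powr p * F \<le> 1"
  proof -
    have "d powr p \<le> ((L * F) powr (- (1 / p))) powr p" using d p by (intro powr_mono2) (auto simp: d_def)
    also have "\<dots> = (L * F) powr (- 1)" using p by (simp only: powr_powr) simp
    also have "\<dots> = 1 / (L * F)" using L F by (simp add: powr_minus_divide)
    finally show ?thesis using L F by (simp add: field_simps)
  qed
  have main: "cmod ((radial_deriv ^^ k) b a) \<le> B * M / d * (1 - (norm a)\<^sup>2) powr (- real k) * dual_weight \<Phi> ((1 - (norm a)\<^sup>2) powr N)"
    if a: "norm a < 1" for a
  proof -
    define x where "x = 1 - (norm a)\<^sup>2"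
    have x: "x > 0" using norm_lt_1_iff_square[of a] a by (simp add: x_def)
    define S where "S = \<Psi> (x powr (- N))"
    have S: "S > 0" unfolding S_def using x by (intro psi_pos) simp
    \<comment> \<open>With this factor |f w| \<le> S t, where t = d (x / bdist a w)^(N + k) and
      \<Phi> S = x^(-N). The lower type bounds \<Phi> |f w| by L t^p x^(-N), which the Forelli-Rudin
      estimate integrates at exponent q = p (N + k).\<close>
    define r where "r = d / M * S * x powr (N + real k)"
    have r: "r > 0" using d M S x by (simp add: r_def)
    define f where "f w = of_real r * kernel_deriv N k (hermitian_inner w a)" for w
    have f: "holomorphic_ball f"
      unfolding f_def by (intro holomorphic_ball_mult holomorphic_ball_const holomorphic_ball_inner holomorphic_kernel_deriv a)
    have fle: "cmod (f w) \<le> S * (d * (x powr (N + real k) * bdist a w powr (- (N + real k))))" if w: "norm w < 1" for w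
    proof -
      have "cmod (f w) \<le> r * (M * bdist w a powr (- (N + real k)))"
        unfolding f_def norm_mult using M(2)[OF w a] r by (intro mult_mono) auto
      also have "\<dots> = S * (d * (x powr (N + real k) * bdist a w powr (- (N + real k))))"
        using M(1) by (simp add: r_def bdist_commute[of w a])
      finally show ?thesis .
    qed
    have t_le: "d * (x powr (N + real k) * bdist a w powr (- (N + real k))) \<le> 1" if w: "norm w < 1" for w
    proof -
      have bp: "bdist a w > 0" using bdist_pos[OF a w] .
      have "x powr (N + real k) \<le> (2 * bdist a w) powr (N + real k)"
        using bdist_ge_square(1)[OF a w] x N by (intro powr_mono2) (auto simp: x_def)
      also have "\<dots> = 2 powr (N + real k) * bdist a w powr (N + real k)" using bp by (simp add: powr_mult)
      finally have "x powr (N + real k) * bdist a w powr (- (N + real k)) \<le> 2 powr (N + real k) * bdist a w powr (N + real k) * bdist a w powr (- (N + real k))"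
        by (rule mult_right_mono) simp
      also have "\<dots> = 2 powr (N + real k) * (bdist a w powr (N + real k) * bdist a w powr (- (N + real k)))"
        by (rule mult.assoc)
      also have "bdist a w powr (N + real k) * bdist a w powr (- (N + real k)) = 1"
        using bp by (simp flip: powr_add)
      finally have le: "x powr (N + real k) * bdist a w powr (- (N + real k)) \<le> 2 powr (N + real k) * 1" .
      have "d * (x powr (N + real k) * bdist a w powr (- (N + real k))) \<le> 2 powr (- (N + real k)) * (2 powr (N + real k) * 1)"
        by (rule mult_mono[OF _ le]) (auto simp: d_def)
      also have "\<dots> = 1" by (simp flip: powr_add)
      finally show ?thesis .
    qed
    have bdd: "bounded (f ` ball 0 1)"
    proof -
      have "cmod (f w) \<le> S * 1" if w: "norm w < 1" for w
        by (rule order_trans[OF fle[OF w] mult_left_mono[OF t_le[OF w] less_imp_le[OF S]]])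
      then show ?thesis unfolding bounded_iff by (intro exI[of _ "S * 1"]) auto
    qed
    have phif: "\<Phi> (cmod (f w)) \<le> L * d powr p * x powr (q - N) * bdist a w powr (- q)" if w: "norm w < 1" for w
    proof -
      define t where "t = d * (x powr (N + real k) * bdist a w powr (- (N + real k)))"
      have t: "0 \<le> t" "t \<le> 1" using t_le[OF w] d by (simp_all add: t_def)
      have bp: "bdist a w > 0" using bdist_pos[OF a w] .
      have "\<Phi> (cmod (f w)) \<le> \<Phi> (S * t)" using fle[OF w] by (intro phi_mono) (auto simp: t_def)
      also have "\<dots> \<le> L * t powr p * \<Phi> S" using S t by (intro L(2)) auto
      also have "\<Phi> S = x powr (- N)" unfolding S_def by (rule phi_psi) simp
      also have "t powr p = d powr p * (x powr q * bdist a w powr (- q))"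
        using d x bp by (simp add: t_def powr_mult powr_powr q_def algebra_simps)
      also have "L * (d powr p * (x powr q * bdist a w powr (- q))) * x powr (- N)
          = L * d powr p * (x powr q * x powr (- N)) * bdist a w powr (- q)" by (simp only: mult_ac)
      also have "x powr q * x powr (- N) = x powr (q - N)" by (simp flip: powr_add)
      finally show ?thesis .
    qed
    have "(\<integral>\<^sup>+w. ennreal (\<Phi> (cmod (f w))) \<partial>weighted_measure \<alpha>)
      \<le> (\<integral>\<^sup>+w. ennreal (L * d powr p * x powr (q - N)) * ennreal (bdist a w powr (- q)) \<partial>weighted_measure \<alpha>)"
      using phif L by (intro nn_integral_mono) (simp add: ennreal_leI flip: ennreal_mult)
    also have "\<dots> = ennreal (L * d powr p * x powr (q - N)) * (\<integral>\<^sup>+w. ennreal (bdist a w powr (- q)) \<partial>weighted_measure \<alpha>)"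
      by (intro nn_integral_cmult borel_measurable_weightedI) measurable
    also have "\<dots> \<le> ennreal (L * d powr p * x powr (q - N)) * ennreal (F * x powr (N - q))"
      using F(2)[OF a] by (intro mult_left_mono) (simp_all add: x_def)
    also have "\<dots> = ennreal (L * d powr p * F * (x powr (q - N) * x powr (N - q)))"
      using L F by (simp add: mult_ac flip: ennreal_mult)
    also have "x powr (q - N) * x powr (N - q) = 1" using x by (simp flip: powr_add)
    also have "ennreal (L * d powr p * F * 1) \<le> 1" using dp by simp
    finally have "cmod (LINT w|weighted_measure \<alpha>. b w * cnj (f w)) \<le> B"
      by (intro bound f bdd)
    also have "(LINT w|weighted_measure \<alpha>. b w * cnj (f w))
      = (LINT w|weighted_measure \<alpha>. of_real r * (b w * kernel_deriv N k (hermitian_inner a w)))"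
      by (intro Bochner_Integration.integral_cong) (simp_all add: f_def cnj_kernel_deriv a)
    also have "\<dots> = of_real r * (radial_deriv ^^ k) b a"
      unfolding radial_deriv_iterate[OF \<alpha> hol b a] N_def by (rule integral_mult_right_zero)
    finally have "cmod ((radial_deriv ^^ k) b a) \<le> B / r"
      using r by (simp add: norm_mult field_simps)
    \<comment> \<open>Undoing the normalisation: 1 / (x^N S) is the dual weight, and the remaining
      x^(-k) is the price of k derivatives.\<close>
    also have "B / r = B * M / d * x powr (- real k) * dual_weight \<Phi> (x powr N)"
    proof -
      have "dual_weight \<Phi> (x powr N) = 1 / (x powr N * S)" unfolding S_def by (rule dual_weight_eq[OF x])
      then show ?thesis using x d M(1) S by (simp add: r_def powr_add powr_minus field_simps)
    qed
    finally show ?thesis by (simp add: x_def)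
  qed
  have "\<exists>C>0. \<forall>z\<in>ball 0 1. cmod ((radial_deriv ^^ k) b z) \<le> C * (1 - (norm z)\<^sup>2) powr (- real k) * dual_weight \<Phi> ((1 - (norm z)\<^sup>2) powr N)"
    using main \<open>B > 0\<close> M(1) d by (intro exI[of _ "B * M / d"]) auto
  then show ?thesis
    unfolding Gamma_space_def using hol k by (auto simp: N_def)
qed

end

section \<open>Sufficiency\<close>

text \<open>For a non-integrable \<open>f\<close> both sides take the default value 0, so the
  identity needs no case distinction where it is applied.\<close>

lemma lebesgue_integral_weighted:
  fixes f :: "complex ^ 'n \<Rightarrow> complex"
  assumes "f \<in> borel_measurable (weighted_measure \<alpha>)"
  shows "(LINT x|weighted_measure \<alpha>. f x) = (LINT x|lborel. indicator (ball 0 1) x * (of_real (ball_weight \<alpha> x) * f x))"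
proof (cases "integrable (weighted_measure \<alpha>) f")
  case True
  from has_bochner_integral_integrable[OF this]
  show ?thesis
    unfolding has_bochner_integral_weighted_iff[OF assms] by (rule has_bochner_integral_integral_eq[symmetric])
next
  case False
  have "\<not> integrable lborel (\<lambda>x. indicator (ball 0 1) x * (of_real (ball_weight \<alpha> x) * f x))"
    using False has_bochner_integral_weighted_iff[OF assms] unfolding has_bochner_integral_iff by blast
  then show ?thesis
    by (subst not_integrable_integral_eq[OF False], subst not_integrable_integral_eq) auto
qed

lemma integral_weighted_shift:
  fixes f :: "complex ^ 'n \<Rightarrow> complex"
  assumes "\<alpha> > -1" "\<alpha> + t > -1" and f: "f \<in> borel_measurable (weighted_measure \<alpha>)"
  shows "(LINT x|weighted_measure (\<alpha> + t). f x) = (LINT x|weighted_measure \<alpha>.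
    of_real (weight_const TYPE('n) (\<alpha> + t) / weight_const TYPE('n) \<alpha> * (1 - (norm x)\<^sup>2) powr t) * f x)"
proof -
  have f': "f \<in> borel_measurable (weighted_measure (\<alpha> + t))"
    using f unfolding measurable_cong_sets[OF sets_weighted_measure refl] .
  have "(\<lambda>x. of_real (weight_const TYPE('n) (\<alpha> + t) / weight_const TYPE('n) \<alpha> * (1 - (norm x)\<^sup>2) powr t) :: complex)
      \<in> borel_measurable (weighted_measure \<alpha> :: (complex ^ 'n) measure)"
    by (rule borel_measurable_weightedI) measurable
  then have m: "(\<lambda>x. of_real (weight_const TYPE('n) (\<alpha> + t) / weight_const TYPE('n) \<alpha> * (1 - (norm x)\<^sup>2) powr t) * f x)
      \<in> borel_measurable (weighted_measure \<alpha>)"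
    using f by (rule borel_measurable_times)
  have c: "weight_const TYPE('n) \<alpha> > 0" by (rule weight_const_pos[OF assms(1)])
  have e: "ball_weight \<alpha> x * (weight_const TYPE('n) (\<alpha> + t) / weight_const TYPE('n) \<alpha> * (1 - (norm x)\<^sup>2) powr t)
      = ball_weight (\<alpha> + t) x" for x :: "complex ^ 'n"
    using c by (simp add: powr_add)
  show ?thesis
    unfolding lebesgue_integral_weighted[OF f'] lebesgue_integral_weighted[OF m] mult.assoc[symmetric] of_real_mult[symmetric] e[symmetric]
    by (simp only: mult.assoc)
qed

lemma nn_integral_weight_powr:
  assumes "\<alpha> > -1" "\<alpha> - e > -1"
  shows "(\<integral>\<^sup>+w. ennreal ((1 - (norm (w :: complex ^ 'n))\<^sup>2) powr (- e)) \<partial>weighted_measure \<alpha>) < \<infinity>"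
proof -
  have "(\<integral>\<^sup>+w. 1 * ennreal ((1 - (norm (w :: complex ^ 'n))\<^sup>2) powr (- e)) \<partial>weighted_measure \<alpha>)
    = ennreal (weight_const TYPE('n) \<alpha> / weight_const TYPE('n) (\<alpha> + - e))
      * (\<integral>\<^sup>+w. 1 \<partial>(weighted_measure (\<alpha> + - e) :: (complex ^ 'n) measure))"
    using assms by (intro nn_integral_weighted_shift) auto
  also have "\<dots> < \<infinity>"
    using emeasure_weighted_space[of "\<alpha> + - e", where 'n='n] assms by (simp add: ennreal_mult_less_top)
  finally show ?thesis by simp
qed

text \<open>Fubini's theorem and the reproducing formula for the weight \<open>\<alpha> + t\<close>.\<close>

lemma kernel_pairing:
  fixes u V :: "complex ^ 'n \<Rightarrow> complex"
  assumes \<alpha>: "\<alpha> > -1" and t: "t \<ge> 0" and e: "0 < e" "e < \<alpha> + t + 1"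
    and u: "u \<in> borel_measurable (weighted_measure \<alpha>)"
    and ufin: "(\<integral>\<^sup>+w. ennreal (cmod (u w) * (1 - (norm w)\<^sup>2) powr (- e)) \<partial>weighted_measure \<alpha>) < \<infinity>"
    and V: "holomorphic_ball V" "bounded (V ` ball 0 1)"
  defines "N \<equiv> real CARD('n) + 1 + \<alpha>"
  shows "(LINT w|weighted_measure (\<alpha> + t). (LINT x|weighted_measure \<alpha>. u x * kernel_power (N + t) (hermitian_inner w x)) * cnj (V w))
    = (LINT x|weighted_measure \<alpha>. u x * cnj (V x))"
proof -
  have \<beta>: "\<alpha> + t > -1" using \<alpha> t by simp
  define M1 where "M1 = (weighted_measure \<alpha> :: (complex ^ 'n) measure)"
  define M2 where "M2 = (weighted_measure (\<alpha> + t) :: (complex ^ 'n) measure)"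
  interpret M1: finite_measure M1 unfolding M1_def by (rule finite_measure_weighted[OF \<alpha>])
  interpret M2: finite_measure M2 unfolding M2_def by (rule finite_measure_weighted[OF \<beta>])
  interpret P: pair_sigma_finite M1 M2 ..
  have [measurable]: "(\<lambda>x. x) \<in> borel_measurable M1" "(\<lambda>x. x) \<in> borel_measurable M2"
    unfolding M1_def M2_def by (rule borel_measurable_weighted_ident)+
  have [simp]: "space M1 = ball 0 1" "space M2 = ball 0 1" by (simp_all add: M1_def M2_def)
  have [measurable]: "u \<in> borel_measurable M1" using u by (simp add: M1_def)
  have [measurable]: "V \<in> borel_measurable M2"
    unfolding M2_def by (intro borel_measurable_weighted_continuous holomorphic_ball_imp_continuous_on V)
  \<comment> \<open>Cut off to the unit disc, the kernel is Borel as a function of one complex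
    variable, hence jointly measurable in w and x after composition.\<close>
  define H where "H x = indicator (ball 0 1) x * kernel_power (N + t) x" for x
  have [measurable]: "H \<in> borel_measurable borel"
    using borel_measurable_continuous_on_indicator[OF _ holomorphic_on_imp_continuous_on[OF holomorphic_kernel_power[of "N + t"]]]
    unfolding H_def[abs_def] indicator_scaleR by simp
  have H: "H (hermitian_inner w x) = kernel_power (N + t) (hermitian_inner w x)" if "norm w < 1" "norm x < 1" for w x :: "complex ^ 'n"
    using hermitian_inner_less_one(2)[OF that] by (simp add: H_def)
  define f where "f x w = u x * H (hermitian_inner w x) * cnj (V w)" for x w
  obtain B where "\<forall>w\<in>ball 0 1. cmod (V w) \<le> B" using V(2) by (auto simp: bounded_iff)
  then have B: "\<And>w. norm w < 1 \<Longrightarrow> cmod (V w) \<le> B" by simp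
  then have "B \<ge> 0" using order_trans[OF norm_ge_zero, of "V 0" B] by simp
  obtain C where C: "C > 0" "\<And>z :: complex ^ 'n. norm z < 1 \<Longrightarrow>
      (\<integral>\<^sup>+w. ennreal (bdist z w powr (- (real CARD('n) + 1 + (\<alpha> + t)))) * ennreal ((1 - (norm w)\<^sup>2) powr (- e)) \<partial>weighted_measure (\<alpha> + t))
      \<le> ennreal (C * (1 - (norm z)\<^sup>2) powr (- e))"
    using schur_bound[OF \<beta> e, where 'n='n] by blast
  have int: "integrable (M1 \<Otimes>\<^sub>M M2) (case_prod f)"
  proof (rule integrableI_bounded)
    show fm: "case_prod f \<in> borel_measurable (M1 \<Otimes>\<^sub>M M2)"
      unfolding f_def[abs_def] by measurable
    have "(\<integral>\<^sup>+p. ennreal (norm (case_prod f p)) \<partial>(M1 \<Otimes>\<^sub>M M2)) = (\<integral>\<^sup>+x. (\<integral>\<^sup>+w. ennreal (norm (f x w)) \<partial>M2) \<partial>M1)"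
      using fm by (subst M2.nn_integral_fst[symmetric]) (simp_all add: case_prod_beta')
    also have "\<dots> \<le> (\<integral>\<^sup>+x. ennreal (B * C) * ennreal (cmod (u x) * (1 - (norm x)\<^sup>2) powr (- e)) \<partial>M1)"
    proof (rule nn_integral_mono)
      fix x assume "x \<in> space M1"
      then have x: "norm x < 1" by simp
      have "(\<integral>\<^sup>+w. ennreal (norm (f x w)) \<partial>M2)
        \<le> (\<integral>\<^sup>+w. ennreal (cmod (u x) * B) * (ennreal (bdist x w powr (- (real CARD('n) + 1 + (\<alpha> + t)))) * ennreal ((1 - (norm w)\<^sup>2) powr (- e))) \<partial>M2)"
      proof (rule nn_integral_mono)
        fix w assume "w \<in> space M2"
        then have w: "norm w < 1" by simp
        have y: "0 < 1 - (norm w)\<^sup>2" "1 - (norm w)\<^sup>2 \<le> 1" using norm_lt_1_iff_square[of w] w by auto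
        \<comment> \<open>A factor at least 1 is inserted to bring the integrand into the form of
          the Schur bound, which, unlike the plain kernel integral at the critical exponent, gives a
          power of 1 - |x|^2.\<close>
        have "1 \<le> (1 - (norm w)\<^sup>2) powr (- e)"
          using powr_mono2'[of "- e" "1 - (norm w)\<^sup>2" 1] y e by simp
        then have "bdist x w powr (- (N + t)) * 1 \<le> bdist x w powr (- (N + t)) * (1 - (norm w)\<^sup>2) powr (- e)"
          by (intro mult_left_mono) auto
        moreover have "norm (f x w) = cmod (u x) * cmod (V w) * bdist x w powr (- (N + t))"
          by (simp add: f_def H[OF w x] norm_mult cmod_kernel_power bdist_commute[of w x])
        moreover have "\<dots> \<le> cmod (u x) * B * (bdist x w powr (- (N + t)) * (1 - (norm w)\<^sup>2) powr (- e))"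
          using B[OF w] \<open>B \<ge> 0\<close> calculation(1) by (intro mult_mono mult_left_mono mult_nonneg_nonneg) auto
        ultimately have "norm (f x w) \<le> cmod (u x) * B * (bdist x w powr (- (real CARD('n) + 1 + (\<alpha> + t))) * (1 - (norm w)\<^sup>2) powr (- e))"
          by (simp add: N_def add_ac)
        then show "ennreal (norm (f x w)) \<le> ennreal (cmod (u x) * B) * (ennreal (bdist x w powr (- (real CARD('n) + 1 + (\<alpha> + t)))) * ennreal ((1 - (norm w)\<^sup>2) powr (- e)))"
          using \<open>B \<ge> 0\<close> by (simp only: ennreal_mult[symmetric] mult_nonneg_nonneg powr_ge_zero norm_ge_zero ennreal_leI)
      qed
      also have "\<dots> = ennreal (cmod (u x) * B) * (\<integral>\<^sup>+w. ennreal (bdist x w powr (- (real CARD('n) + 1 + (\<alpha> + t)))) * ennreal ((1 - (norm w)\<^sup>2) powr (- e)) \<partial>M2)"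
        by (rule nn_integral_cmult) measurable
      also have "\<dots> \<le> ennreal (cmod (u x) * B) * ennreal (C * (1 - (norm x)\<^sup>2) powr (- e))"
        using C(2)[OF x] by (intro mult_left_mono) (simp_all add: M2_def)
      also have "\<dots> = ennreal (B * C) * ennreal (cmod (u x) * (1 - (norm x)\<^sup>2) powr (- e))"
        using \<open>B \<ge> 0\<close> C(1) by (simp add: mult_ac flip: ennreal_mult)
      finally show "(\<integral>\<^sup>+w. ennreal (norm (f x w)) \<partial>M2) \<le> ennreal (B * C) * ennreal (cmod (u x) * (1 - (norm x)\<^sup>2) powr (- e))" .
    qed
    also have "\<dots> = ennreal (B * C) * (\<integral>\<^sup>+x. ennreal (cmod (u x) * (1 - (norm x)\<^sup>2) powr (- e)) \<partial>M1)"
      by (rule nn_integral_cmult) measurable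
    also have "\<dots> < \<infinity>" using ufin by (simp add: M1_def ennreal_mult_less_top)
    finally show "(\<integral>\<^sup>+p. ennreal (norm (case_prod f p)) \<partial>(M1 \<Otimes>\<^sub>M M2)) < \<infinity>" .
  qed
  have "(LINT w|M2. (LINT x|M1. u x * kernel_power (N + t) (hermitian_inner w x)) * cnj (V w)) = (LINT w|M2. LINT x|M1. f x w)"
  proof (rule Bochner_Integration.integral_cong)
    fix w assume "w \<in> space M2"
    then have w: "norm w < 1" by simp
    have "(LINT x|M1. f x w) = (LINT x|M1. u x * kernel_power (N + t) (hermitian_inner w x) * cnj (V w))"
      by (intro Bochner_Integration.integral_cong) (simp_all add: f_def H w)
    then show "(LINT x|M1. u x * kernel_power (N + t) (hermitian_inner w x)) * cnj (V w) = (LINT x|M1. f x w)"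
      by (simp only: integral_mult_left_zero)
  qed simp
  also have "\<dots> = (LINT x|M1. LINT w|M2. f x w)" by (rule P.Fubini_integral[OF int])
  \<comment> \<open>With the order of integration reversed, the inner integral is the conjugate of
    the reproducing formula for \<open>V\<close> at \<open>x\<close>.\<close>
  also have "\<dots> = (LINT x|M1. u x * cnj (V x))"
  proof (rule Bochner_Integration.integral_cong)
    fix x assume "x \<in> space M1"
    then have x: "norm x < 1" by simp
    have "(LINT w|M2. f x w) = (LINT w|M2. u x * cnj (V w * kernel_power (N + t) (hermitian_inner x w)))"
      by (intro Bochner_Integration.integral_cong) (simp_all add: f_def H x cnj_kernel_power mult_ac)
    also have "\<dots> = u x * cnj (LINT w|M2. V w * kernel_power (N + t) (hermitian_inner x w))"
      by (simp only: integral_mult_right_zero Bochner_Integration.integral_cnj)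
    also have "(LINT w|M2. V w * kernel_power (N + t) (hermitian_inner x w)) = bergman_projection (\<alpha> + t) V x"
      by (simp add: bergman_projection_eq M2_def N_def add_ac)
    also have "\<dots> = V x" by (rule bergman_reproducing[OF \<beta> V(1) integrable_weighted_holomorphic[OF \<beta> V] x])
    finally show "(LINT w|M2. f x w) = u x * cnj (V x)" .
  qed simp
  finally show ?thesis by (simp add: M1_def M2_def)
qed

section \<open>From weak type to the Orlicz modular\<close>

context growth
begin

text \<open>Layer formula: above a level s, \<Phi> is \<Phi>(s) plus the integral of its derivative,
  and the derivative at t times the distribution bound at A t is of order C1 \<Phi>(t) / (A t^2). As
  \<Phi>(t)/t^2 is not integrable at 0, small values are treated apart: \<Phi>(s) \<le> 1/2 and
  total mass 1 give at most 1/2, and a large \<open>A\<close> makes the rest at most 1/2.\<close>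

lemma weak_type_orlicz:
  fixes \<alpha> C1 :: real
  assumes \<alpha>: "\<alpha> > -1" and "C1 > 0"
    and dini: "(\<integral>\<^sup>+ t\<in>{1..}. ennreal (\<Phi> t / t\<^sup>2) \<partial>lborel) < \<infinity>"
  obtains A where "A > 0" "\<And>h :: complex ^ 'n \<Rightarrow> complex. h \<in> borel_measurable (weighted_measure \<alpha>) \<Longrightarrow>
    (\<And>l. l > 0 \<Longrightarrow> ennreal l * emeasure (weighted_measure \<alpha>) {z \<in> ball 0 1. l < cmod (h z)} \<le> ennreal C1) \<Longrightarrow>
    (\<integral>\<^sup>+z. ennreal (\<Phi> (cmod (h z) / A)) \<partial>weighted_measure \<alpha>) \<le> 1"
proof -
  obtain c \<Phi>' where d: "0 < c" "continuous_on {0<..} \<Phi>'" "\<And>t. t > 0 \<Longrightarrow> (\<Phi> has_real_derivative \<Phi>' t) (at t)"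
    "\<And>t. t > 0 \<Longrightarrow> c * (\<Phi> t / t) \<le> \<Phi>' t" "\<And>t. t > 0 \<Longrightarrow> \<Phi>' t \<le> inverse c * (\<Phi> t / t)"
    using phi_derivative by auto
  define s where "s = min 1 (\<Psi> (1/2))"
  have s: "0 < s" "s \<le> 1" using psi_pos[of "1/2"] by (simp_all add: s_def)
  have "\<Phi> s \<le> \<Phi> (\<Psi> (1/2))" using s by (intro phi_mono) (auto simp: s_def)
  then have phis: "\<Phi> s \<le> 1/2" by (simp add: phi_psi)
  \<comment> \<open>Freezing the derivative below \<open>s\<close> makes it continuous on the whole
    line, hence Borel; only arguments from \<open>s\<close> on are used.\<close>
  define D where "D t = \<Phi>' (max s t)" for t
  have D_nonneg: "D t \<ge> 0" for t
  proof -
    have "max s t > 0" using s by simp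
    then have "0 \<le> c * (\<Phi> (max s t) / max s t)" using d(1) phi_nonneg[of "max s t"] by simp
    then show ?thesis using d(4)[OF \<open>max s t > 0\<close>] by (simp add: D_def)
  qed
  have "continuous_on UNIV D"
    unfolding D_def using s by (intro continuous_on_compose2[OF d(2)] continuous_intros) auto
  then have [measurable]: "D \<in> borel_measurable borel" by (rule borel_measurable_continuous_onI)
  have [measurable]: "(\<lambda>t. \<Phi> (max 0 t)) \<in> borel_measurable borel"
    by (rule borel_measurable_continuous_onI, rule continuous_on_compose2[OF phi_cont]) (auto intro!: continuous_intros)
  define J where "J = (\<integral>\<^sup>+t\<in>{s..}. ennreal (\<Phi> (max 0 t) / t\<^sup>2) \<partial>lborel)"
  have "J < \<infinity>"
  proof -
    have "J \<le> (\<integral>\<^sup>+t. ennreal (\<Phi> 1 / s\<^sup>2) * indicator {s..1} t + ennreal (\<Phi> (max 0 t) / t\<^sup>2) * indicator {1..} t \<partial>lborel)"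
      unfolding J_def
    proof (rule nn_integral_mono)
      fix t :: real
      show "ennreal (\<Phi> (max 0 t) / t\<^sup>2) * indicator {s..} t
         \<le> ennreal (\<Phi> 1 / s\<^sup>2) * indicator {s..1} t + ennreal (\<Phi> (max 0 t) / t\<^sup>2) * indicator {1..} t"
      proof (cases "s \<le> t \<and> t \<le> 1")
        case True
        then have "\<Phi> (max 0 t) / t\<^sup>2 \<le> \<Phi> 1 / s\<^sup>2"
          using s by (intro frac_le phi_mono phi_nonneg power_mono) auto
        then show ?thesis using True by (simp add: ennreal_leI add_increasing2)
      qed (auto simp: indicator_def)
    qed
    also have "\<dots> = ennreal (\<Phi> 1 / s\<^sup>2) * emeasure lborel {s..1} + (\<integral>\<^sup>+t\<in>{1..}. ennreal (\<Phi> (max 0 t) / t\<^sup>2) \<partial>lborel)"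
      by (subst nn_integral_add) (simp_all add: nn_integral_cmult_indicator)
    also have "(\<integral>\<^sup>+t\<in>{1..}. ennreal (\<Phi> (max 0 t) / t\<^sup>2) \<partial>lborel) = (\<integral>\<^sup>+t\<in>{1..}. ennreal (\<Phi> t / t\<^sup>2) \<partial>lborel)"
      by (intro nn_integral_cong) (auto simp: indicator_def)
    also have "ennreal (\<Phi> 1 / s\<^sup>2) * emeasure lborel {s..1} + (\<integral>\<^sup>+t\<in>{1..}. ennreal (\<Phi> t / t\<^sup>2) \<partial>lborel) < \<infinity>"
      using dini s by (simp add: ennreal_mult_less_top)
    finally show ?thesis .
  qed
  then obtain j where j: "j \<ge> 0" "J = ennreal j" by (cases J) auto
  \<comment> \<open>Solves 2 C1 j / (A c) \<le> 1/2; the summand 1 keeps \<open>A\<close> positive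
    without a lower bound on \<open>j\<close>.\<close>
  define A where "A = 4 * C1 * j / c + 1"
  have A: "A > 0" "2 * C1 / (A * c) * j \<le> 1/2"
  proof -
    have "4 * C1 * j / c \<ge> 0" using assms(2) j d(1) by simp
    then show "A > 0" by (simp add: A_def)
    have "4 * C1 * j / c \<le> A" by (simp add: A_def)
    then show "2 * C1 / (A * c) * j \<le> 1/2" using \<open>A > 0\<close> d(1) by (simp add: field_simps)
  qed
  show ?thesis
  proof (rule that[OF A(1)])
    fix h :: "complex ^ 'n \<Rightarrow> complex"
    assume h: "h \<in> borel_measurable (weighted_measure \<alpha>)"
      and weak: "\<And>l. l > 0 \<Longrightarrow> ennreal l * emeasure (weighted_measure \<alpha>) {z \<in> ball 0 1. l < cmod (h z)} \<le> ennreal C1"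
    define M where "M = (weighted_measure \<alpha> :: (complex ^ 'n) measure)"
    interpret finite_measure M unfolding M_def by (rule finite_measure_weighted[OF \<alpha>])
    interpret P: pair_sigma_finite lborel M ..
    have [simp]: "space M = ball 0 1" by (simp add: M_def)
    have [measurable]: "h \<in> borel_measurable M" using h by (simp add: M_def)
    define I where "I t z = ennreal (D t) * (if s \<le> t \<and> A * t \<le> cmod (h z) then 1 else 0)" for t z
    have [measurable]: "case_prod I \<in> borel_measurable (lborel \<Otimes>\<^sub>M M)"
      unfolding I_def[abs_def] by measurable
    have bound: "ennreal (\<Phi> (cmod (h z) / A)) \<le> ennreal (1/2) + (\<integral>\<^sup>+t. I t z \<partial>lborel)" for z
    proof (cases "cmod (h z) / A \<le> s")
      case True
      then have "\<Phi> (cmod (h z) / A) \<le> \<Phi> s" using A(1) by (intro phi_mono) auto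
      then have "ennreal (\<Phi> (cmod (h z) / A)) \<le> ennreal (1/2)" using phis by (intro ennreal_leI) simp
      then show ?thesis by (simp add: add_increasing2)
    next
      case False
      define v where "v = cmod (h z) / A"
      have v: "s < v" using False by (simp add: v_def)
      have "(\<integral>\<^sup>+t. ennreal (D t) * indicator {s..v} t \<partial>lborel) = ennreal (\<Phi> v - \<Phi> s)"
      proof (rule nn_integral_FTC_Icc[where F=\<Phi>])
        fix t assume "t \<in> {s..v}"
        then show "(\<Phi> has_real_derivative D t) (at t)"
          using d(3)[of t] s by (simp add: D_def max_def)
      qed (use v D_nonneg in auto)
      moreover have "ennreal (D t) * indicator {s..v} t = I t z" for t
        using A(1) by (auto simp: I_def v_def indicator_def field_simps)
      ultimately have eq: "(\<integral>\<^sup>+t. I t z \<partial>lborel) = ennreal (\<Phi> v - \<Phi> s)" by simp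
      have "\<Phi> s \<le> \<Phi> v" using s v by (intro phi_mono) auto
      have "ennreal (\<Phi> v) \<le> ennreal (1/2 + (\<Phi> v - \<Phi> s))"
        using phis by (intro ennreal_leI) simp
      also have "\<dots> = ennreal (1/2) + ennreal (\<Phi> v - \<Phi> s)"
        using \<open>\<Phi> s \<le> \<Phi> v\<close> by (intro ennreal_plus) auto
      finally show ?thesis by (simp add: eq v_def)
    qed
    have "(\<integral>\<^sup>+z. ennreal (\<Phi> (cmod (h z) / A)) \<partial>M) \<le> (\<integral>\<^sup>+z. ennreal (1/2) + (\<integral>\<^sup>+t. I t z \<partial>lborel) \<partial>M)"
      using bound by (intro nn_integral_mono)
    also have "\<dots> = ennreal (1/2) + (\<integral>\<^sup>+z. (\<integral>\<^sup>+t. I t z \<partial>lborel) \<partial>M)"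
      using emeasure_weighted_space[OF \<alpha>, where 'n='n]
      by (subst nn_integral_add) (simp_all add: M_def[symmetric])
    also have "(\<integral>\<^sup>+z. (\<integral>\<^sup>+t. I t z \<partial>lborel) \<partial>M) = (\<integral>\<^sup>+t. (\<integral>\<^sup>+z. I t z \<partial>M) \<partial>lborel)"
      by (rule P.Fubini') measurable
    also have "\<dots> \<le> (\<integral>\<^sup>+t. ennreal (2 * C1 / (A * c)) * (ennreal (\<Phi> (max 0 t) / t\<^sup>2) * indicator {s..} t) \<partial>lborel)"
    proof (rule nn_integral_mono)
      fix t :: real
      show "(\<integral>\<^sup>+z. I t z \<partial>M) \<le> ennreal (2 * C1 / (A * c)) * (ennreal (\<Phi> (max 0 t) / t\<^sup>2) * indicator {s..} t)"
      proof (cases "s \<le> t")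
        case True
        then have t: "t > 0" using s by simp
        \<comment> \<open>The layer is given by the closed condition A t \<le> |h|, the weak bound
          by a strict one; halving the level bridges the gap at the cost of a factor 2.\<close>
        define l where "l = A * t / 2"
        have l: "l > 0" "l < A * t" using A(1) t by (simp_all add: l_def)
        define E where "E = {z \<in> space M. l < cmod (h z)}"
        have [measurable]: "E \<in> sets M" unfolding E_def by measurable
        have "(\<integral>\<^sup>+z. I t z \<partial>M) \<le> (\<integral>\<^sup>+z. ennreal (D t) * indicator E z \<partial>M)"
          using True l by (intro nn_integral_mono) (auto simp: I_def E_def indicator_def)
        also have "\<dots> = ennreal (D t) * emeasure M E" by (rule nn_integral_cmult_indicator) measurable
        also have "\<dots> \<le> ennreal (\<Phi> t / (c * t)) * ennreal (C1 / l)"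
        proof (rule mult_mono)
          show "ennreal (D t) \<le> ennreal (\<Phi> t / (c * t))"
            using d(5)[OF t] True by (intro ennreal_leI) (simp add: D_def max_absorb2 field_simps)
          have "ennreal (l * measure M E) \<le> ennreal C1"
            using weak[OF l(1)] l(1) by (simp add: E_def M_def[symmetric] emeasure_eq_measure ennreal_mult)
          then have "l * measure M E \<le> C1" using assms(2) by (simp add: ennreal_le_iff)
          then have "measure M E \<le> C1 / l" using l(1) by (simp add: field_simps)
          then show "emeasure M E \<le> ennreal (C1 / l)" by (simp add: emeasure_eq_measure ennreal_leI)
        qed auto
        also have "\<dots> = ennreal (2 * C1 / (A * c)) * ennreal (\<Phi> (max 0 t) / t\<^sup>2)"
          using t A(1) d(1) assms(2) phi_nonneg[of t]
          by (subst (1 2) ennreal_mult[symmetric]) (auto simp: l_def power2_eq_square max_absorb2 field_simps)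
        finally show ?thesis using True by simp
      qed (simp add: I_def)
    qed
    also have "\<dots> = ennreal (2 * C1 / (A * c)) * J"
      unfolding J_def by (rule nn_integral_cmult) measurable
    also have "\<dots> = ennreal (2 * C1 / (A * c) * j)"
      unfolding j(2) using A(1) assms(2) d(1) j(1) by (intro ennreal_mult[symmetric]) auto
    also have "\<dots> \<le> ennreal (1/2)"
      using A(2) by (rule ennreal_leI)
    finally have "(\<integral>\<^sup>+z. ennreal (\<Phi> (cmod (h z) / A)) \<partial>M) \<le> ennreal (1/2) + ennreal (1/2)"
      by (simp add: add_left_mono)
    also have "\<dots> = 1" by (subst ennreal_plus[symmetric]) simp_all
    finally show "(\<integral>\<^sup>+z. ennreal (\<Phi> (cmod (h z) / A)) \<partial>weighted_measure \<alpha>) \<le> 1" by (simp add: M_def)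
  qed
qed

end

lemma has_field_derivative_ray:
  assumes D: "(f has_derivative D) (at (c *s z))" "\<And>a v. D (a *s v) = a * D v" and "c \<noteq> 0"
  shows "((\<lambda>c. f (c *s z)) has_field_derivative radial_deriv f (c *s z) / c) (at c)"
proof -
  have "bounded_linear (\<lambda>c. c *s z)"
    by (rule linear_conv_bounded_linear[THEN iffD1], rule linearI) (simp_all add: vec_eq_iff algebra_simps)
  then have "((\<lambda>c. c *s z) has_derivative (\<lambda>c. c *s z)) (at c)"
    by (rule bounded_linear_imp_has_derivative)
  then have d: "((\<lambda>c. f (c *s z)) has_derivative (\<lambda>c. D (c *s z))) (at c)"
    by (rule has_derivative_compose[where f="\<lambda>c. c *s z" and g=f]) (rule D(1))
  have "radial_deriv f (c *s z) = c * D z" using radial_deriv_eq[OF D] by (simp add: D(2))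
  then have "(\<lambda>c. D (c *s z)) = (*) (radial_deriv f (c *s z) / c)"
    using \<open>c \<noteq> 0\<close> by (simp add: fun_eq_iff D(2))
  then show ?thesis using d by (simp only: has_field_derivative_def)
qed

section \<open>Growth of the symbol and its lower derivatives\<close>

context growth
begin

text \<open>The growth allowed to R^k b in the Gamma space, as a function of x = 1 - |z|^2.\<close>

definition symbol_weight :: "real \<Rightarrow> nat \<Rightarrow> real \<Rightarrow> real" where
  "symbol_weight N k x = x powr (- real k) * dual_weight \<Phi> (x powr N)"

lemma symbol_weight_eq:
  "x > 0 \<Longrightarrow> symbol_weight N k x = x powr (- (real k + N)) / \<Psi> (x powr (- N))"
  unfolding symbol_weight_def by (simp only: dual_weight_eq) (simp add: powr_diff powr_minus field_simps)

lemma symbol_weight_pos: "x > 0 \<Longrightarrow> symbol_weight N k x > 0"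
  using psi_pos[of "x powr (- N)"] by (simp add: symbol_weight_eq)

text \<open>When x decreases to x', the \<Psi> in the denominator grows by at most K (x/x')^(N/p),
  while the power in front grows by (x/x')^(k + N). The order condition says N/p < k + N.\<close>

lemma symbol_weight_decreasing:
  assumes N: "N > 0" and k: "real k > (1 / p - 1) * N"
  obtains K where "K \<ge> 1" "\<And>x x'. 0 < x' \<Longrightarrow> x' \<le> x \<Longrightarrow> symbol_weight N k x \<le> K * symbol_weight N k x'"
proof -
  obtain K where K: "K \<ge> 1" "\<And>u v. 0 < u \<Longrightarrow> u \<le> v \<Longrightarrow> \<Psi> v \<le> K * (v / u) powr (1 / p) * \<Psi> u"
    using psi_upper_type by blast
  show ?thesis
  proof (rule that[OF K(1)])
    fix x x' :: real assume x: "0 < x'" "x' \<le> x"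
    define u where "u = x powr (- N)"
    define v where "v = x' powr (- N)"
    have uv: "0 < u" "u \<le> v" using x N by (auto simp: u_def v_def intro!: powr_mono2')
    have pos: "\<Psi> u > 0" "\<Psi> v > 0" using uv by (auto intro!: psi_pos)
    have "v / u = (x / x') powr N" using x by (simp add: u_def v_def powr_minus powr_divide field_simps)
    then have "(v / u) powr (1 / p) = (x / x') powr (N / p)" by (simp add: powr_powr)
    also have "\<dots> \<le> (x / x') powr (real k + N)"
      using x k p by (intro powr_mono) (auto simp: field_simps)
    also have "\<dots> = x powr (real k + N) / x' powr (real k + N)" using x by (simp add: powr_divide)
    finally have "K * (v / u) powr (1 / p) * \<Psi> u \<le> K * (x powr (real k + N) / x' powr (real k + N)) * \<Psi> u"
      using K(1) pos by (intro mult_right_mono mult_left_mono) auto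
    then have "\<Psi> v \<le> K * (x powr (real k + N) / x' powr (real k + N)) * \<Psi> u"
      using K(2)[OF uv] by (rule order_trans[rotated])
    then have "1 / x powr (real k + N) / \<Psi> u \<le> K * (1 / x' powr (real k + N) / \<Psi> v)"
      using pos x by (simp add: field_simps)
    then show "symbol_weight N k x \<le> K * symbol_weight N k x'"
      using symbol_weight_eq[OF x(1), of N k] symbol_weight_eq[OF less_le_trans[OF x], of N k]
      by (simp only: u_def v_def powr_minus_divide)
  qed
qed

text \<open>The dual weight is \<Phi>(s)/s at s = \<Psi>(x^(-N)), and s \<ge> \<Psi>(1); the
  quotient is non-increasing.\<close>

lemma dual_weight_bounded:
  assumes "0 < x" "x \<le> 1" "N > 0"
  shows "dual_weight \<Phi> (x powr N) \<le> 1 / \<Psi> 1"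
proof -
  define s where "s = \<Psi> (x powr (- N))"
  have x: "1 \<le> x powr (- N)" using assms powr_mono2'[of "- N" x 1] by simp
  have s: "\<Psi> 1 \<le> s" "\<Psi> 1 > 0" unfolding s_def using x by (auto intro!: psi_mono psi_pos)
  have "dual_weight \<Phi> (x powr N) = 1 / (x powr N * s)" unfolding s_def by (rule dual_weight_eq[OF assms(1)])
  also have "\<dots> = \<Phi> s / s" unfolding s_def using assms by (simp add: phi_psi powr_minus field_simps)
  also have "\<dots> \<le> \<Phi> (\<Psi> 1) / \<Psi> 1" using s by (intro phi_quotient)
  finally show ?thesis by (simp add: phi_psi)
qed

text \<open>Integration along the ray from z/2 to z, on which the weight is at most K times its
  value at \<open>z\<close>. The order of the weight is kept rather than improved, which suffices
  for the representation of the symbol.\<close>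

lemma radial_deriv_lower_order:
  fixes u :: "complex ^ 'n \<Rightarrow> complex"
  assumes N: "N > 0" and k: "real k > (1 / p - 1) * N" and u: "holomorphic_ball u"
    and "C \<ge> 0" and C: "\<And>z. norm z < 1 \<Longrightarrow> cmod (radial_deriv u z) \<le> C * symbol_weight N k (1 - (norm z)\<^sup>2)"
  shows "\<exists>C'\<ge>0. \<forall>z. norm z < 1 \<longrightarrow> cmod (u z) \<le> C' * symbol_weight N k (1 - (norm z)\<^sup>2)"
proof -
  obtain K where K: "K \<ge> 1" "\<And>x x'. 0 < x' \<Longrightarrow> x' \<le> x \<Longrightarrow> symbol_weight N k x \<le> K * symbol_weight N k x'"
    using symbol_weight_decreasing[OF N k] by blast
  have "compact (u ` cball 0 (1/2))"
    by (intro compact_continuous_image continuous_on_subset[OF holomorphic_ball_imp_continuous_on[OF u]]) auto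
  then obtain B where B: "\<forall>x\<in>cball 0 (1/2). cmod (u x) \<le> B"
    by (auto dest!: compact_imp_bounded simp: bounded_iff)
  then have "B \<ge> 0" using order_trans[OF norm_ge_zero, of "u 0" B] by simp
  have W1: "symbol_weight N k 1 > 0" by (rule symbol_weight_pos) simp
  show ?thesis
  \<comment> \<open>\<open>B\<close> bounds \<open>u\<close> on the ball of radius 1/2, and K over
    the weight at 1 converts it into a multiple of the weight; C K comes from the ray.\<close>
  proof (intro exI[of _ "B * K / symbol_weight N k 1 + C * K"] conjI allI impI)
    show "0 \<le> B * K / symbol_weight N k 1 + C * K" using \<open>B \<ge> 0\<close> K(1) W1 \<open>C \<ge> 0\<close> by simp
    fix z :: "complex ^ 'n" assume z: "norm z < 1"
    define W where "W = symbol_weight N k (1 - (norm z)\<^sup>2)"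
    have y: "0 < 1 - (norm z)\<^sup>2" using norm_lt_1_iff_square[of z] z by simp
    have "W > 0" unfolding W_def by (rule symbol_weight_pos[OF y])
    \<comment> \<open>Starting at 1/2 and not at 0 keeps the divisor \<open>c\<close>, which the
      derivative along the ray carries, away from 0.\<close>
    define S where "S = closed_segment (1/2 :: complex) 1"
    have S: "cmod c \<le> 1" "1/2 \<le> cmod c" if "c \<in> S" for c
    proof -
      have "\<exists>t. 0 \<le> t \<and> t \<le> 1 \<and> c = (1 - t) *\<^sub>R (1/2) + t *\<^sub>R 1"
        using that unfolding S_def by (simp only: in_segment)
      then obtain t where t: "0 \<le> t" "t \<le> 1" "c = (1 - t) *\<^sub>R (1/2) + t *\<^sub>R 1"
        by (elim exE conjE)
      have "c = of_real ((1 - t) * (1/2) + t)" unfolding t(3) by (simp add: scaleR_conv_of_real)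
      then have "cmod c = \<bar>(1 - t) * (1/2) + t\<bar>" by (simp only: norm_of_real)
      moreover have "(1 - t) * (1/2) + t = (1 + t) / 2" by (simp add: field_simps)
      ultimately have "cmod c = \<bar>(1 + t) / 2\<bar>" by (simp only:)
      then have "cmod c = (1 + t) / 2" using t(1) by simp
      then show "cmod c \<le> 1" "1/2 \<le> cmod c" using t by auto
    qed
    have "cmod (u (1 *s z) - u ((1/2) *s z)) \<le> 2 * (C * (K * W)) * cmod (1 - 1/2)"
    proof (rule field_differentiable_bound[where S=S])
      show "convex S" unfolding S_def by simp
      fix c assume c: "c \<in> S"
      have "norm (c *s z) \<le> 1 * norm z" unfolding norm_vec_scale using S[OF c] by (intro mult_right_mono) auto
      then have cz: "norm (c *s z) \<le> norm z" by simp
      then have cz1: "c *s z \<in> ball 0 1" using z by simp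
      then obtain D where D: "(u has_derivative D) (at (c *s z))" "\<forall>a v. D (a *s v) = a * D v"
        using u unfolding holomorphic_ball_def by blast
      have "c \<noteq> 0" using S[OF c] by auto
      with D have "((\<lambda>c. u (c *s z)) has_field_derivative radial_deriv u (c *s z) / c) (at c)"
        by (intro has_field_derivative_ray) auto
      then show "((\<lambda>c. u (c *s z)) has_field_derivative radial_deriv u (c *s z) / c) (at c within S)"
        by (rule has_field_derivative_at_within)
      have "(norm (c *s z))\<^sup>2 \<le> (norm z)\<^sup>2" using cz by (intro power_mono) auto
      then have "symbol_weight N k (1 - (norm (c *s z))\<^sup>2) \<le> K * W"
        unfolding W_def using y by (intro K(2)) auto
      then have "cmod (radial_deriv u (c *s z)) \<le> C * (K * W)"
        using C[of "c *s z"] cz1 \<open>C \<ge> 0\<close> by (meson mult_left_mono mem_ball_0 order_trans)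
      then have "cmod (radial_deriv u (c *s z)) * (1 / cmod c) \<le> C * (K * W) * 2"
        using S[OF c] \<open>C \<ge> 0\<close> K(1) \<open>W > 0\<close> \<open>c \<noteq> 0\<close> by (intro mult_mono) (auto simp: field_simps)
      then show "cmod (radial_deriv u (c *s z) / c) \<le> 2 * (C * (K * W))"
        by (simp add: norm_divide mult.commute)
    qed (simp_all add: S_def)
    moreover have "cmod (1 - 1/2) = 1/2" by (simp add: norm_divide)
    ultimately have "cmod (u z - u ((1/2) *s z)) \<le> C * K * W" by (simp add: mult.assoc)
    moreover have "cmod (u ((1/2) *s z)) \<le> B" using B z by (simp add: norm_vec_scale norm_divide)
    ultimately have "cmod (u z) \<le> B + C * K * W"
      using norm_triangle_ineq2[of "u z" "u ((1/2) *s z)"] by linarith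
    moreover have "B * 1 \<le> B * (K / symbol_weight N k 1 * W)"
    proof (intro mult_left_mono)
      have "symbol_weight N k 1 \<le> K * W" unfolding W_def using y by (intro K(2)) auto
      then show "1 \<le> K / symbol_weight N k 1 * W" using W1 by (simp add: field_simps)
    qed (rule \<open>B \<ge> 0\<close>)
    moreover have "(B * K / symbol_weight N k 1 + C * K) * W = B * (K / symbol_weight N k 1 * W) + C * K * W"
      by (simp add: distrib_right)
    ultimately have "cmod (u z) \<le> (B * K / symbol_weight N k 1 + C * K) * W" by linarith
    then show "cmod (u z) \<le> (B * K / symbol_weight N k 1 + C * K) * symbol_weight N k (1 - (norm z)\<^sup>2)"
      by (simp only: W_def)
  qed
qed

lemma radial_deriv_iterate_bound:
  fixes b :: "complex ^ 'n \<Rightarrow> complex"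
  assumes \<alpha>: "\<alpha> > -1" and b: "holomorphic_ball b" "integrable (weighted_measure \<alpha>) b"
    and N: "N > 0" and k: "real k > (1 / p - 1) * N"
    and "C \<ge> 0" and C: "\<And>z. norm z < 1 \<Longrightarrow> cmod ((radial_deriv ^^ k) b z) \<le> C * symbol_weight N k (1 - (norm z)\<^sup>2)"
    and "j \<le> k"
  shows "\<exists>C'\<ge>0. \<forall>z. norm z < 1 \<longrightarrow> cmod ((radial_deriv ^^ j) b z) \<le> C' * symbol_weight N k (1 - (norm z)\<^sup>2)"
  using \<open>j \<le> k\<close>
proof (induction rule: inc_induct)
  case base
  show ?case using C \<open>C \<ge> 0\<close> by blast
next
  case (step i)
  then obtain C' where C': "C' \<ge> 0"
    "\<And>z. norm z < 1 \<Longrightarrow> cmod (radial_deriv ((radial_deriv ^^ i) b) z) \<le> C' * symbol_weight N k (1 - (norm z)\<^sup>2)"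
    by auto
  show ?case
    by (rule radial_deriv_lower_order[OF N k holomorphic_ball_radial_deriv_iterate[OF \<alpha> b] C'])
qed

text \<open>Here \<open>g\<close> is the weight \<open>(1 - \<bar>z\<bar>\<^sup>2)\<^sup>k\<close> times a differential operator of order \<open>k\<close> applied
  to \<open>b\<close>.\<close>

lemma symbol_representation:
  fixes b :: "complex ^ 'n \<Rightarrow> complex"
  assumes \<alpha>: "\<alpha> > -1" and b: "b \<in> bergman_orlicz \<alpha> (\<lambda>t. t\<^sup>2)"
    and Gamma: "b \<in> Gamma_space \<alpha> (1 / p - 1) (dual_weight \<Phi>)"
  defines "N \<equiv> real CARD('n) + 1 + \<alpha>"
  obtains g C where "C > 0" "g \<in> borel_measurable (weighted_measure \<alpha>)"
    "\<And>z. norm z < 1 \<Longrightarrow> cmod (g z) \<le> C * dual_weight \<Phi> ((1 - (norm z)\<^sup>2) powr N)"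
    "\<And>z. norm z < 1 \<Longrightarrow> (LINT w|weighted_measure \<alpha>. g w * kernel_power N (hermitian_inner z w)) = b z"
proof -
  have N: "N > 0" using \<alpha> by (simp add: N_def add_pos_nonneg)
  note b2 = bergman_orlicz_2D[OF \<alpha> b]
  obtain k :: nat and C0 where k: "real k > (1 / p - 1) * N" and "C0 > 0" and
    "\<And>z. z \<in> ball 0 1 \<Longrightarrow> cmod ((radial_deriv ^^ k) b z) \<le> C0 * (1 - (norm z)\<^sup>2) powr (- real k) * dual_weight \<Phi> ((1 - (norm z)\<^sup>2) powr N)"
    using Gamma unfolding Gamma_space_def N_def by blast
  then have C0: "C0 \<ge> 0" "\<And>z. norm z < 1 \<Longrightarrow> cmod ((radial_deriv ^^ k) b z) \<le> C0 * symbol_weight N k (1 - (norm z)\<^sup>2)"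
    by (simp_all add: symbol_weight_def mult.assoc)
  have "\<forall>j\<in>{..k}. \<exists>C'\<ge>0. \<forall>z. norm z < 1 \<longrightarrow> cmod ((radial_deriv ^^ j) b z) \<le> C' * symbol_weight N k (1 - (norm z)\<^sup>2)"
    using radial_deriv_iterate_bound[OF \<alpha> b2(1,4) N k C0] by blast
  then obtain Cj where Cj: "\<forall>j\<in>{..k}. Cj j \<ge> 0 \<and> (\<forall>z. norm z < 1 \<longrightarrow> cmod ((radial_deriv ^^ j) b z) \<le> Cj j * symbol_weight N k (1 - (norm z)\<^sup>2))"
    by metis
  obtain a :: "nat \<Rightarrow> real" where a: "\<forall>x\<in>ball 0 1. kernel_power (N + real k) x = (\<Sum>j\<le>k. of_real (a j) * kernel_deriv N j x)"
    using kernel_power_expansion[OF N] by blast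
  define D where "D z = (LINT w|weighted_measure \<alpha>. b w * kernel_power (N + real k) (hermitian_inner z w))" for z
  have D_hol: "holomorphic_ball D"
    unfolding D_def by (rule holomorphic_ball_param_integral[OF b2(4) holomorphic_kernel_power])
  define C1 where "C1 = (\<Sum>j\<le>k. \<bar>a j\<bar> * Cj j)"
  have D_bound: "cmod (D z) \<le> C1 * symbol_weight N k (1 - (norm z)\<^sup>2)" if z: "norm z < 1" for z
  proof -
    have i: "integrable (weighted_measure \<alpha>) (\<lambda>w. b w * kernel_deriv N j (hermitian_inner z w))" for j
      by (rule integrable_weighted_inner[OF b2(4) holomorphic_kernel_deriv z])
    have "D z = (LINT w|weighted_measure \<alpha>. (\<Sum>j\<le>k. of_real (a j) * (b w * kernel_deriv N j (hermitian_inner z w))))"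
      unfolding D_def using a hermitian_inner_less_one(2)[OF z]
      by (intro Bochner_Integration.integral_cong) (simp_all add: sum_distrib_left mult_ac)
    also have "\<dots> = (\<Sum>j\<le>k. (LINT w|weighted_measure \<alpha>. of_real (a j) * (b w * kernel_deriv N j (hermitian_inner z w))))"
      by (intro Bochner_Integration.integral_sum integrable_mult_right i)
    also have "\<dots> = (\<Sum>j\<le>k. of_real (a j) * (radial_deriv ^^ j) b z)"
      using radial_deriv_iterate[OF \<alpha> b2(1,4) z] by (simp only: integral_mult_right_zero N_def)
    finally have "cmod (D z) \<le> (\<Sum>j\<le>k. \<bar>a j\<bar> * cmod ((radial_deriv ^^ j) b z))"
      by (simp add: sum_norm_le norm_mult)
    also have "\<dots> \<le> (\<Sum>j\<le>k. \<bar>a j\<bar> * (Cj j * symbol_weight N k (1 - (norm z)\<^sup>2)))"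
      using Cj z by (intro sum_mono mult_left_mono) auto
    finally show ?thesis by (simp add: C1_def sum_distrib_right mult.assoc)
  qed
  have "C1 \<ge> 0" unfolding C1_def using Cj by (intro sum_nonneg) auto
  \<comment> \<open>The ratio of the normalising constants: \<open>g\<close> times the measure of
    weight \<alpha> is then \<open>D\<close> times the measure of weight \<alpha> + k.\<close>
  define c where "c = weight_const TYPE('n) (\<alpha> + real k) / weight_const TYPE('n) \<alpha>"
  have "c > 0" unfolding c_def using \<alpha> by (intro divide_pos_pos weight_const_pos) auto
  define g where "g w = of_real (c * (1 - (norm w)\<^sup>2) powr real k) * D w" for w
  have D_meas: "D \<in> borel_measurable (weighted_measure \<alpha>)"
    by (intro borel_measurable_weighted_continuous holomorphic_ball_imp_continuous_on D_hol)
  have "(\<lambda>w. of_real (c * (1 - (norm w)\<^sup>2) powr real k) :: complex) \<in> borel_measurable (weighted_measure \<alpha> :: (complex ^ 'n) measure)"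
    by (rule borel_measurable_weightedI) measurable
  then have g_meas: "g \<in> borel_measurable (weighted_measure \<alpha>)"
    unfolding g_def[abs_def] using D_meas by (rule borel_measurable_times)
  have g_bound: "cmod (g z) \<le> (c * C1 + 1) * dual_weight \<Phi> ((1 - (norm z)\<^sup>2) powr N)" if z: "norm z < 1" for z
  proof -
    define y where "y = 1 - (norm z)\<^sup>2"
    have y: "y > 0" using norm_lt_1_iff_square[of z] z by (simp add: y_def)
    have "cmod (g z) = c * y powr real k * cmod (D z)"
      using \<open>c > 0\<close> by (simp add: g_def norm_mult y_def)
    also have "\<dots> \<le> c * y powr real k * (C1 * symbol_weight N k y)"
      using D_bound[OF z] \<open>c > 0\<close> by (intro mult_left_mono) (auto simp: y_def)
    also have "\<dots> = c * C1 * dual_weight \<Phi> (y powr N) * (y powr real k * y powr (- real k))"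
      by (simp add: symbol_weight_def)
    also have "y powr real k * y powr (- real k) = 1" using y by (simp flip: powr_add)
    also have "c * C1 * dual_weight \<Phi> (y powr N) * 1 = c * C1 * dual_weight \<Phi> (y powr N)" by simp
    also have "\<dots> \<le> (c * C1 + 1) * dual_weight \<Phi> (y powr N)"
      using symbol_weight_pos[OF y, of N 0] y by (intro mult_right_mono) (auto simp: symbol_weight_def)
    finally show ?thesis by (simp add: y_def)
  qed
  have repr: "(LINT w|weighted_measure \<alpha>. g w * kernel_power N (hermitian_inner z w)) = b z" if z: "norm z < 1" for z
  proof -
    \<comment> \<open>Half the usual exponent: \<open>b\<close> is only square integrable, so the
      product is split by 2xy \<le> x^2 + y^2 and the power -2e of 1 - |w|^2 must still be
      integrable.\<close>
    define e where "e = (\<alpha> + 1) / 4"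
    have e: "0 < e" "e < \<alpha> + real k + 1" "2 * e < \<alpha> + 1" using \<alpha> by (simp_all add: e_def)
    define V where "V w = kernel_power N (hermitian_inner w z)" for w
    have V: "holomorphic_ball V" unfolding V_def by (rule holomorphic_ball_inner[OF holomorphic_kernel_power z])
    obtain BV where BV: "\<And>w. norm w < 1 \<Longrightarrow> cmod (kernel_power N (hermitian_inner z w)) \<le> BV"
      using inner_compose_bounded[OF holomorphic_kernel_power z] by blast
    have Vcnj: "cnj (V w) = kernel_power N (hermitian_inner z w)" if "norm w < 1" for w
      unfolding V_def by (rule cnj_kernel_power[OF that z])
    have "cmod (V w) \<le> BV" if "norm w < 1" for w
      using BV[OF that] Vcnj[OF that] by (metis complex_mod_cnj)
    then have Vb: "bounded (V ` ball 0 1)" unfolding bounded_iff by (intro exI[of _ BV]) auto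
    have fin: "(\<integral>\<^sup>+w. ennreal (cmod (b w) * (1 - (norm w)\<^sup>2) powr (- e)) \<partial>weighted_measure \<alpha>) < \<infinity>"
    proof -
      have m: "(\<lambda>w :: complex ^ 'n. ennreal ((1 - (norm w)\<^sup>2) powr (- (2 * e)))) \<in> borel_measurable (weighted_measure \<alpha>)"
        by (rule borel_measurable_weightedI) measurable
      have m2: "(\<lambda>w. ennreal ((cmod (b w))\<^sup>2)) \<in> borel_measurable (weighted_measure \<alpha>)"
        using b2(3) by measurable
      have "(\<integral>\<^sup>+w. ennreal (cmod (b w) * (1 - (norm w)\<^sup>2) powr (- e)) \<partial>weighted_measure \<alpha>)
        \<le> (\<integral>\<^sup>+w. ennreal ((cmod (b w))\<^sup>2) + ennreal ((1 - (norm w)\<^sup>2) powr (- (2 * e))) \<partial>weighted_measure \<alpha>)"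
      proof (rule nn_integral_mono)
        fix w :: "complex ^ 'n"
        define y where "y = (1 - (norm w)\<^sup>2) powr (- e)"
        have "y\<^sup>2 = (1 - (norm w)\<^sup>2) powr (- (2 * e))" by (simp add: y_def power2_eq_square flip: powr_add)
        moreover have "2 * (cmod (b w) * y) \<le> (cmod (b w))\<^sup>2 + y\<^sup>2"
          using zero_le_power2[of "cmod (b w) - y"] by (simp add: power2_diff)
        moreover have "0 \<le> cmod (b w) * y" by (simp add: y_def)
        ultimately have "cmod (b w) * y \<le> (cmod (b w))\<^sup>2 + (1 - (norm w)\<^sup>2) powr (- (2 * e))" by linarith
        then show "ennreal (cmod (b w) * (1 - (norm w)\<^sup>2) powr (- e)) \<le> ennreal ((cmod (b w))\<^sup>2) + ennreal ((1 - (norm w)\<^sup>2) powr (- (2 * e)))"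
          by (simp add: y_def ennreal_leI flip: ennreal_plus)
      qed
      also have "\<dots> = (\<integral>\<^sup>+w. ennreal ((cmod (b w))\<^sup>2) \<partial>weighted_measure \<alpha>) + (\<integral>\<^sup>+w. ennreal ((1 - (norm w)\<^sup>2) powr (- (2 * e))) \<partial>(weighted_measure \<alpha> :: (complex ^ 'n) measure))"
        by (rule nn_integral_add[OF m2 m])
      also have "\<dots> < \<infinity>"
        using b2(2) nn_integral_weight_powr[of \<alpha> "2 * e", where 'n='n] \<alpha> e by simp
      finally show ?thesis .
    qed
    have DV_meas: "(\<lambda>w. D w * cnj (V w)) \<in> borel_measurable (weighted_measure \<alpha>)"
      by (intro borel_measurable_weighted_continuous continuous_intros holomorphic_ball_imp_continuous_on D_hol V)
    have "(LINT w|weighted_measure \<alpha>. g w * kernel_power N (hermitian_inner z w))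
      = (LINT w|weighted_measure \<alpha>. of_real (weight_const TYPE('n) (\<alpha> + real k) / weight_const TYPE('n) \<alpha> * (1 - (norm w)\<^sup>2) powr real k) * (D w * cnj (V w)))"
      by (intro Bochner_Integration.integral_cong) (simp_all add: g_def c_def Vcnj)
    also have "\<dots> = (LINT w|weighted_measure (\<alpha> + real k). D w * cnj (V w))"
      using \<alpha> by (intro integral_weighted_shift[symmetric] DV_meas) auto
    \<comment> \<open>The pairing formula with t = k: \<open>D\<close> is the integral of
      \<open>b\<close> against the kernel of weight \<alpha> + k, and that kernel reproduces
      \<open>V\<close>.\<close>
    also have "\<dots> = (LINT w|weighted_measure \<alpha>. b w * cnj (V w))"
      unfolding D_def N_def using \<alpha> by (intro kernel_pairing[where e=e] e b2(3) fin V Vb) auto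
    also have "\<dots> = (LINT w|weighted_measure \<alpha>. b w * kernel_power N (hermitian_inner z w))"
      by (intro Bochner_Integration.integral_cong) (simp_all add: Vcnj)
    also have "\<dots> = bergman_projection \<alpha> b z" by (simp add: bergman_projection_eq N_def)
    also have "\<dots> = b z" by (rule bergman_reproducing[OF \<alpha> b2(1,4) z])
    finally show ?thesis .
  qed
  show ?thesis
    by (rule that[of "c * C1 + 1" g]) (use \<open>c > 0\<close> \<open>C1 \<ge> 0\<close> g_meas g_bound repr in \<open>auto intro: add_nonneg_pos\<close>)
qed

text \<open>The pointwise estimate and the upper type of \<Psi> give |f z| \<le> k s at the point s
  where the dual weight is \<Phi>(s)/s. The monotone quotient compares this value with \<Phi> at |f
  z| / k.\<close>

lemma dual_weight_mult_le:
  fixes \<alpha> :: real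
  assumes \<alpha>: "\<alpha> > -1"
  defines "N \<equiv> real CARD('n::finite) + 1 + \<alpha>"
  obtains C where "C > 0" "\<And>(f :: complex ^ 'n \<Rightarrow> complex) z. holomorphic_ball f \<Longrightarrow> bounded (f ` ball 0 1) \<Longrightarrow>
      (\<integral>\<^sup>+w. ennreal (\<Phi> (cmod (f w))) \<partial>weighted_measure \<alpha>) \<le> 1 \<Longrightarrow> norm z < 1 \<Longrightarrow>
      dual_weight \<Phi> ((1 - (norm z)\<^sup>2) powr N) * cmod (f z) \<le> C * \<Phi> (cmod (f z))"
proof (rule pointwise_estimate[OF \<alpha>, where 'n='n], goal_cases)
  case (1 C0)
  obtain K where K: "K \<ge> 1" "\<And>u v. 0 < u \<Longrightarrow> u \<le> v \<Longrightarrow> \<Psi> v \<le> K * (v / u) powr (1 / p) * \<Psi> u"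
    using psi_upper_type by blast
  \<comment> \<open>The upper type of \<Psi> is stated for increasing arguments, so the factor must
    be at least 1.\<close>
  define C2 where "C2 = max 1 C0"
  define k where "k = K * C2 powr (1 / p)"
  have k: "k \<ge> 1"
    unfolding k_def using K(1) p mult_mono[of 1 K 1 "C2 powr (1 / p)"] by (simp add: C2_def ge_one_powr_ge_zero)
  show ?case
  proof (rule that[of k])
    show "k > 0" using k by simp
    fix f :: "complex ^ 'n \<Rightarrow> complex" and z :: "complex ^ 'n"
    assume f: "holomorphic_ball f" "bounded (f ` ball 0 1)" "(\<integral>\<^sup>+w. ennreal (\<Phi> (cmod (f w))) \<partial>weighted_measure \<alpha>) \<le> 1"
      and z: "norm z < 1"
    define y where "y = 1 - (norm z)\<^sup>2"
    have y: "y > 0" using norm_lt_1_iff_square[of z] z by (simp add: y_def)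
    define s where "s = \<Psi> (y powr (- N))"
    have s: "s > 0" unfolding s_def using y by (intro psi_pos) simp
    have "\<Phi> (cmod (f z)) * y powr N \<le> C0" using 1(3)[OF f z] by (simp add: N_def y_def)
    also have "\<dots> \<le> C2" by (simp add: C2_def)
    finally have "\<Phi> (cmod (f z)) \<le> C2 * y powr (- N)" using y by (simp add: powr_minus field_simps)
    then have "cmod (f z) \<le> \<Psi> (C2 * y powr (- N))" by (subst le_psi_iff) (auto simp: C2_def)
    also have "\<dots> \<le> K * (C2 * y powr (- N) / y powr (- N)) powr (1 / p) * \<Psi> (y powr (- N))"
      using y by (intro K(2)) (auto simp: C2_def)
    also have "\<dots> = k * s" using y by (simp add: k_def s_def)
    finally have le: "cmod (f z) / k \<le> s" using k by (simp add: field_simps)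
    have dw: "dual_weight \<Phi> (y powr N) = \<Phi> s / s"
    proof -
      have "dual_weight \<Phi> (y powr N) = 1 / (y powr N * s)" unfolding s_def by (rule dual_weight_eq[OF y])
      also have "\<dots> = \<Phi> s / s" unfolding s_def using y by (simp add: phi_psi powr_minus field_simps)
      finally show ?thesis .
    qed
    show "dual_weight \<Phi> ((1 - (norm z)\<^sup>2) powr N) * cmod (f z) \<le> k * \<Phi> (cmod (f z))"
    proof (cases "f z = 0")
      case False
      then have "\<Phi> s / s \<le> \<Phi> (cmod (f z) / k) / (cmod (f z) / k)"
        using le k by (intro phi_quotient) auto
      also have "\<dots> \<le> \<Phi> (cmod (f z)) / (cmod (f z) / k)"
        using k False by (intro divide_right_mono phi_mono) (auto simp: field_simps)
      finally show ?thesis using False k by (simp add: dw[unfolded y_def] field_simps)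
    qed simp
  qed
qed

end

section \<open>Boundedness of the small Hankel operator\<close>

lemma small_hankel_divide:
  "small_hankel \<alpha> b (\<lambda>w. f w / of_real r) z = small_hankel \<alpha> b f z / of_real r"
proof -
  have "small_hankel \<alpha> b (\<lambda>w. f w / of_real r) z = (LINT w|weighted_measure \<alpha>.
      (b w * cnj (f w) / (1 - hermitian_inner z w) powr of_real (real CARD('a) + 1 + \<alpha>)) / of_real r)"
    by (simp add: small_hankel_def bergman_projection_def mult.commute)
  then show ?thesis
    by (simp only: small_hankel_def bergman_projection_def integral_divide_zero)
qed

text \<open>The L^1 bound C C' for \<open>g\<close> times the conjugate of \<open>f\<close> is
  uniform over all \<open>f\<close> of modular at most 1, so a single \<open>A\<close> serves for
  all their images. Homogeneity in \<open>f\<close> then passes from modulars to Luxemburg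
  norms.\<close>

lemma sufficiency:
  fixes b :: "complex ^ 'n \<Rightarrow> complex"
  assumes \<alpha>: "\<alpha> > -1" and "growth \<Phi>1 p" "growth \<Phi>2 p"
    and dini: "(\<integral>\<^sup>+ t\<in>{1..}. ennreal (\<Phi>2 t / t\<^sup>2) \<partial>lborel) < \<infinity>"
    and b: "b \<in> bergman_orlicz \<alpha> (\<lambda>t. t\<^sup>2)"
    and Gamma: "b \<in> Gamma_space \<alpha> (1 / p - 1) (dual_weight \<Phi>1)"
  shows "hankel_extends_bounded \<alpha> \<Phi>1 \<Phi>2 b"
proof -
  interpret G1: growth \<Phi>1 p by fact
  interpret G2: growth \<Phi>2 p by fact
  define N where "N = real CARD('n) + 1 + \<alpha>"
  have N: "N > 0" using \<alpha> by (simp add: N_def add_pos_nonneg)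
  note b2 = bergman_orlicz_2D[OF \<alpha> b]
  obtain g C where C: "C > 0" and g: "g \<in> borel_measurable (weighted_measure \<alpha>)"
    "\<And>z. norm z < 1 \<Longrightarrow> cmod (g z) \<le> C * dual_weight \<Phi>1 ((1 - (norm z)\<^sup>2) powr N)"
    "\<And>z. norm z < 1 \<Longrightarrow> (LINT w|weighted_measure \<alpha>. g w * kernel_power N (hermitian_inner z w)) = b z"
    by (rule G1.symbol_representation[OF \<alpha> b Gamma, folded N_def]) (rule that)
  obtain C' where C': "C' > 0" "\<And>(f :: complex ^ 'n \<Rightarrow> complex) z. holomorphic_ball f \<Longrightarrow> bounded (f ` ball 0 1) \<Longrightarrow>
      (\<integral>\<^sup>+w. ennreal (\<Phi>1 (cmod (f w))) \<partial>weighted_measure \<alpha>) \<le> 1 \<Longrightarrow> norm z < 1 \<Longrightarrow>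
      dual_weight \<Phi>1 ((1 - (norm z)\<^sup>2) powr N) * cmod (f z) \<le> C' * \<Phi>1 (cmod (f z))"
    using G1.dual_weight_mult_le[OF \<alpha>, where 'n='n] unfolding N_def by blast
  obtain Cw where Cw: "Cw > 0" "\<And>(g :: complex ^ 'n \<Rightarrow> ennreal) l. g \<in> borel_measurable (weighted_measure \<alpha>) \<Longrightarrow> l > 0 \<Longrightarrow>
      ennreal l * emeasure (weighted_measure \<alpha>)
        {z \<in> ball 0 1. ennreal l < (\<integral>\<^sup>+w. g w * ennreal (bdist z w powr (- N)) \<partial>weighted_measure \<alpha>)}
      \<le> ennreal Cw * (\<integral>\<^sup>+w. g w \<partial>weighted_measure \<alpha>)"
    using bergman_kernel_weak_type[OF \<alpha>, where 'n='n] unfolding N_def by blast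
  define C1 where "C1 = Cw * (C * C')"
  have C1: "C1 > 0" using C C' Cw by (simp add: C1_def)
  obtain A where A: "A > 0" "\<And>h :: complex ^ 'n \<Rightarrow> complex. h \<in> borel_measurable (weighted_measure \<alpha>) \<Longrightarrow>
    (\<And>l. l > 0 \<Longrightarrow> ennreal l * emeasure (weighted_measure \<alpha>) {z \<in> ball 0 1. l < cmod (h z)} \<le> ennreal C1) \<Longrightarrow>
    (\<integral>\<^sup>+z. ennreal (\<Phi>2 (cmod (h z) / A)) \<partial>weighted_measure \<alpha>) \<le> 1"
    using G2.weak_type_orlicz[OF \<alpha> C1 dini, where 'n='n] by blast
  have unit: "(\<integral>\<^sup>+z. ennreal (\<Phi>2 (cmod (small_hankel \<alpha> b f z) / A)) \<partial>weighted_measure \<alpha>) \<le> 1"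
    if f: "holomorphic_ball f" "bounded (f ` ball 0 1)" "(\<integral>\<^sup>+w. ennreal (\<Phi>1 (cmod (f w))) \<partial>weighted_measure \<alpha>) \<le> 1"
    for f :: "complex ^ 'n \<Rightarrow> complex"
  proof (rule A(2))
    show "small_hankel \<alpha> b f \<in> borel_measurable (weighted_measure \<alpha>)"
      by (intro borel_measurable_weighted_continuous holomorphic_ball_imp_continuous_on
        holomorphic_ball_small_hankel b2(4) f)
    fix l :: real assume l: "l > 0"
    have fm: "f \<in> borel_measurable (weighted_measure \<alpha>)"
      by (intro borel_measurable_weighted_continuous holomorphic_ball_imp_continuous_on f)
    define G where "G w = ennreal (cmod (g w * cnj (f w)))" for w
    note [measurable] = fm g(1) borel_measurable_weighted_ident
    have G_meas [measurable]: "G \<in> borel_measurable (weighted_measure \<alpha>)" unfolding G_def[abs_def] by measurable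
    have G_le: "G w \<le> ennreal (C * C') * ennreal (\<Phi>1 (cmod (f w)))" if w: "norm w < 1" for w
    proof -
      have "cmod (g w * cnj (f w)) \<le> C * dual_weight \<Phi>1 ((1 - (norm w)\<^sup>2) powr N) * cmod (f w)"
        using g(2)[OF w] by (simp add: norm_mult mult_right_mono)
      also have "\<dots> \<le> C * (C' * \<Phi>1 (cmod (f w)))"
        using C'(2)[OF f w] C by (simp add: mult.assoc mult_left_mono)
      finally show ?thesis
        using C C' by (simp add: G_def G1.phi_nonneg mult.assoc ennreal_leI flip: ennreal_mult)
    qed
    have "(\<integral>\<^sup>+w. G w \<partial>weighted_measure \<alpha>) \<le> (\<integral>\<^sup>+w. ennreal (C * C') * ennreal (\<Phi>1 (cmod (f w))) \<partial>weighted_measure \<alpha>)"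
      using G_le by (intro nn_integral_mono) simp
    also have "\<dots> = ennreal (C * C') * (\<integral>\<^sup>+w. ennreal (\<Phi>1 (cmod (f w))) \<partial>weighted_measure \<alpha>)"
      using G1.borel_measurable_phi_cmod[OF fm, of 1] by (intro nn_integral_cmult) simp
    also have "\<dots> \<le> ennreal (C * C') * 1" using f(3) by (intro mult_left_mono) auto
    finally have G_int: "(\<integral>\<^sup>+w. G w \<partial>weighted_measure \<alpha>) \<le> ennreal (C * C')" by simp
    have rep: "small_hankel \<alpha> b f z = (LINT w|weighted_measure \<alpha>. g w * cnj (f w) * kernel_power N (hermitian_inner z w))"
      if z: "norm z < 1" for z
    proof -
      define V where "V w = f w * kernel_power N (hermitian_inner w z)" for w
      have V: "holomorphic_ball V"
        unfolding V_def by (intro holomorphic_ball_mult f holomorphic_ball_inner[OF holomorphic_kernel_power z])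
      obtain BV where BV: "\<And>w. norm w < 1 \<Longrightarrow> cmod (kernel_power N (hermitian_inner z w)) \<le> BV"
        using inner_compose_bounded[OF holomorphic_kernel_power z] by blast
      obtain Bf where Bf: "\<forall>w\<in>ball 0 1. cmod (f w) \<le> Bf" using f(2) by (auto simp: bounded_iff)
      have cn: "cnj (kernel_power N (hermitian_inner w z)) = kernel_power N (hermitian_inner z w)" if "norm w < 1" for w
        by (rule cnj_kernel_power[OF that z])
      have "cmod (V w) \<le> Bf * BV" if w: "norm w < 1" for w
      proof -
        have "cmod (kernel_power N (hermitian_inner w z)) \<le> BV" using BV[OF w] cn[OF w] by (metis complex_mod_cnj)
        moreover have "cmod (f w) \<le> Bf" using Bf w by simp
        moreover have "0 \<le> Bf" using calculation(2) norm_ge_zero order_trans by blast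
        ultimately show ?thesis unfolding V_def norm_mult by (intro mult_mono) auto
      qed
      then have Vb: "bounded (V ` ball 0 1)" unfolding bounded_iff by (intro exI[of _ "Bf * BV"]) auto
      define e where "e = (\<alpha> + 1) / 2"
      have e: "0 < e" "e < \<alpha> + 0 + 1" "\<alpha> - e > -1" using \<alpha> by (simp_all add: e_def field_simps)
      have gfin: "(\<integral>\<^sup>+w. ennreal (cmod (g w) * (1 - (norm w)\<^sup>2) powr (- e)) \<partial>weighted_measure \<alpha>) < \<infinity>"
      proof -
        have "(\<integral>\<^sup>+w. ennreal (cmod (g w) * (1 - (norm w)\<^sup>2) powr (- e)) \<partial>weighted_measure \<alpha>)
          \<le> (\<integral>\<^sup>+w. ennreal (C * (1 / G1.\<Psi> 1)) * ennreal ((1 - (norm w)\<^sup>2) powr (- e)) \<partial>(weighted_measure \<alpha> :: (complex ^ 'n) measure))"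
        proof (rule nn_integral_mono)
          fix w assume "w \<in> space (weighted_measure \<alpha> :: (complex ^ 'n) measure)"
          then have w: "norm w < 1" by simp
          have "dual_weight \<Phi>1 ((1 - (norm w)\<^sup>2) powr N) \<le> 1 / G1.\<Psi> 1"
            using norm_lt_1_iff_square[of w] w N by (intro G1.dual_weight_bounded) auto
          then have "cmod (g w) \<le> C * (1 / G1.\<Psi> 1)"
            using g(2)[OF w] C by (meson mult_left_mono less_imp_le order_trans)
          then have "cmod (g w) * (1 - (norm w)\<^sup>2) powr (- e) \<le> C * (1 / G1.\<Psi> 1) * (1 - (norm w)\<^sup>2) powr (- e)"
            by (rule mult_right_mono) simp
          then show "ennreal (cmod (g w) * (1 - (norm w)\<^sup>2) powr (- e)) \<le> ennreal (C * (1 / G1.\<Psi> 1)) * ennreal ((1 - (norm w)\<^sup>2) powr (- e))"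
            using C G1.psi_pos[of 1] by (subst ennreal_mult[symmetric]) (auto intro!: ennreal_leI)
        qed
        also have "\<dots> = ennreal (C * (1 / G1.\<Psi> 1)) * (\<integral>\<^sup>+w. ennreal ((1 - (norm w)\<^sup>2) powr (- e)) \<partial>(weighted_measure \<alpha> :: (complex ^ 'n) measure))"
          by (intro nn_integral_cmult borel_measurable_weightedI) measurable
        also have "\<dots> < \<infinity>"
          using nn_integral_weight_powr[OF \<alpha> e(3), where 'n='n] by (simp add: ennreal_mult_less_top)
        finally show ?thesis .
      qed
      \<comment> \<open>The kernel is the conjugate of a function holomorphic in \<open>w\<close>
        and joins \<open>f\<close> in \<open>V\<close>. As \<open>b\<close> is the projection of
        \<open>g\<close>, the pairing formula with t = 0, in effect self-adjointness of the
        projection, replaces \<open>b\<close> by \<open>g\<close>.\<close>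
      have "small_hankel \<alpha> b f z = (LINT w|weighted_measure (\<alpha> + 0). b w * cnj (V w))"
        unfolding small_hankel_def bergman_projection_eq N_def[symmetric] add_0_right
        by (intro Bochner_Integration.integral_cong) (simp_all add: V_def cn mult.assoc)
      also have "\<dots> = (LINT w|weighted_measure (\<alpha> + 0). (LINT x|weighted_measure \<alpha>. g x * kernel_power (real CARD('n) + 1 + \<alpha> + 0) (hermitian_inner w x)) * cnj (V w))"
        by (intro Bochner_Integration.integral_cong) (simp_all add: g(3) N_def[symmetric])
      also have "\<dots> = (LINT w|weighted_measure \<alpha>. g w * cnj (V w))"
        by (rule kernel_pairing[where e=e]) (use \<alpha> e g gfin V Vb in auto)
      also have "\<dots> = (LINT w|weighted_measure \<alpha>. g w * cnj (f w) * kernel_power N (hermitian_inner z w))"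
        by (intro Bochner_Integration.integral_cong) (simp_all add: V_def cn mult.assoc)
      finally show ?thesis .
    qed
    have le: "ennreal (cmod (small_hankel \<alpha> b f z)) \<le> (\<integral>\<^sup>+w. G w * ennreal (bdist z w powr (- N)) \<partial>weighted_measure \<alpha>)"
      if z: "norm z < 1" for z
    proof (cases "integrable (weighted_measure \<alpha>) (\<lambda>w. g w * cnj (f w) * kernel_power N (hermitian_inner z w))")
      case True
      then have "ennreal (cmod (small_hankel \<alpha> b f z)) \<le> (\<integral>\<^sup>+w. ennreal (cmod (g w * cnj (f w) * kernel_power N (hermitian_inner z w))) \<partial>weighted_measure \<alpha>)"
        unfolding rep[OF z] by (rule integral_norm_bound_ennreal)
      also have "\<dots> = (\<integral>\<^sup>+w. G w * ennreal (bdist z w powr (- N)) \<partial>weighted_measure \<alpha>)"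
        by (intro nn_integral_cong) (simp only: norm_mult[of "_ * _" "kernel_power _ _"] cmod_kernel_power G_def ennreal_mult norm_ge_zero powr_ge_zero)
      finally show ?thesis .
    \<comment> \<open>Without integrability the integral has the default value 0 and the bound is
      trivial.\<close>
    qed (simp add: rep[OF z] not_integrable_integral_eq)
    have "{z \<in> space (weighted_measure \<alpha> :: (complex ^ 'n) measure). ennreal l < (\<integral>\<^sup>+w. G w * ennreal (bdist z w powr (- N)) \<partial>weighted_measure \<alpha>)} \<in> sets (weighted_measure \<alpha>)"
    proof -
      interpret finite_measure "weighted_measure \<alpha> :: (complex ^ 'n) measure" by (rule finite_measure_weighted[OF \<alpha>])
      show ?thesis by measurable
    qed
    then have "emeasure (weighted_measure \<alpha>) {z \<in> ball 0 1. l < cmod (small_hankel \<alpha> b f z)}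
      \<le> emeasure (weighted_measure \<alpha>) {z \<in> ball 0 1. ennreal l < (\<integral>\<^sup>+w. G w * ennreal (bdist z w powr (- N)) \<partial>weighted_measure \<alpha>)}"
    proof (intro emeasure_mono)
      have "ennreal l < (\<integral>\<^sup>+w. G w * ennreal (bdist z w powr (- N)) \<partial>weighted_measure \<alpha>)"
        if "norm z < 1" "l < cmod (small_hankel \<alpha> b f z)" for z
        using le[OF that(1)] that(2) l by (meson ennreal_lessI less_le_trans less_trans)
      then show "{z \<in> ball 0 1. l < cmod (small_hankel \<alpha> b f z)}
        \<subseteq> {z \<in> ball 0 1. ennreal l < (\<integral>\<^sup>+w. G w * ennreal (bdist z w powr (- N)) \<partial>weighted_measure \<alpha>)}" by auto
    qed simp
    then have "ennreal l * emeasure (weighted_measure \<alpha>) {z \<in> ball 0 1. l < cmod (small_hankel \<alpha> b f z)}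
      \<le> ennreal l * emeasure (weighted_measure \<alpha>) {z \<in> ball 0 1. ennreal l < (\<integral>\<^sup>+w. G w * ennreal (bdist z w powr (- N)) \<partial>weighted_measure \<alpha>)}"
      by (rule mult_left_mono) simp
    also have "\<dots> \<le> ennreal Cw * (\<integral>\<^sup>+w. G w \<partial>weighted_measure \<alpha>)" by (rule Cw(2)[OF G_meas l])
    also have "\<dots> \<le> ennreal Cw * ennreal (C * C')" using G_int by (rule mult_left_mono) simp
    also have "\<dots> = ennreal C1" using Cw C C' by (simp add: C1_def flip: ennreal_mult)
    finally show "ennreal l * emeasure (weighted_measure \<alpha>) {z \<in> ball 0 1. l < cmod (small_hankel \<alpha> b f z)} \<le> ennreal C1" .
  qed
  show ?thesis
    unfolding hankel_extends_bounded_def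
  proof (intro exI[of _ A] allI impI)
    fix f :: "complex ^ 'n \<Rightarrow> complex" assume f: "holomorphic_ball f \<and> bounded (f ` ball 0 1)"
    \<comment> \<open>Dividing by \<open>A\<close> lets the left side be tested as a lower bound for
      each admissible \<open>r\<close>; if there is none, the infimum is infinite and the same
      argument applies.\<close>
    have "lux_norm \<alpha> \<Phi>2 (small_hankel \<alpha> b f) / ennreal A \<le> lux_norm \<alpha> \<Phi>1 f"
      unfolding lux_norm_def[of \<alpha> \<Phi>1 f]
    proof (rule Inf_greatest)
      fix x assume "x \<in> {ennreal r |r. r > 0 \<and> (\<integral>\<^sup>+ z. ennreal (\<Phi>1 (cmod (f z) / r)) \<partial>weighted_measure \<alpha>) \<le> 1}"
      then obtain r where r: "x = ennreal r" "r > 0" "(\<integral>\<^sup>+ z. ennreal (\<Phi>1 (cmod (f z) / r)) \<partial>weighted_measure \<alpha>) \<le> 1"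
        by blast
      have "bounded ((\<lambda>z. f z / of_real r) ` ball 0 1)"
      proof -
        obtain B where "\<forall>z\<in>ball 0 1. cmod (f z) \<le> B" using f by (auto simp: bounded_iff)
        then show ?thesis
          unfolding bounded_iff using r(2) by (intro exI[of _ "B / r"]) (auto simp: norm_divide divide_right_mono)
      qed
      then have "(\<integral>\<^sup>+z. ennreal (\<Phi>2 (cmod (small_hankel \<alpha> b (\<lambda>z. f z / of_real r) z) / A)) \<partial>weighted_measure \<alpha>) \<le> 1"
        using f r by (intro unit holomorphic_ball_divide) (auto simp: norm_divide)
      then have "(\<integral>\<^sup>+z. ennreal (\<Phi>2 (cmod (small_hankel \<alpha> b f z) / (A * r))) \<partial>weighted_measure \<alpha>) \<le> 1"
        using r(2) by (simp add: small_hankel_divide norm_divide mult.commute)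
      then have "lux_norm \<alpha> \<Phi>2 (small_hankel \<alpha> b f) \<le> ennreal (A * r)"
        using A(1) r(2) by (intro lux_norm_le) auto
      also have "\<dots> = ennreal r * ennreal A" using A(1) r(2) by (simp add: mult.commute flip: ennreal_mult)
      finally show "lux_norm \<alpha> \<Phi>2 (small_hankel \<alpha> b f) / ennreal A \<le> x"
        unfolding r(1) using A(1) by (intro divide_le_posI_ennreal) (auto simp: mult.commute)
    qed
    then have "ennreal A * (lux_norm \<alpha> \<Phi>2 (small_hankel \<alpha> b f) / ennreal A) \<le> ennreal A * lux_norm \<alpha> \<Phi>1 f"
      by (rule mult_left_mono) simp
    then show "lux_norm \<alpha> \<Phi>2 (small_hankel \<alpha> b f) \<le> ennreal A * lux_norm \<alpha> \<Phi>1 f"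
      using A(1) by (simp add: ennreal_times_divide mult.commute[of "ennreal A"] ennreal_mult_divide_eq)
  qed
qed

theorem corollary4p7:
  fixes \<alpha> p :: real and \<Phi>1 \<Phi>2 :: "real \<Rightarrow> real" and b :: "complex ^ 'n \<Rightarrow> complex"
  assumes "\<alpha> > -1" and "0 < p" and "p \<le> 1"
    and "\<Phi>1 \<in> growth_class p" and "\<Phi>2 \<in> growth_class p"
    and "(\<integral>\<^sup>+ t\<in>{1..}. ennreal (\<Phi>2 t / t\<^sup>2) \<partial>lborel) < \<infinity>"
    and "b \<in> bergman_orlicz \<alpha> (\<lambda>t. t\<^sup>2)"
  shows "hankel_extends_bounded \<alpha> \<Phi>1 \<Phi>2 b \<longleftrightarrow>
    b \<in> Gamma_space \<alpha> (1 / p - 1) (dual_weight \<Phi>1)"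
proof
  have g: "growth \<Phi>1 p" "growth \<Phi>2 p" using assms by (simp_all add: growth_def)
  note b = bergman_orlicz_2D[OF assms(1,7)]
  {
    assume "hankel_extends_bounded \<alpha> \<Phi>1 \<Phi>2 b"
    then obtain B where "B > 0" "\<And>f. holomorphic_ball f \<Longrightarrow> bounded (f ` ball 0 1) \<Longrightarrow>
      (\<integral>\<^sup>+w. ennreal (\<Phi>1 (cmod (f w))) \<partial>weighted_measure \<alpha>) \<le> 1 \<Longrightarrow>
      cmod (LINT w|weighted_measure \<alpha>. b w * cnj (f w)) \<le> B"
      using hankel_functional_bound[OF assms(1) g(2) b(4)] by blast
    then show "b \<in> Gamma_space \<alpha> (1 / p - 1) (dual_weight \<Phi>1)"
      by (rule growth.necessity[OF g(1) assms(1) b(1,4)])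
  }
  show "hankel_extends_bounded \<alpha> \<Phi>1 \<Phi>2 b" if "b \<in> Gamma_space \<alpha> (1 / p - 1) (dual_weight \<Phi>1)"
    using sufficiency[OF assms(1) g assms(6,7) that] .
qed

end
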